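(* Let $L>0$, $I_L=(0,L)$, and let $\theta,\phi\in BV(I_L)$ be continuous functions of bounded variation. Let $$\Omega(s)=\begin{pmatrix}0&\theta(s)&0\\-\theta(s)&0&\phi(s)\\0&-\phi(s)&0\end{pmatrix},\qquad s\in I_L .$$ Then the system $$DG=-(G^\top)^{-1}D\Omega,\qquad G(0)=\mathbb I_3$$ admits a unique continuous solution $G\in BV(I_L,SO(3))$. Moreover, setting $\mathbf t(s)=G(s)\mathbf e_1$, $\mathbf n(s)=G(s)\mathbf e_2$, $\mathbf b(s)=G(s)\mathbf e_3$, $k(s)=\theta'(s)$ and $\tau(s)=\phi'(s)$, the Frenet--Serret system $$\mathbf t'=k\,\mathbf n,\quad \mathbf n'=-k\,\mathbf t+\tau\,\mathbf b,\quad \mathbf b'=-\tau\,\mathbf n$$ holds for Lebesgue-a.e. $s\in I_L$, with $\mathbf t(0)=\mathbf e_1$, $\mathbf n(0)=\mathbf e_2$, $\mathbf b(0)=\mathbf e_3$. Finally, if $\theta$ is strictly increasing, there exists a unique (up to rigid motions) rectifiable curve $\mathbf c:[0,L]\to\mathbb R^3$ of class $C^1$, parameterized in arc-length, with tantrix $\mathbf c'(s)=\mathbf t(s)$ for every $s\in I_L$, and with finite total curvature $$\mathrm{TC}(\mathbf c)=D\theta(I_L)=\theta(L)-\theta(0).$$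
   Context: $(\mathbf e_1,\mathbf e_2,\mathbf e_3)$ is the canonical basis of $\mathbb R^3$ (column vectors), $\mathbb I_3$ the identity matrix. $BV(I_L,X)$ denotes the functions of bounded variation on $I_L$ with values in $X$ a.e.; for a BV function $u$, $u'$ denotes the a.e. derivative (the density of the absolutely continuous part of $Du$), $u(0)=u(0^+)$, $u(L)=u(L^-)$, and $u$ is called continuous if $Du$ has no atomic part (continuous representative). The first line of the system is an equality of matrix-valued Borel measures on $I_L$, with $G$ on the right-hand side the precise representative $\frac12(G(s^+)+G(s^-))$, required to be invertible for every $s$. The rotation of a polygonal curve is the sum of the turning angles at its interior vertices, and the total curvature $\mathrm{TC}(\mathbf c)$ of a rectifiable curve is the supremum of the rotations of the polygonal curves inscribed in $\mathbf c$. *)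

theory Defs
  imports "HOL-Analysis.Analysis"
begin

subsection \<open>Functions of bounded variation of one variable\<close>

text \<open>The library has no signed measures.  A finite signed Borel measure on an open set \<open>I\<close> is
  represented by a pair \<open>(P, N)\<close> of finite positive Borel measures on \<open>I\<close>, and it is \<open>P - N\<close>.\<close>

definition finite_borel_measure_on :: "real set \<Rightarrow> real measure \<Rightarrow> bool" where
  "finite_borel_measure_on I M \<longleftrightarrow> sets M = sets (restrict_space borel I) \<and> finite_measure M"

definition mutually_singular :: "'a measure \<Rightarrow> 'a measure \<Rightarrow> bool" where
  "mutually_singular P N \<longleftrightarrow> (\<exists>A\<in>sets P. emeasure P (space P - A) = 0 \<and> emeasure N A = 0)"

definition test_function_on :: "real set \<Rightarrow> (real \<Rightarrow> real) \<Rightarrow> bool" where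
  "test_function_on I \<psi> \<longleftrightarrow>
     (\<forall>x. \<psi> differentiable (at x)) \<and> continuous_on UNIV (deriv \<psi>) \<and>
     (\<exists>K. compact K \<and> K \<subseteq> I \<and> (\<forall>x. x \<notin> K \<longrightarrow> \<psi> x = 0))"

definition has_distributional_derivative ::
    "real set \<Rightarrow> (real \<Rightarrow> real) \<Rightarrow> real measure \<Rightarrow> real measure \<Rightarrow> bool" where
  "has_distributional_derivative I u P N \<longleftrightarrow>
     finite_borel_measure_on I P \<and> finite_borel_measure_on I N \<and>
     (\<forall>\<psi>. test_function_on I \<psi> \<longrightarrow>
        (LINT s:I|lborel. u s * deriv \<psi> s) = - ((LINT s|P. \<psi> s) - (LINT s|N. \<psi> s)))"

definition BV_on :: "real set \<Rightarrow> (real \<Rightarrow> real) \<Rightarrow> bool" where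
  "BV_on I u \<longleftrightarrow> set_integrable lborel I u \<and> (\<exists>P N. has_distributional_derivative I u P N)"

text \<open>The Jordan decomposition of \<open>Du\<close>, i.e. the only mutually singular pair representing it.
  Only meaningful if \<open>u\<close> is of bounded variation on the open set \<open>I\<close>.\<close>

definition Jordan_parts :: "real set \<Rightarrow> (real \<Rightarrow> real) \<Rightarrow> real measure \<times> real measure" where
  "Jordan_parts I u =
     (THE PN. has_distributional_derivative I u (fst PN) (snd PN) \<and>
              mutually_singular (fst PN) (snd PN))"

definition D_pos :: "real set \<Rightarrow> (real \<Rightarrow> real) \<Rightarrow> real measure" where
  "D_pos I u = fst (Jordan_parts I u)"

definition D_neg :: "real set \<Rightarrow> (real \<Rightarrow> real) \<Rightarrow> real measure" where
  "D_neg I u = snd (Jordan_parts I u)"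

definition D_measure :: "real set \<Rightarrow> (real \<Rightarrow> real) \<Rightarrow> real set \<Rightarrow> real" where
  "D_measure I u B = measure (D_pos I u) B - measure (D_neg I u) B"

definition D_integrable :: "real set \<Rightarrow> (real \<Rightarrow> real) \<Rightarrow> (real \<Rightarrow> real) \<Rightarrow> bool" where
  "D_integrable I u f \<longleftrightarrow> integrable (D_pos I u) f \<and> integrable (D_neg I u) f"

definition D_integral :: "real set \<Rightarrow> (real \<Rightarrow> real) \<Rightarrow> (real \<Rightarrow> real) \<Rightarrow> real set \<Rightarrow> real" where
  "D_integral I u f B = (LINT s:B|D_pos I u. f s) - (LINT s:B|D_neg I u. f s)"

text \<open>\<open>f\<close> is the density of the absolutely continuous part in the Lebesgue decomposition of \<open>Du\<close>:
  the remainder \<open>Du - f ds\<close> is concentrated on a Lebesgue null set \<open>Z\<close>.\<close>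

definition is_ac_density :: "real set \<Rightarrow> (real \<Rightarrow> real) \<Rightarrow> (real \<Rightarrow> real) \<Rightarrow> bool" where
  "is_ac_density I u f \<longleftrightarrow> set_integrable lborel I f \<and>
     (\<exists>Z\<in>null_sets lborel. \<forall>B\<in>sets borel. B \<subseteq> I - Z \<longrightarrow>
        D_measure I u B = (LINT s:B|lborel. f s))"

text \<open>The a.e. derivative \<open>u'\<close>, determined up to Lebesgue null sets only; \<open>SOME\<close> picks
  a representative, so it should only occur in statements holding almost everywhere.\<close>

definition ae_deriv :: "real set \<Rightarrow> (real \<Rightarrow> real) \<Rightarrow> real \<Rightarrow> real" where
  "ae_deriv I u = (SOME f. is_ac_density I u f)"

definition ae_vector_deriv :: "real set \<Rightarrow> (real \<Rightarrow> real^3) \<Rightarrow> real \<Rightarrow> real^3" where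
  "ae_vector_deriv I v s = (\<chi> i. ae_deriv I (\<lambda>r. v r $ i) s)"

text \<open>No atoms, and \<open>u\<close> itself is the continuous representative of its a.e.-class.\<close>

definition continuous_BV_on :: "real set \<Rightarrow> (real \<Rightarrow> real) \<Rightarrow> bool" where
  "continuous_BV_on I u \<longleftrightarrow>
     BV_on I u \<and> (\<forall>s\<in>I. D_measure I u {s} = 0) \<and> continuous_on I u"


subsection \<open>The system \<open>DG = - (G\<^sup>T)\<^sup>-\<^sup>1 D\<Omega>\<close>\<close>

definition Omega :: "(real \<Rightarrow> real) \<Rightarrow> (real \<Rightarrow> real) \<Rightarrow> real \<Rightarrow> real^3^3" where
  "Omega \<theta> \<phi> s = vector [vector [0, \<theta> s, 0],
                        vector [- \<theta> s, 0, \<phi> s],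
                        vector [0, - \<phi> s, 0]]"

definition precise_rep :: "(real \<Rightarrow> real^3^3) \<Rightarrow> real \<Rightarrow> real^3^3" where
  "precise_rep G s = (1/2) *\<^sub>R (Lim (at_right s) G + Lim (at_left s) G)"

text \<open>The initial condition is read as \<open>G(0\<^sup>+) = 1\<close>.\<close>

definition solves_system :: "real \<Rightarrow> (real \<Rightarrow> real^3^3) \<Rightarrow> (real \<Rightarrow> real^3^3) \<Rightarrow> bool" where
  "solves_system L \<Omega> G \<longleftrightarrow>
     (let I = {0<..<L}; A = (\<lambda>s. matrix_inv (transpose (precise_rep G s))) in
       (\<forall>s\<in>I. invertible (precise_rep G s)) \<and>
       (\<forall>i j k. D_integrable I (\<lambda>s. \<Omega> s $ k $ j) (\<lambda>s. A s $ i $ k)) \<and>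
       (\<forall>i j. \<forall>B\<in>sets borel. B \<subseteq> I \<longrightarrow>
          D_measure I (\<lambda>s. G s $ i $ j) B =
            - (\<Sum>k\<in>UNIV. D_integral I (\<lambda>s. \<Omega> s $ k $ j) (\<lambda>s. A s $ i $ k) B)) \<and>
       (G \<longlongrightarrow> mat 1) (at_right 0))"

definition continuous_BV_SO3 :: "real set \<Rightarrow> (real \<Rightarrow> real^3^3) \<Rightarrow> bool" where
  "continuous_BV_SO3 I G \<longleftrightarrow>
     (\<forall>i j. continuous_BV_on I (\<lambda>s. G s $ i $ j)) \<and> (AE s\<in>I in lborel. rotation_matrix (G s))"


subsection \<open>Curves, length and total curvature\<close>

definition polygon_length :: "(real^3) list \<Rightarrow> real" where
  "polygon_length xs = (\<Sum>i<length xs - 1. dist (xs ! i) (xs ! Suc i))"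

definition turning_angle :: "real^3 \<Rightarrow> real^3 \<Rightarrow> real" where
  "turning_angle u v = arccos (u \<bullet> v / (norm u * norm v))"

definition polygon_rotation :: "(real^3) list \<Rightarrow> real" where
  "polygon_rotation xs =
     (\<Sum>i<length xs - 2. turning_angle (xs ! Suc i - xs ! i) (xs ! Suc (Suc i) - xs ! Suc i))"

text \<open>Vertex lists of the polygonal curves inscribed in \<open>c\<close> restricted to \<open>[a, b]\<close>.  Consecutive
  vertices are distinct, so that the edges have a direction; lists with fewer than two
  vertices are harmless, as they have length and rotation \<open>0\<close>.\<close>

definition inscribed :: "(real \<Rightarrow> real^3) \<Rightarrow> real \<Rightarrow> real \<Rightarrow> (real^3) list set" where
  "inscribed c a b =
     {map c ts | ts. sorted_wrt (<) ts \<and> set ts \<subseteq> {a..b} \<and> distinct_adj (map c ts)}"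

definition curve_length :: "(real \<Rightarrow> real^3) \<Rightarrow> real \<Rightarrow> real \<Rightarrow> ereal" where
  "curve_length c a b = (SUP xs\<in>inscribed c a b. ereal (polygon_length xs))"

definition total_curvature :: "(real \<Rightarrow> real^3) \<Rightarrow> real \<Rightarrow> real \<Rightarrow> ereal" where
  "total_curvature c a b = (SUP xs\<in>inscribed c a b. ereal (polygon_rotation xs))"

definition rectifiable_curve :: "(real \<Rightarrow> real^3) \<Rightarrow> real \<Rightarrow> real \<Rightarrow> bool" where
  "rectifiable_curve c a b \<longleftrightarrow> continuous_on {a..b} c \<and> curve_length c a b < \<infinity>"

text \<open>One-sided derivatives at the end points.\<close>

definition C1_curve :: "(real \<Rightarrow> real^3) \<Rightarrow> real \<Rightarrow> real \<Rightarrow> bool" where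
  "C1_curve c a b \<longleftrightarrow>
     (\<exists>c'. (\<forall>s\<in>{a..b}. (c has_vector_derivative c' s) (at s within {a..b})) \<and>
           continuous_on {a..b} c')"

definition arc_length_parameterized :: "(real \<Rightarrow> real^3) \<Rightarrow> real \<Rightarrow> real \<Rightarrow> bool" where
  "arc_length_parameterized c a b \<longleftrightarrow> (\<forall>s\<in>{a..b}. curve_length c a s = ereal (s - a))"

definition rigid_motion :: "(real^3 \<Rightarrow> real^3) \<Rightarrow> bool" where
  "rigid_motion f \<longleftrightarrow> (\<exists>R v. rotation_matrix R \<and> f = (\<lambda>x. R *v x + v))"

definition is_arc_length_curve_with_tantrix ::
    "real \<Rightarrow> (real \<Rightarrow> real^3) \<Rightarrow> (real \<Rightarrow> real^3) \<Rightarrow> bool" where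
  "is_arc_length_curve_with_tantrix L t c \<longleftrightarrow>
     rectifiable_curve c 0 L \<and> C1_curve c 0 L \<and> arc_length_parameterized c 0 L \<and>
     (\<forall>s\<in>{0<..<L}. (c has_vector_derivative t s) (at s))"

end

theory Submission
  imports Defs
begin

text \<open>Choose one atomless finite measure \<open>M\<close> on \<open>(0,L)\<close> dominating \<open>D\<theta>\<close>, \<open>D\<phi>\<close> and Lebesgue measure.  With
  \<open>D\<theta> = f M\<close> and \<open>D\<phi> = g M\<close> the system becomes a linear Volterra equation with respect to \<open>M\<close>,
  solved by Picard iteration.  As \<open>M\<close> has no atoms, primitives obey the Leibniz rule; since
  \<open>\<Omega>\<close> is skew, inner products of rows of solutions are then constant, which gives both
  \<open>G G\<^sup>T = 1\<close> and uniqueness.  If Lebesgue measure is \<open>l M\<close>, then \<open>D\<theta>\<close> has absolutely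
  continuous density \<open>f / l\<close>, and likewise for \<open>G\<close>, whence the Frenet--Serret system.

  For the total curvature, \<open>t(b) - t(a)\<close> differs from \<open>(\<theta>(b) - \<theta>(a)) n(a)\<close> by a small multiple of
  \<open>|D\<theta>|(a,b)\<close> on short intervals, so the angle swept by \<open>t\<close> is at most \<open>\<theta>(b) - \<theta>(a)\<close>, and nearly
  attains it along fine partitions.  A secant of the curve is a limit of sums of tangent vectors,
  and the triangle inequality on the sphere bounds the rotation of an inscribed polygon.\<close>

subsection \<open>A smooth approximation of intervals\<close>

text \<open>\<open>Du\<close> is given by a definite description over test functions of class C^1,
  so nothing about it can be computed before the Jordan decomposition is known to be unique; hence
  the explicit spline bumps and their limits. Afterwards signed measures are replaced by densities
  with respect to a positive measure (\<open>is_density\<close>), and \<open>D_measure\<close> and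
  \<open>D_integral\<close> become plain integrals. On orthogonal matrices
  \<open>(G^T)^-1 = G\<close>, so the system, nonlinear as written, is linear along its solutions.
  The data live on the open interval, whereas the initial condition and the total curvature concern
  its end points; primitives make sense on the whole line and supply these values. Since \<theta>
  may grow on a Lebesgue null set, \<open>t\<close> need not be Lipschitz in arc-length, although
  the curve is C^1. Local estimates for \<open>t\<close> are therefore measured in the variation of
  \<theta> and not in length, and the curvature is reached by first-order comparisons at small scale
  instead of by differentiating \<open>t\<close>.\<close>

definition pos_square :: "real \<Rightarrow> real" where
  "pos_square y = (max 0 y)\<^sup>2"

text \<open>Half a second difference of \<open>pos_square\<close>: a quadratic spline climbing from
  0 to 1 across \<open>[0, 2]\<close>. It is C^1, as test functions must be, and the piecewise
  linear hat \<open>tent\<close> is its derivative.\<close>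

definition smooth_step :: "real \<Rightarrow> real" where
  "smooth_step y = (pos_square y - 2 * pos_square (y - 1) + pos_square (y - 2)) / 2"

definition tent :: "real \<Rightarrow> real" where
  "tent y = max 0 y - 2 * max 0 (y - 1) + max 0 (y - 2)"

lemma DERIV_pos_square: "DERIV pos_square x :> 2 * max 0 x"
proof -
  have "pos_square z - pos_square x = (max 0 z + max 0 x) * (if z = x then 0 else (max 0 z - max 0 x))" for z
    by (auto simp: pos_square_def power2_eq_square algebra_simps)
  show ?thesis
  proof (cases x "0 :: real" rule: linorder_cases)
    case less
    have "((\<lambda>_. 0) has_field_derivative 0) (at x)" by simp
    then have "(pos_square has_field_derivative 0) (at x)"
      by (rule has_field_derivative_transform_within_open[where S = "{..<0}"])
        (use less in \<open>auto simp: pos_square_def max_def\<close>)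
    then show ?thesis using less by (simp add: max_def)
  next
    case equal
    \<comment> \<open>At 0 the Caratheodory factor is \<open>max 0\<close>, because
      \<open>pos_square z = max 0 z * z\<close>.\<close>
    then show ?thesis
      by (auto simp: CARAT_DERIV pos_square_def power2_eq_square max_def intro!: exI[of _ "\<lambda>z. max 0 z"] continuous_intros)
  next
    case greater
    have "((\<lambda>y. y\<^sup>2) has_field_derivative 2 * x) (at x)"
      by (auto intro!: derivative_eq_intros)
    then have "(pos_square has_field_derivative 2 * x) (at x)"
      by (rule has_field_derivative_transform_within_open[where S = "{0<..}"])
        (use greater in \<open>auto simp: pos_square_def max_def\<close>)
    then show ?thesis using greater by (simp add: max_def)
  qed
qed

lemma DERIV_smooth_step: "DERIV smooth_step x :> tent x"
  unfolding smooth_step_def tent_def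
  by (auto intro!: derivative_eq_intros DERIV_chain'[OF _ DERIV_pos_square] simp: field_simps)

lemma tent_nonneg: "0 \<le> tent y" and tent_le_1: "tent y \<le> 1"
  by (auto simp: tent_def max_def)

lemma tent_eq_0: "y \<le> 0 \<or> 2 \<le> y \<Longrightarrow> tent y = 0"
  by (auto simp: tent_def max_def)

lemma continuous_on_tent [continuous_intros]:
  "continuous_on A f \<Longrightarrow> continuous_on A (\<lambda>x. tent (f x))"
  unfolding tent_def by (intro continuous_intros)

lemma smooth_step_eq_0: "y \<le> 0 \<Longrightarrow> smooth_step y = 0"
  by (auto simp: smooth_step_def pos_square_def max_def)

lemma smooth_step_eq_1: "2 \<le> y \<Longrightarrow> smooth_step y = 1"
  by (auto simp: smooth_step_def pos_square_def max_def power2_eq_square algebra_simps)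

lemma smooth_step_mono: "x \<le> y \<Longrightarrow> smooth_step x \<le> smooth_step y"
  using DERIV_nonneg_imp_nondecreasing[of x y smooth_step] DERIV_smooth_step tent_nonneg by blast

lemma smooth_step_nonneg: "0 \<le> smooth_step y" and smooth_step_le_1: "smooth_step y \<le> 1"
  using smooth_step_mono[of "min 0 y" y] smooth_step_mono[of y "max 2 y"]
  by (simp_all add: smooth_step_eq_0 smooth_step_eq_1)

text \<open>The step up occupies \<open>[x + d, x + 3 * d]\<close> and the step down
  \<open>[z - 4 * d, z - 2 * d]\<close>, so the support is a compact subset of
  \<open>(x, z)\<close>. The condition \<open>7 * d \<le> z - x\<close> used below says that the two
  ramps do not overlap.\<close>

definition bump :: "real \<Rightarrow> real \<Rightarrow> real \<Rightarrow> real \<Rightarrow> real" where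
  "bump x z d y = smooth_step ((y - (x + d)) / d) - smooth_step ((y - (z - 4 * d)) / d)"

lemma DERIV_bump:
  assumes "d > 0"
  shows "DERIV (bump x z d) y :> tent ((y - (x + d)) / d) / d - tent ((y - (z - 4 * d)) / d) / d"
  unfolding bump_def using assms
  by (auto intro!: derivative_eq_intros DERIV_chain'[OF _ DERIV_smooth_step] simp: field_simps)

lemma deriv_bump:
  assumes "d > 0"
  shows "deriv (bump x z d) = (\<lambda>y. tent ((y - (x + d)) / d) / d - tent ((y - (z - 4 * d)) / d) / d)"
  using DERIV_imp_deriv[OF DERIV_bump[OF assms]] by blast

lemma bump_eq_0:
  assumes "d > 0" "7 * d \<le> z - x" "y \<notin> {x + d..z - 2 * d}"
  shows "bump x z d y = 0"
proof (cases "y < x + d")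
  case True
  then show ?thesis using assms unfolding bump_def
    by (subst (1 2) smooth_step_eq_0) (auto simp: divide_simps)
next
  case False
  then show ?thesis using assms unfolding bump_def
    by (subst (1 2) smooth_step_eq_1) (auto simp: divide_simps)
qed

lemma abs_bump_le_1: "\<bar>bump x z d y\<bar> \<le> 1"
  unfolding bump_def
  using smooth_step_nonneg[of "(y - (x + d)) / d"] smooth_step_le_1[of "(y - (x + d)) / d"]
    smooth_step_nonneg[of "(y - (z - 4 * d)) / d"] smooth_step_le_1[of "(y - (z - 4 * d)) / d"]
  by linarith

lemma bump_eq_1:
  assumes "d > 0" "x + 3 * d \<le> y" "y \<le> z - 4 * d"
  shows "bump x z d y = 1"
  using assms unfolding bump_def
  by (subst smooth_step_eq_1, simp add: divide_simps, subst smooth_step_eq_0) (auto simp: divide_simps)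

lemma test_function_on_bump:
  assumes "d > 0" "7 * d \<le> z - x" "0 \<le> x" "z \<le> L"
  shows "test_function_on {0<..<L} (bump x z d)"
  unfolding test_function_on_def
proof (intro conjI allI)
  show "bump x z d differentiable at y" for y
    using DERIV_bump[OF assms(1)] real_differentiable_def by blast
  show "continuous_on UNIV (deriv (bump x z d))"
    unfolding deriv_bump[OF assms(1)] using assms(1) by (intro continuous_intros) auto
  show "\<exists>K. compact K \<and> K \<subseteq> {0<..<L} \<and> (\<forall>y. y \<notin> K \<longrightarrow> bump x z d y = 0)"
    using assms bump_eq_0[OF assms(1,2)] by (intro exI[of _ "{x + d..z - 2 * d}"]) auto
qed

text \<open>The plateau exhausts the open interval while the support stays inside it, so the end
  points always receive 0 and atoms sitting there are not counted.\<close>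

lemma bump_tendsto_indicator:
  assumes "x < z"
  shows "((\<lambda>d. bump x z d y) \<longlongrightarrow> indicator {x<..<z} y) (at_right 0)"
proof -
  consider "y \<notin> {x<..<z}" | "x < y" "y < z" by fastforce
  then show ?thesis
  proof cases
    case 1
    have "eventually (\<lambda>d. bump x z d y = 0) (at_right 0)"
      using eventually_at_right_real[of 0 "(z - x) / 7"] assms
      by (auto elim!: eventually_mono intro!: bump_eq_0 simp del: atLeastAtMost_iff) (use 1 in auto)
    then show ?thesis using 1 by (simp add: tendsto_eventually)
  next
    case 2
    have "eventually (\<lambda>d. d \<in> {0<..<min ((y - x) / 3) ((z - y) / 4)}) (at_right 0)"
      by (rule eventually_at_right_real) (use 2 in auto)
    then have "eventually (\<lambda>d. bump x z d y = 1) (at_right 0)"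
      by (auto elim!: eventually_mono intro!: bump_eq_1)
    then show ?thesis using 2 by (simp add: tendsto_eventually)
  qed
qed

section \<open>Mollification by scaled tents\<close>

lemma integral_scaled_tent:
  assumes "d > 0" "{a..a + 2 * d} \<subseteq> {0<..<L}"
  shows "set_integrable lborel {0<..<L} (\<lambda>y. tent ((y - a) / d) / d)"
    and "(LINT y:{0<..<L}|lborel. tent ((y - a) / d) / d) = 1"
proof -
  have eq: "indicator {0<..<L} y *\<^sub>R (tent ((y - a) / d) / d) =
      indicator {a..a + 2 * d} y *\<^sub>R (tent ((y - a) / d) / d)" for y
    using assms tent_eq_0[of "(y - a) / d"]
    by (cases "y \<in> {a..a + 2 * d}") (auto simp: indicator_def divide_simps)
  have cont: "continuous_on {a..a + 2 * d} (\<lambda>y. tent ((y - a) / d) / d)"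
    using assms by (intro continuous_intros) auto
  have "set_integrable lborel {a..a + 2 * d} (\<lambda>y. tent ((y - a) / d) / d)"
    by (rule borel_integrable_atLeastAtMost'[OF cont])
  then show "set_integrable lborel {0<..<L} (\<lambda>y. tent ((y - a) / d) / d)"
    unfolding set_integrable_def eq .
  have "(\<integral>y. indicator {a..a + 2 * d} y *\<^sub>R (tent ((y - a) / d) / d) \<partial>lborel) =
      smooth_step ((a + 2 * d - a) / d) - smooth_step ((a - a) / d)"
  proof (rule integral_FTC_atLeastAtMost[where F = "\<lambda>y. smooth_step ((y - a) / d)", OF _ _ cont])
    fix y
    have "DERIV (\<lambda>y. smooth_step ((y - a) / d)) y :> tent ((y - a) / d) / d"
    proof -
      have "DERIV (\<lambda>y. (y - a) / d) y :> 1 / d"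
        using assms(1) by (auto intro!: derivative_eq_intros)
      from DERIV_chain'[OF this DERIV_smooth_step] show ?thesis by simp
    qed
    then show "((\<lambda>y. smooth_step ((y - a) / d)) has_vector_derivative tent ((y - a) / d) / d)
        (at y within {a..a + 2 * d})"
      unfolding has_real_derivative_iff_has_vector_derivative[symmetric] by (rule has_field_derivative_at_within)
  qed (use assms in auto)
  then show "(LINT y:{0<..<L}|lborel. tent ((y - a) / d) / d) = 1"
    unfolding set_lebesgue_integral_def eq using assms by (simp add: smooth_step_eq_0 smooth_step_eq_1)
qed

lemma set_integrable_mult_tent:
  fixes u :: "real \<Rightarrow> real"
  assumes u: "set_integrable lborel A u" and "0 < d"
  shows "set_integrable lborel A (\<lambda>y. u y * (tent ((y - a) / d) / d))"
    (is "set_integrable lborel A (\<lambda>y. u y * ?T y)")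
proof -
  have "integrable lborel (\<lambda>y. indicator A y *\<^sub>R (u y * ?T y))"
  proof (rule Bochner_Integration.integrable_bound)
    show "integrable lborel (\<lambda>y. (1 / d) *\<^sub>R (indicator A y *\<^sub>R u y))"
      using u unfolding set_integrable_def by (rule integrable_scaleR_right)
    have "continuous_on UNIV ?T" using assms(2) by (intro continuous_intros) auto
    then have [measurable]: "?T \<in> borel_measurable borel" by (rule borel_measurable_continuous_onI)
    have "(\<lambda>y. (indicator A y *\<^sub>R u y) * ?T y) \<in> borel_measurable lborel"
      using borel_measurable_integrable[OF u[unfolded set_integrable_def]] by measurable
    then show "(\<lambda>y. indicator A y *\<^sub>R (u y * ?T y)) \<in> borel_measurable lborel"
      by (simp add: mult.assoc)
    show "AE y in lborel. norm (indicator A y *\<^sub>R (u y * ?T y)) \<le>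
        norm ((1 / d) *\<^sub>R (indicator A y *\<^sub>R u y))"
      using assms(2) tent_nonneg tent_le_1
      by (auto simp: indicator_def abs_mult divide_simps intro!: mult_left_le)
  qed
  then show ?thesis unfolding set_integrable_def .
qed

text \<open>The kernel is nonnegative, has mass 1 and lives on \<open>[a d, a d + 2 * d]\<close>,
  which shrinks to \<open>x\<close>. The drifting base point \<open>a d\<close> serves both ramps of
  a bump, whose derivatives are such kernels based at \<open>x + d\<close> and
  \<open>z - 4 * d\<close>.\<close>

lemma mollification_tendsto:
  fixes u :: "real \<Rightarrow> real"
  assumes u: "set_integrable lborel {0<..<L} u" and cont: "isCont u x" and x: "0 < x" "x < L"
    and a: "(a \<longlongrightarrow> x) (at_right 0)"
  shows "((\<lambda>d. LINT y:{0<..<L}|lborel. u y * (tent ((y - a d) / d) / d)) \<longlongrightarrow> u x) (at_right 0)"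
proof (rule tendstoI)
  fix e :: real assume "e > 0"
  then obtain r where r: "r > 0" "\<And>y. dist y x < r \<Longrightarrow> dist (u y) (u x) < e / 2"
    using cont unfolding continuous_at_eps_delta by (metis half_gt_zero)
  \<comment> \<open>A point of the kernel's support has distance below \<open>r' + 2 * r'\<close>
    from \<open>x\<close>, hence the division by 3; it must stay both \<open>r\<close>-close to
    \<open>x\<close> and inside the interval.\<close>
  define r' where "r' = min r (min x (L - x)) / 3"
  have "r' > 0" using r x by (simp add: r'_def)
  have "eventually (\<lambda>d. d \<in> {0<..<r'}) (at_right 0)"
    by (rule eventually_at_right_real) fact
  moreover have "eventually (\<lambda>d. dist (a d) x < r') (at_right 0)"
    using a \<open>r' > 0\<close> by (rule tendstoD)
  ultimately show "eventually (\<lambda>d. dist (LINT y:{0<..<L}|lborel. u y * (tent ((y - a d) / d) / d)) (u x) < e) (at_right 0)"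
  proof eventually_elim
    fix d assume d: "d \<in> {0<..<r'}" "dist (a d) x < r'"
    let ?T = "\<lambda>y. tent ((y - a d) / d) / d"
    have near: "dist y x < r \<and> y \<in> {0<..<L}" if "y \<in> {a d..a d + 2 * d}" for y
    proof -
      have "3 * r' \<le> r" "3 * r' \<le> x" "3 * r' \<le> L - x" unfolding r'_def by simp_all
      then show ?thesis using that d x unfolding dist_real_def atLeastAtMost_iff greaterThanLessThan_iff abs_less_iff
        by linarith
    qed
    then have sub: "{a d..a d + 2 * d} \<subseteq> {0<..<L}" by blast
    have d0: "d > 0" using d by simp
    note T = integral_scaled_tent[OF d0 sub]
    have int: "set_integrable lborel {0<..<L} (\<lambda>y. u y * ?T y)"
      by (rule set_integrable_mult_tent[OF u d0])
    have int2: "set_integrable lborel {0<..<L} (\<lambda>y. u x * ?T y)"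
      by (rule set_integrable_mult_right[OF T(1)])
    have "(LINT y:{0<..<L}|lborel. u y * ?T y) - u x =
        (LINT y:{0<..<L}|lborel. u y * ?T y) - (LINT y:{0<..<L}|lborel. u x * ?T y)"
      using T(2) by simp
    also have "\<dots> = (LINT y:{0<..<L}|lborel. u y * ?T y - u x * ?T y)"
      by (rule set_integral_diff(2)[symmetric, OF int int2])
    finally have "\<bar>(LINT y:{0<..<L}|lborel. u y * ?T y) - u x\<bar> =
        \<bar>LINT y:{0<..<L}|lborel. u y * ?T y - u x * ?T y\<bar>" by (rule arg_cong)
    also have "\<dots> \<le> (LINT y:{0<..<L}|lborel. \<bar>u y * ?T y - u x * ?T y\<bar>)"
      using set_integral_norm_bound[OF set_integral_diff(1)[OF int int2]] by simp
    also have "\<dots> \<le> (LINT y:{0<..<L}|lborel. (e / 2) * ?T y)"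
    proof (rule set_integral_mono)
      show "set_integrable lborel {0<..<L} (\<lambda>y. \<bar>u y * ?T y - u x * ?T y\<bar>)"
        by (rule set_integrable_abs[OF set_integral_diff(1)[OF int int2]])
      show "set_integrable lborel {0<..<L} (\<lambda>y. (e / 2) * ?T y)"
        using T(1) by (rule set_integrable_mult_right)
      show "\<bar>u y * ?T y - u x * ?T y\<bar> \<le> (e / 2) * ?T y" for y
      proof (cases "y \<in> {a d..a d + 2 * d}")
        case True
        then have "\<bar>u y - u x\<bar> \<le> e / 2" using r(2) near by (fastforce simp: dist_real_def)
        then have "\<bar>u y - u x\<bar> * ?T y \<le> (e / 2) * ?T y"
          by (rule mult_right_mono) (use tent_nonneg d0 in simp)
        moreover have "\<bar>u y * ?T y - u x * ?T y\<bar> = \<bar>u y - u x\<bar> * ?T y"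
        proof -
          have "u y * ?T y - u x * ?T y = (u y - u x) * ?T y" by (simp only: left_diff_distrib)
          moreover have "\<bar>?T y\<bar> = ?T y" using tent_nonneg[of "(y - a d) / d"] d0 by simp
          ultimately show ?thesis by (simp only: abs_mult)
        qed
        ultimately show ?thesis by simp
      next
        case False
        then have "?T y = 0" using d0 tent_eq_0[of "(y - a d) / d"] by (auto simp: field_simps)
        then show ?thesis by (simp only: mult_zero_right)
      qed
    qed
    also have "\<dots> = e / 2" using T(2) by simp
    finally show "dist (LINT y:{0<..<L}|lborel. u y * ?T y) (u x) < e"
      using \<open>e > 0\<close> by (simp add: dist_real_def)
  qed
qed

subsection \<open>Jordan decomposition of distributional derivatives\<close>

text \<open>Used for two purposes: to rewrite \<open>P - N = P' - N'\<close> as the equality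
  \<open>P + N' = P' + N\<close> of positive measures, and to dominate several measures at
  once.\<close>

definition sum_measure :: "'a measure \<Rightarrow> 'a measure \<Rightarrow> 'a measure" where
  "sum_measure P N = measure_of (space P) (sets P) (\<lambda>X. emeasure P X + emeasure N X)"

lemma sets_sum_measure [simp, measurable_cong]: "sets (sum_measure P N) = sets P"
  and space_sum_measure [simp]: "space (sum_measure P N) = space P"
  by (simp_all add: sum_measure_def)

lemma emeasure_sum_measure:
  assumes "sets N = sets P"
  shows "emeasure (sum_measure P N) X = emeasure P X + emeasure N X"
proof (cases "X \<in> sets P")
  case True
  show ?thesis unfolding sum_measure_def
  proof (rule emeasure_measure_of_sigma[OF _ _ _ True])
    show "sigma_algebra (space P) (sets P)" by (rule sets.sigma_algebra_axioms)
    show "positive (sets P) (\<lambda>X. emeasure P X + emeasure N X)"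
      by (simp add: positive_def)
    show "countably_additive (sets P) (\<lambda>X. emeasure P X + emeasure N X)"
    proof (rule countably_additiveI)
      fix A :: "nat \<Rightarrow> 'a set" assume A: "range A \<subseteq> sets P" "disjoint_family A" "\<Union> (range A) \<in> sets P"
      then show "(\<Sum>i. emeasure P (A i) + emeasure N (A i)) = emeasure P (\<Union> (range A)) + emeasure N (\<Union> (range A))"
        using assms by (simp add: suminf_add[symmetric] suminf_emeasure)
    qed
  qed
next
  case False
  then show ?thesis using assms by (simp add: emeasure_notin_sets)
qed

lemma finite_measure_sum_measure:
  assumes "finite_measure P" "finite_measure N" "sets N = sets P"
  shows "finite_measure (sum_measure P N)"
  using assms sets_eq_imp_space_eq[OF assms(3)]
  by (auto intro!: finite_measureI simp: emeasure_sum_measure finite_measure.emeasure_finite)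

lemma finite_borel_measure_on_sum_measure:
  assumes "finite_borel_measure_on I P" "finite_borel_measure_on I N"
  shows "finite_borel_measure_on I (sum_measure P N)"
  using assms finite_measure_sum_measure[of P N] by (simp add: finite_borel_measure_on_def)

lemma measure_sum_measure:
  assumes "finite_measure P" "finite_measure N" "sets N = sets P"
  shows "measure (sum_measure P N) X = measure P X + measure N X"
  using assms finite_measure.emeasure_finite[of P X] finite_measure.emeasure_finite[of N X]
  by (simp add: measure_def emeasure_sum_measure enn2real_plus top.not_eq_extremum)

locale interval_measure =
  fixes L :: real and M :: "real measure"
  assumes finite_borel: "finite_borel_measure_on {0<..<L} M"
begin

lemma sets_M: "sets M = sets (restrict_space borel {0<..<L})"
  using finite_borel by (simp add: finite_borel_measure_on_def)

lemma space_M [simp]: "space M = {0<..<L}"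
  using sets_eq_imp_space_eq[OF sets_M] by (simp add: space_restrict_space)

sublocale finite_measure M
  using finite_borel by (simp add: finite_borel_measure_on_def)

lemma measurable_M_eq: "borel_measurable M = borel_measurable (restrict_space borel {0<..<L})"
  by (rule measurable_cong_sets[OF sets_M refl])

lemma borel_measurable_M: "f \<in> borel_measurable borel \<Longrightarrow> f \<in> borel_measurable M"
  unfolding measurable_M_eq by (rule measurable_restrict_space1)

lemma continuous_on_borel_measurable_M:
  fixes f :: "real \<Rightarrow> 'b :: topological_space"
  shows "continuous_on {0<..<L} f \<Longrightarrow> f \<in> borel_measurable M"
  unfolding measurable_M_eq by (rule borel_measurable_continuous_on_restrict)

lemma in_sets_M: "B \<in> sets borel \<Longrightarrow> B \<inter> {0<..<L} \<in> sets M"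
  unfolding sets_M sets_restrict_space by (auto simp: Int_commute)

lemma in_sets_M': "B \<in> sets borel \<Longrightarrow> B \<subseteq> {0<..<L} \<Longrightarrow> B \<in> sets M"
  using in_sets_M[of B] by (simp add: Int_absorb2)

lemma indicator_measurable_M: "B \<in> sets borel \<Longrightarrow> (indicator B :: real \<Rightarrow> real) \<in> borel_measurable M"
  by (rule borel_measurable_M) simp

lemma integrable_mult_bounded:
  fixes f h :: "real \<Rightarrow> real"
  assumes "integrable M h" "f \<in> borel_measurable M" "\<And>x. x \<in> {0<..<L} \<Longrightarrow> \<bar>f x\<bar> \<le> C"
  shows "integrable M (\<lambda>x. f x * h x)"
proof (rule Bochner_Integration.integrable_bound)
  show "integrable M (\<lambda>x. C * h x)" using assms(1) by simp
  show "(\<lambda>x. f x * h x) \<in> borel_measurable M"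
    using assms(2) borel_measurable_integrable[OF assms(1)] by measurable
  show "AE x in M. norm (f x * h x) \<le> norm (C * h x)"
  proof (rule AE_I2)
    fix x assume "x \<in> space M"
    then have "\<bar>f x\<bar> \<le> \<bar>C\<bar>" using assms(3)[of x] by auto
    then show "norm (f x * h x) \<le> norm (C * h x)" by (simp add: abs_mult mult_right_mono)
  qed
qed

lemma set_integrable_borel:
  fixes h :: "real \<Rightarrow> real"
  assumes "integrable M h" "B \<in> sets borel"
  shows "set_integrable M B h"
  unfolding set_integrable_def real_scaleR_def
  by (rule integrable_mult_bounded[where C = 1]) (use assms indicator_measurable_M in \<open>auto split: split_indicator\<close>)

lemma bump_measurable_M: "0 < d \<Longrightarrow> bump x z d \<in> borel_measurable M"
proof (rule continuous_on_borel_measurable_M)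
  assume "0 < d"
  then have "isCont (bump x z d) y" for y using DERIV_bump DERIV_isCont by blast
  then show "continuous_on {0<..<L} (bump x z d)" by (simp add: continuous_at_imp_continuous_on)
qed



end

text \<open>Dominated convergence wants a sequence of widths; the 7 makes the condition
  \<open>7 * d \<le> z - x\<close> hold from \<open>n = 0\<close> on.\<close>

lemma filterlim_bump_width:
  fixes x z :: real
  assumes "x < z"
  shows "filterlim (\<lambda>n. (z - x) / (real n + 7)) (at_right 0) sequentially"
proof (rule tendsto_imp_filterlim_at_right)
  show "(\<lambda>n. (z - x) / (real n + 7)) \<longlonglongrightarrow> 0"
    using LIMSEQ_ignore_initial_segment[OF lim_const_over_n[of "z - x"], of 7] by simp
  show "\<forall>\<^sub>F n in sequentially. (z - x) / (real n + 7) > 0" using assms by simp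
qed


lemma bump_width:
  fixes x z :: real
  assumes "x < z"
  shows "0 < (z - x) / (real n + 7)" "7 * ((z - x) / (real n + 7)) \<le> z - x"
  using assms by (simp_all add: divide_simps) (simp_all add: algebra_simps mult_right_mono)

lemma (in interval_measure) bump_integral_tendsto:
  fixes h :: "real \<Rightarrow> real"
  assumes h: "integrable M h" and "x < z"
  shows "(\<lambda>n. \<integral>s. bump x z ((z - x) / (real n + 7)) s * h s \<partial>M) \<longlonglongrightarrow> (LINT s:{x<..<z}|M. h s)"
  unfolding set_lebesgue_integral_def real_scaleR_def
proof (rule integral_dominated_convergence)
  show "integrable M (\<lambda>s. \<bar>h s\<bar>)" using h by simp
  show "(\<lambda>s. indicator {x<..<z} s * h s) \<in> borel_measurable M"
    using h indicator_measurable_M[of "{x<..<z}"] by measurable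
  show "(\<lambda>s. bump x z ((z - x) / (real n + 7)) s * h s) \<in> borel_measurable M" for n
    using h bump_measurable_M[OF bump_width(1)[OF assms(2)]] by measurable
  show "AE s in M. (\<lambda>n. bump x z ((z - x) / (real n + 7)) s * h s) \<longlonglongrightarrow> indicator {x<..<z} s * h s"
    by (intro AE_I2 tendsto_intros
        filterlim_compose[OF bump_tendsto_indicator[OF assms(2)] filterlim_bump_width[OF assms(2)]])
  show "AE s in M. norm (bump x z ((z - x) / (real n + 7)) s * h s) \<le> \<bar>h s\<bar>" for n
    using abs_bump_le_1 by (intro AE_I2) (simp add: abs_mult mult_left_le_one_le)
qed

section \<open>Uniqueness of the distributional derivative\<close>

lemma interval_measure_derivative:
  assumes "has_distributional_derivative {0<..<L} u P N"
  shows "interval_measure L P" "interval_measure L N"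
  using assms by (simp_all add: interval_measure_def has_distributional_derivative_def)

text \<open>The sequence involves \<open>u\<close> alone. Its limit therefore shows that
  \<open>u\<close> determines \<open>P - N\<close> on open intervals; computing the same limit for
  continuous \<open>u\<close> will give the fundamental theorem of calculus.\<close>

lemma bump_integral_tendsto_distributional_derivative:
  assumes hdd: "has_distributional_derivative {0<..<L} u P N" and x: "0 \<le> x" "x < z" "z \<le> L"
  shows "(\<lambda>n. - (LINT s:{0<..<L}|lborel. u s * deriv (bump x z ((z - x) / (real n + 7))) s))
    \<longlonglongrightarrow> measure P {x<..<z} - measure N {x<..<z}"
proof -
  interpret P: interval_measure L P using hdd by (rule interval_measure_derivative)
  interpret N: interval_measure L N using hdd by (rule interval_measure_derivative)
  have "- (LINT s:{0<..<L}|lborel. u s * deriv (bump x z ((z - x) / (real n + 7))) s) =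
      (\<integral>s. bump x z ((z - x) / (real n + 7)) s * 1 \<partial>P) - (\<integral>s. bump x z ((z - x) / (real n + 7)) s * 1 \<partial>N)" for n
    using hdd test_function_on_bump[OF bump_width[OF x(2)] x(1,3), of n]
    by (simp add: has_distributional_derivative_def)
  moreover have "(\<lambda>n. (\<integral>s. bump x z ((z - x) / (real n + 7)) s * 1 \<partial>P) - (\<integral>s. bump x z ((z - x) / (real n + 7)) s * 1 \<partial>N))
      \<longlonglongrightarrow> (LINT s:{x<..<z}|P. 1) - (LINT s:{x<..<z}|N. 1)"
    by (intro tendsto_diff P.bump_integral_tendsto N.bump_integral_tendsto x) auto
  moreover have "(LINT s:{x<..<z}|P. 1) = measure P {x<..<z}" "(LINT s:{x<..<z}|N. 1) = measure N {x<..<z}"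
    using P.in_sets_M'[of "{x<..<z}"] N.in_sets_M'[of "{x<..<z}"] x
    by (simp_all add: set_lebesgue_integral_def subset_eq)
  ultimately show ?thesis by simp
qed

text \<open>Written with sums, the claim is an equality of two finite positive measures. These are
  determined by rays, and a ray meets \<open>(0, L)\<close> in an open interval or not at all. For
  nonmeasurable \<open>B\<close> all four terms are 0.\<close>

lemma distributional_derivative_unique:
  assumes hdd: "has_distributional_derivative {0<..<L} u P N" "has_distributional_derivative {0<..<L} u P' N'"
  shows "measure P B + measure N' B = measure P' B + measure N B"
proof -
  interpret P: interval_measure L P using hdd(1) by (rule interval_measure_derivative)
  interpret N: interval_measure L N using hdd(1) by (rule interval_measure_derivative)
  interpret P': interval_measure L P' using hdd(2) by (rule interval_measure_derivative)
  interpret N': interval_measure L N' using hdd(2) by (rule interval_measure_derivative)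
  have ivl: "measure P {x<..<z} + measure N' {x<..<z} = measure P' {x<..<z} + measure N {x<..<z}"
    if "0 \<le> x" "x < z" "z \<le> L" for x z
    using LIMSEQ_unique[OF bump_integral_tendsto_distributional_derivative[OF hdd(1) that]
        bump_integral_tendsto_distributional_derivative[OF hdd(2) that]] by simp
  let ?A = "sum_measure P N'" and ?B = "sum_measure P' N"
  interpret A: interval_measure L ?A
    using P.finite_borel N'.finite_borel by (simp add: interval_measure_def finite_borel_measure_on_sum_measure)
  interpret B: interval_measure L ?B
    using P'.finite_borel N.finite_borel by (simp add: interval_measure_def finite_borel_measure_on_sum_measure)
  have meas: "(\<lambda>x. x) \<in> measurable ?A borel" "(\<lambda>x. x) \<in> measurable ?B borel"
    by (intro A.borel_measurable_M B.borel_measurable_M; simp)+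
  have mA: "measure ?A X = measure P X + measure N' X" for X
    by (intro measure_sum_measure) (simp_all add: P.finite_measure_axioms N'.finite_measure_axioms P.sets_M N'.sets_M)
  have mB: "measure ?B X = measure P' X + measure N X" for X
    by (intro measure_sum_measure) (simp_all add: P'.finite_measure_axioms N.finite_measure_axioms P'.sets_M N.sets_M)
  \<comment> \<open>Pushing forward to the line gives Borel measures, for which agreement on rays
    suffices.\<close>
  have "distr ?A borel (\<lambda>x. x) = distr ?B borel (\<lambda>x. x)"
  proof (rule measure_eqI_lessThan)
    fix x :: real
    have "measure ?A ({x<..} \<inter> {0<..<L}) = measure ?B ({x<..} \<inter> {0<..<L})"
    proof (cases "max 0 x < L")
      case True
      have "{x<..} \<inter> {0<..<L} = {max 0 x<..<L}" by auto
      then show ?thesis using ivl[of "max 0 x" L] True by (simp add: mA mB)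
    next
      case False
      then have "{x<..} \<inter> {0<..<L} = {}" by auto
      then show ?thesis by simp
    qed
    then show "emeasure (distr ?A borel (\<lambda>x. x)) {x<..} = emeasure (distr ?B borel (\<lambda>x. x)) {x<..}"
      using meas by (simp add: emeasure_distr A.emeasure_eq_measure B.emeasure_eq_measure)
    show "emeasure (distr ?A borel (\<lambda>x. x)) {x<..} < \<infinity>"
      using meas by (simp add: emeasure_distr A.emeasure_eq_measure)
  qed simp_all
  then have eq: "measure (distr ?A borel (\<lambda>x. x)) X = measure (distr ?B borel (\<lambda>x. x)) X" for X by simp
  have *: "measure ?A (X \<inter> {0<..<L}) = measure ?B (X \<inter> {0<..<L})" if "X \<in> sets borel" for X
    using eq[of X] meas that by (simp add: measure_distr)
  show ?thesis
  proof (cases "B \<in> sets P")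
    case True
    then obtain X where "X \<in> sets borel" "B = X \<inter> {0<..<L}"
      unfolding P.sets_M sets_restrict_space by (auto simp: Int_commute)
    then show ?thesis using * mA mB by simp
  next
    case False
    then show ?thesis using P.sets_M N.sets_M P'.sets_M N'.sets_M by (simp add: measure_notin_sets)
  qed
qed

text \<open>A singular pair is minimal. If \<open>P\<close> is carried by \<open>A\<close> and
  \<open>N\<close> vanishes there, the balance equation on subsets of \<open>A\<close> reads
  \<open>P + N' = P'\<close>, hence
  \<open>P B = P (B \<inter> A) \<le> P' (B \<inter> A) \<le> P' B\<close>. The other three
  inequalities arise likewise.\<close>

lemma mutually_singular_unique:
  assumes fin: "finite_measure P" "finite_measure N" "finite_measure P'" "finite_measure N'"
    and sets: "sets N = sets P" "sets P' = sets P" "sets N' = sets P"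
    and eq: "\<And>B. measure P B + measure N' B = measure P' B + measure N B"
    and sing: "mutually_singular P N" "mutually_singular P' N'"
  shows "P = P' \<and> N = N'"
proof -
  interpret P: finite_measure P by fact
  interpret N: finite_measure N by fact
  interpret P': finite_measure P' by fact
  interpret N': finite_measure N' by fact
  have sp: "space N = space P" "space P' = space P" "space N' = space P"
    using sets sets_eq_imp_space_eq by blast+
  obtain A where A: "A \<in> sets P" "measure P (space P - A) = 0" "measure N A = 0"
    using sing(1) unfolding mutually_singular_def measure_def by force
  obtain A' where A': "A' \<in> sets P" "measure P' (space P - A') = 0" "measure N' A' = 0"
    using sing(2) sets sp unfolding mutually_singular_def measure_def by force
  have le: "measure P B \<le> measure P' B" and le': "measure N B \<le> measure N' B"
    and ge: "measure P' B \<le> measure P B" and ge': "measure N' B \<le> measure N B" if B: "B \<in> sets P" for B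
  proof -
    have [measurable]: "B \<in> sets P" "A \<in> sets P" "A' \<in> sets P" by fact+
    have "B - A \<subseteq> space P - A" "B - A' \<subseteq> space P - A'" using sets.sets_into_space[OF B] by auto
    then have null: "measure P (B - A) = 0" "measure N (B \<inter> A) = 0" "measure P' (B - A') = 0" "measure N' (B \<inter> A') = 0"
      using P.finite_measure_mono[of "B - A" "space P - A"] N.finite_measure_mono[of "B \<inter> A" A]
        P'.finite_measure_mono[of "B - A'" "space P - A'"] N'.finite_measure_mono[of "B \<inter> A'" A']
        A A' sets sp sets.sets_into_space[OF B] by (auto simp: measure_le_0_iff)
    have dec: "measure Q B = measure Q (B \<inter> X) + measure Q (B - X)" if "finite_measure Q" "sets Q = sets P" "X \<in> sets P" for Q X
      using finite_measure.finite_measure_Union[OF that(1), of "B \<inter> X" "B - X"] that B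
      by (auto simp: Int_Diff_Un Int_Diff_disjoint)
    note decs = dec[OF fin(1) refl A(1)] dec[OF fin(2) sets(1) A(1)] dec[OF fin(3) sets(2) A(1)] dec[OF fin(4) sets(3) A(1)]
       dec[OF fin(1) refl A'(1)] dec[OF fin(2) sets(1) A'(1)] dec[OF fin(3) sets(2) A'(1)] dec[OF fin(4) sets(3) A'(1)]
    note nn = measure_nonneg[of P] measure_nonneg[of N] measure_nonneg[of P'] measure_nonneg[of N']
    show "measure P B \<le> measure P' B"
      using decs null eq[of "B \<inter> A"] nn[of "B \<inter> A"] nn[of "B - A"] by linarith
    show "measure N B \<le> measure N' B"
      using decs null eq[of "B - A"] nn[of "B \<inter> A"] nn[of "B - A"] by linarith
    show "measure P' B \<le> measure P B"
      using decs null eq[of "B \<inter> A'"] nn[of "B \<inter> A'"] nn[of "B - A'"] by linarith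
    show "measure N' B \<le> measure N B"
      using decs null eq[of "B - A'"] nn[of "B \<inter> A'"] nn[of "B - A'"] by linarith
  qed
  have "P = P'"
    by (rule measure_eqI) (use le ge sets in \<open>auto simp: P.emeasure_eq_measure P'.emeasure_eq_measure intro!: arg_cong[where f = ennreal] antisym\<close>)
  moreover have "N = N'"
    by (rule measure_eqI) (use le' ge' sets in \<open>auto simp: N.emeasure_eq_measure N'.emeasure_eq_measure intro!: arg_cong[where f = ennreal] antisym\<close>)
  ultimately show ?thesis ..
qed

text \<open>This gives access to the definite description: a mutually singular pair exhibited by
  hand must be the one described.\<close>

lemma Jordan_parts_eqI:
  assumes hdd: "has_distributional_derivative {0<..<L} u P N" and sing: "mutually_singular P N"
  shows "Jordan_parts {0<..<L} u = (P, N)"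
  unfolding Jordan_parts_def
proof (rule the_equality)
  fix PN assume "has_distributional_derivative {0<..<L} u (fst PN) (snd PN) \<and> mutually_singular (fst PN) (snd PN)"
  then have *: "has_distributional_derivative {0<..<L} u (fst PN) (snd PN)" "mutually_singular (fst PN) (snd PN)" by auto
  interpret P: interval_measure L P using hdd by (rule interval_measure_derivative)
  interpret N: interval_measure L N using hdd by (rule interval_measure_derivative)
  interpret P': interval_measure L "fst PN" using *(1) by (rule interval_measure_derivative)
  interpret N': interval_measure L "snd PN" using *(1) by (rule interval_measure_derivative)
  have "P = fst PN \<and> N = snd PN"
    using distributional_derivative_unique[OF hdd *(1)] sing *(2)
    by (intro mutually_singular_unique)
      (simp_all add: P.sets_M N.sets_M P'.sets_M N'.sets_M P.finite_measure_axioms N.finite_measure_axioms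
        P'.finite_measure_axioms N'.finite_measure_axioms)
  then show "PN = (P, N)" by (simp add: prod_eq_iff)
qed (use assms in simp)

subsection \<open>Primitives\<close>

lemma test_function_onD:
  assumes "test_function_on I \<psi>"
  shows "DERIV \<psi> x :> deriv \<psi> x" "continuous_on A \<psi>" "continuous_on A (deriv \<psi>)"
    and "x \<notin> I \<Longrightarrow> \<psi> x = 0" "x \<notin> I \<Longrightarrow> deriv \<psi> x = 0" "\<exists>C. \<forall>x. \<bar>\<psi> x\<bar> \<le> C"
    and "\<exists>C. \<forall>x. \<bar>deriv \<psi> x\<bar> \<le> C"
proof -
  have D: "DERIV \<psi> x :> deriv \<psi> x" for x
    using assms by (simp add: test_function_on_def DERIV_deriv_iff_real_differentiable)
  then show "DERIV \<psi> x :> deriv \<psi> x" .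
  show c: "continuous_on A \<psi>" for A
    using D DERIV_isCont by (blast intro: continuous_at_imp_continuous_on)
  show c': "continuous_on A (deriv \<psi>)" for A
    using assms continuous_on_subset unfolding test_function_on_def by blast
  obtain K where K: "compact K" "K \<subseteq> I" "\<And>x. x \<notin> K \<Longrightarrow> \<psi> x = 0"
    using assms unfolding test_function_on_def by blast
  have d0: "deriv \<psi> x = 0" if "x \<notin> K" for x
  proof (rule DERIV_imp_deriv)
    show "DERIV \<psi> x :> 0"
      by (rule has_field_derivative_transform_within_open[where S = "- K" and f = "\<lambda>_. 0"])
        (use K that compact_imp_closed in auto)
  qed
  show "x \<notin> I \<Longrightarrow> \<psi> x = 0" "x \<notin> I \<Longrightarrow> deriv \<psi> x = 0" using K d0 by auto
  have bdd: "\<exists>C. \<forall>x. \<bar>f x\<bar> \<le> C" if "continuous_on K f" "\<And>x. x \<notin> K \<Longrightarrow> f x = 0" for f :: "real \<Rightarrow> real"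
  proof -
    have "bounded (f ` K)" using that(1) K(1) compact_continuous_image compact_imp_bounded by blast
    then obtain C where "\<And>x. x \<in> K \<Longrightarrow> \<bar>f x\<bar> \<le> C" unfolding bounded_iff by auto
    then have "\<bar>f x\<bar> \<le> max C 0" for x using that(2)[of x] by (cases "x \<in> K") fastforce+
    then show ?thesis by blast
  qed
  show "\<exists>C. \<forall>x. \<bar>\<psi> x\<bar> \<le> C" by (rule bdd) (use c K in auto)
  show "\<exists>C. \<forall>x. \<bar>deriv \<psi> x\<bar> \<le> C" by (rule bdd) (use c' d0 in auto)
qed

lemma interval_measure_lborel: "interval_measure L (restrict_space lborel {0<..<L})"
  unfolding interval_measure_def finite_borel_measure_on_def
  by (cases "0 \<le> L") (auto intro!: finite_measureI simp: sets_restrict_space emeasure_restrict_space space_restrict_space)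

text \<open>Fubini on the triangle \<open>r \<le> q\<close>. Two measures are allowed because it is
  applied with \<open>M\<close> and Lebesgue measure (to test a primitive against derivatives) and
  with \<open>M\<close> twice (to integrate by parts).\<close>

lemma interval_measure_Fubini:
  fixes f g :: "real \<Rightarrow> real"
  assumes "interval_measure L P" "interval_measure L Q" and f: "integrable P f" and g: "integrable Q g"
  shows "(\<integral>q. (LINT r:{..q}|P. f r) * g q \<partial>Q) = (\<integral>r. f r * (LINT q:{r..}|Q. g q) \<partial>P)"
proof -
  interpret P: interval_measure L P by fact
  interpret Q: interval_measure L Q by fact
  interpret pair_sigma_finite P Q ..
  have [measurable]: "f \<in> borel_measurable P" "g \<in> borel_measurable Q" using f g by auto
  have [measurable]: "(\<lambda>x. x) \<in> borel_measurable P" "(\<lambda>x. x) \<in> borel_measurable Q"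
    by (simp_all add: P.borel_measurable_M Q.borel_measurable_M)
  have "integrable (P \<Otimes>\<^sub>M Q) (\<lambda>z. f (fst z) * g (snd z))"
  proof (rule Fubini_integrable)
    show "(\<lambda>z. f (fst z) * g (snd z)) \<in> borel_measurable (P \<Otimes>\<^sub>M Q)" by measurable
    show "integrable P (\<lambda>x. \<integral>y. norm (f (fst (x, y)) * g (snd (x, y))) \<partial>Q)"
      using f by (simp add: abs_mult)
    show "AE x in P. integrable Q (\<lambda>y. f (fst (x, y)) * g (snd (x, y)))" using g by simp
  qed
  then have "integrable (P \<Otimes>\<^sub>M Q) (\<lambda>z. (if fst z \<le> snd z then f (fst z) * g (snd z) else 0))"
    by (rule Bochner_Integration.integrable_bound) auto
  then have "integrable (P \<Otimes>\<^sub>M Q) (\<lambda>(r, q). (if r \<le> q then f r * g q else 0))"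
    by (simp add: case_prod_beta')
  from Fubini_integral[OF this]
  have "(\<integral>q. \<integral>r. (if r \<le> q then f r * g q else 0) \<partial>P \<partial>Q) = (\<integral>r. \<integral>q. (if r \<le> q then f r * g q else 0) \<partial>Q \<partial>P)" .
  moreover have "(\<integral>r. (if r \<le> q then f r * g q else 0) \<partial>P) = (LINT r:{..q}|P. f r) * g q" for q
  proof -
    have "(\<integral>r. (if r \<le> q then f r * g q else 0) \<partial>P) = (\<integral>r. indicator {..q} r *\<^sub>R f r * g q \<partial>P)"
      by (rule Bochner_Integration.integral_cong) auto
    then show ?thesis by (simp add: set_lebesgue_integral_def)
  qed
  moreover have "(\<integral>q. (if r \<le> q then f r * g q else 0) \<partial>Q) = f r * (LINT q:{r..}|Q. g q)" for r
  proof -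
    have "(\<integral>q. (if r \<le> q then f r * g q else 0) \<partial>Q) = (\<integral>q. f r * (indicator {r..} q *\<^sub>R g q) \<partial>Q)"
      by (rule Bochner_Integration.integral_cong) auto
    then show ?thesis by (simp add: set_lebesgue_integral_def)
  qed
  ultimately show ?thesis by simp
qed

section \<open>Primitives and densities with respect to a finite measure\<close>

context interval_measure
begin

text \<open>Integrating over \<open>{..s}\<close> makes the primitive a function on the whole line:
  \<open>M\<close> is carried by \<open>(0, L)\<close>, so it is 0 up to 0 and constant from
  \<open>L\<close> on.\<close>

definition prim :: "(real \<Rightarrow> real) \<Rightarrow> real \<Rightarrow> real" where
  "prim h s = (LINT r:{..s}|M. h r)"

text \<open>The weak form of \<open>Du = h M\<close>. The sign is carried by \<open>h\<close>, so
  that calculations stay free of positive and negative parts.\<close>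

definition is_density :: "(real \<Rightarrow> real) \<Rightarrow> (real \<Rightarrow> real) \<Rightarrow> bool" where
  "is_density h u \<longleftrightarrow> integrable M h \<and>
     (\<forall>\<psi>. test_function_on {0<..<L} \<psi> \<longrightarrow>
        (LINT s:{0<..<L}|lborel. u s * deriv \<psi> s) = - (\<integral>s. \<psi> s * h s \<partial>M))"

lemma prim_add: "integrable M f \<Longrightarrow> integrable M g \<Longrightarrow> prim (\<lambda>r. f r + g r) s = prim f s + prim g s"
  unfolding prim_def by (intro set_integral_add set_integrable_borel) auto

lemma prim_diff: "integrable M f \<Longrightarrow> integrable M g \<Longrightarrow> prim (\<lambda>r. f r - g r) s = prim f s - prim g s"
  unfolding prim_def by (intro set_integral_diff set_integrable_borel) auto

lemma prim_uminus: "prim (\<lambda>r. - f r) s = - prim f s"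
  unfolding prim_def set_lebesgue_integral_def by simp

lemma prim_cmult: "prim (\<lambda>r. c * f r) s = c * prim f s"
  unfolding prim_def by simp

lemma prim_0: "prim (\<lambda>r. 0) s = 0"
  unfolding prim_def by simp

lemma prim_sum: "(\<And>i. i \<in> A \<Longrightarrow> integrable M (f i)) \<Longrightarrow> prim (\<lambda>r. \<Sum>i\<in>A. f i r) s = (\<Sum>i\<in>A. prim (f i) s)"
  by (induction A rule: infinite_finite_induct) (simp_all add: prim_add prim_0)

lemma prim_cong:
  assumes "\<And>r. r \<in> {0<..<L} \<Longrightarrow> f r = g r"
  shows "prim f s = prim g s"
  unfolding prim_def set_lebesgue_integral_def
  by (rule Bochner_Integration.integral_cong) (use assms in auto)

lemma prim_mono:
  assumes "integrable M f" "integrable M g" "\<And>r. r \<in> {0<..<L} \<Longrightarrow> f r \<le> g r"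
  shows "prim f s \<le> prim g s"
  unfolding prim_def set_lebesgue_integral_def
  by (rule integral_mono) (use assms set_integrable_borel[unfolded set_integrable_def] in \<open>auto split: split_indicator\<close>)

lemma abs_prim_le:
  assumes "integrable M f"
  shows "\<bar>prim f s\<bar> \<le> prim (\<lambda>r. \<bar>f r\<bar>) s"
  using set_integral_norm_bound[OF set_integrable_borel[OF assms, of "{..s}"]] by (simp add: prim_def)

lemma prim_nonneg: "(\<And>r. r \<in> {0<..<L} \<Longrightarrow> 0 \<le> f r) \<Longrightarrow> 0 \<le> prim f s"
  unfolding prim_def set_lebesgue_integral_def
  by (rule integral_nonneg_AE) (auto split: split_indicator)

lemma prim_le_0: "s \<le> 0 \<Longrightarrow> prim f s = 0"
  unfolding prim_def set_lebesgue_integral_def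
  by (rule integral_eq_zero_AE) (auto split: split_indicator)

lemma prim_ge_L: "L \<le> s \<Longrightarrow> prim f s = (\<integral>r. f r \<partial>M)"
  unfolding prim_def set_lebesgue_integral_def
  by (rule Bochner_Integration.integral_cong) (auto split: split_indicator)

lemma prim_diff_eq:
  assumes "integrable M h" "a \<le> b"
  shows "prim h b - prim h a = (LINT r:{a<..b}|M. h r)"
proof -
  have "{..b} = {..a} \<union> {a<..b}" using assms(2) by auto
  then have "prim h b = (LINT r:{..a}|M. h r) + (LINT r:{a<..b}|M. h r)"
    unfolding prim_def by (simp only:) (rule set_integral_Un, use assms set_integrable_borel in auto)
  then show ?thesis by (simp add: prim_def)
qed

lemma prim_increasing:
  assumes "integrable M f" "\<And>r. r \<in> {0<..<L} \<Longrightarrow> 0 \<le> f r" "a \<le> b"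
  shows "prim f a \<le> prim f b"
proof -
  have "0 \<le> (LINT r:{a<..b}|M. f r)" unfolding set_lebesgue_integral_def
    by (rule integral_nonneg_AE) (use assms in \<open>auto split: split_indicator\<close>)
  then show ?thesis using prim_diff_eq[OF assms(1,3)] by simp
qed

text \<open>Fubini moves the inner integral onto the test function, and the integral of
  \<open>deriv \<psi>\<close> from \<open>r\<close> to \<open>L\<close> is \<open>- \<psi> r\<close>
  because \<open>\<psi> L = 0\<close>.\<close>

lemma is_density_prim:
  assumes h: "integrable M h" and u: "\<And>s. s \<in> {0<..<L} \<Longrightarrow> u s = c + prim h s" and "L > 0"
  shows "is_density h u"
  unfolding is_density_def
proof (intro conjI allI impI)
  fix \<psi> assume \<psi>: "test_function_on {0<..<L} \<psi>"
  note \<psi>_simps = test_function_onD[OF \<psi>]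
  let ?Q = "restrict_space lborel {0<..<L}"
  interpret Q: interval_measure L ?Q by (rule interval_measure_lborel)
  have d: "integrable ?Q (deriv \<psi>)"
  proof -
    obtain C where "\<And>x. \<bar>deriv \<psi> x\<bar> \<le> C" using \<psi>_simps(7) by blast
    then have "integrable ?Q (\<lambda>x. deriv \<psi> x * 1)"
      using \<psi>_simps(3) by (intro Q.integrable_mult_bounded Q.continuous_on_borel_measurable_M) auto
    then show ?thesis by simp
  qed
  \<comment> \<open>The case \<open>r = 0\<close> is included since it shows that
    \<open>deriv \<psi>\<close> has total integral 0, which removes the constant
    \<open>c\<close>.\<close>
  have FTC: "(LINT q:{r..}|?Q. deriv \<psi> q) = - \<psi> r" if "r \<in> {0..<L}" for r
  proof -
    have "deriv \<psi> q = 0 \<or> 0 < q \<and> q < L" for q using \<psi>_simps(5)[of q] by auto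
    then have "(LINT q:{r..}|?Q. deriv \<psi> q) = (\<integral>q. indicator {r..L} q *\<^sub>R deriv \<psi> q \<partial>lborel)"
      unfolding set_lebesgue_integral_def
      by (subst integral_restrict_space) (use that in \<open>auto intro!: Bochner_Integration.integral_cong simp: indicator_def\<close>)
    also have "\<dots> = \<psi> L - \<psi> r"
      by (rule integral_FTC_atLeastAtMost)
        (use that \<psi>_simps in \<open>auto simp flip: has_real_derivative_iff_has_vector_derivative intro: has_field_derivative_at_within\<close>)
    finally show ?thesis using \<psi>_simps(4)[of L] by simp
  qed
  have sp: "(\<integral>q. deriv \<psi> q \<partial>?Q) = 0"
  proof -
    have "(\<integral>q. deriv \<psi> q \<partial>?Q) = (LINT q:{0..}|?Q. deriv \<psi> q)"
      unfolding set_lebesgue_integral_def by (rule Bochner_Integration.integral_cong) (auto simp: space_restrict_space)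
    then show ?thesis using FTC[of 0] \<open>L > 0\<close> \<psi>_simps(4)[of 0] by simp
  qed
  have ip: "integrable ?Q (\<lambda>s. prim h s * deriv \<psi> s)"
  proof (rule Q.integrable_mult_bounded[OF d])
    \<comment> \<open>\<open>M\<close> may have atoms here, so \<open>prim h\<close> can jump; it is
      measurable as a difference of two increasing functions.\<close>
    have "mono (prim (\<lambda>r. max 0 (h r)))" "mono (prim (\<lambda>r. max 0 (- h r)))"
      using h by (auto intro!: monoI prim_increasing)
    then have "(\<lambda>s. prim (\<lambda>r. max 0 (h r)) s - prim (\<lambda>r. max 0 (- h r)) s) \<in> borel_measurable borel"
      by (intro borel_measurable_diff borel_measurable_mono)
    moreover have "prim (\<lambda>r. max 0 (h r)) s - prim (\<lambda>r. max 0 (- h r)) s = prim h s" for s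
      using h by (subst prim_diff[symmetric]) (auto intro!: prim_cong)
    ultimately show "prim h \<in> borel_measurable ?Q" by (intro Q.borel_measurable_M) simp
    show "\<bar>prim h s\<bar> \<le> prim (\<lambda>r. \<bar>h r\<bar>) L" if "s \<in> {0<..<L}" for s
      using abs_prim_le[OF h, of s] prim_increasing[of "\<lambda>r. \<bar>h r\<bar>" s L] h that by simp
  qed
  have "(LINT s:{0<..<L}|lborel. u s * deriv \<psi> s) = (\<integral>s. u s * deriv \<psi> s \<partial>?Q)"
    unfolding set_lebesgue_integral_def by (subst integral_restrict_space) auto
  also have "\<dots> = (\<integral>s. c * deriv \<psi> s + prim h s * deriv \<psi> s \<partial>?Q)"
    by (rule Bochner_Integration.integral_cong) (auto simp: u space_restrict_space algebra_simps)
  also have "\<dots> = c * (\<integral>s. deriv \<psi> s \<partial>?Q) + (\<integral>s. prim h s * deriv \<psi> s \<partial>?Q)"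
    using d ip by simp
  also have "\<dots> = (\<integral>s. prim h s * deriv \<psi> s \<partial>?Q)" using sp by simp
  also have "\<dots> = (\<integral>r. h r * (LINT q:{r..}|?Q. deriv \<psi> q) \<partial>M)"
    unfolding prim_def by (rule interval_measure_Fubini[OF interval_measure_axioms interval_measure_lborel h d])
  also have "\<dots> = (\<integral>r. - (\<psi> r * h r) \<partial>M)"
    by (rule Bochner_Integration.integral_cong) (auto simp: FTC)
  finally show "(LINT s:{0<..<L}|lborel. u s * deriv \<psi> s) = - (\<integral>s. \<psi> s * h s \<partial>M)" by simp
qed (use h in simp)

lemma ex_real_density:
  assumes P: "interval_measure L P" and ac: "absolutely_continuous M P"
  shows "\<exists>p. integrable M p \<and> (\<forall>x. 0 \<le> p x) \<and> density M (\<lambda>x. ennreal (p x)) = P"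
proof -
  interpret P: interval_measure L P by fact
  have sets: "sets P = sets M" by (simp add: sets_M P.sets_M)
  obtain D where D: "D \<in> borel_measurable M" "AE x in M. RN_deriv M P x = ennreal (D x)" "\<And>x. 0 \<le> D x"
    using real_RN_deriv[OF P.finite_measure_axioms ac sets] by metis
  have dens: "density M (\<lambda>x. ennreal (D x)) = P"
    using density_RN_deriv[OF ac sets] density_cong[of "RN_deriv M P" M "\<lambda>x. ennreal (D x)"] D by simp
  have "(\<integral>\<^sup>+x. ennreal (D x) \<partial>M) = emeasure P (space M)"
    unfolding dens[symmetric] using D(1) emeasure_density[of "\<lambda>x. ennreal (D x)" M "space M"]
    by (auto simp del: space_M intro!: nn_integral_cong)
  then have "integrable M D"
    using D by (intro integrableI_nonneg) (auto simp: less_top[symmetric])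
  then show ?thesis using D(3) dens by blast
qed

lemma ex_is_density:
  assumes hdd: "has_distributional_derivative {0<..<L} u P N"
    and ac: "absolutely_continuous M P" "absolutely_continuous M N"
  shows "\<exists>h. is_density h u"
proof -
  obtain p where p: "integrable M p" "\<And>x. 0 \<le> p x" "density M (\<lambda>x. ennreal (p x)) = P"
    using ex_real_density[OF interval_measure_derivative(1)[OF hdd] ac(1)] by blast
  obtain n where n: "integrable M n" "\<And>x. 0 \<le> n x" "density M (\<lambda>x. ennreal (n x)) = N"
    using ex_real_density[OF interval_measure_derivative(2)[OF hdd] ac(2)] by blast
  have "is_density (\<lambda>x. p x - n x) u"
    unfolding is_density_def
  proof (intro conjI allI impI)
    fix \<psi> assume \<psi>: "test_function_on {0<..<L} \<psi>"
    obtain C where C: "\<And>x. \<bar>\<psi> x\<bar> \<le> C" using test_function_onD(6)[OF \<psi>] by blast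
    have meas: "\<psi> \<in> borel_measurable M"
      using test_function_onD(2)[OF \<psi>] by (rule continuous_on_borel_measurable_M)
    have "(\<integral>s. \<psi> s \<partial>P) = (\<integral>s. \<psi> s * p s \<partial>M)" "(\<integral>s. \<psi> s \<partial>N) = (\<integral>s. \<psi> s * n s \<partial>M)"
      unfolding p(3)[symmetric] n(3)[symmetric] using p(1,2) n(1,2) meas
      by (simp_all add: integral_density mult.commute)
    moreover have "integrable M (\<lambda>s. \<psi> s * p s)" "integrable M (\<lambda>s. \<psi> s * n s)"
      using integrable_mult_bounded[OF p(1) meas C] integrable_mult_bounded[OF n(1) meas C] by auto
    ultimately show "(LINT s:{0<..<L}|lborel. u s * deriv \<psi> s) = - (\<integral>s. \<psi> s * (p s - n s) \<partial>M)"
      using hdd \<psi> by (simp add: has_distributional_derivative_def right_diff_distrib)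
  qed (use p n in simp)
  then show ?thesis by blast
qed

section \<open>Jordan parts read off from a density\<close>

definition density_part :: "(real \<Rightarrow> real) \<Rightarrow> real measure" where
  "density_part h = density M (\<lambda>x. ennreal (max 0 (h x)))"

lemma interval_measure_density_part:
  assumes "integrable M h"
  shows "interval_measure L (density_part h)"
  unfolding interval_measure_def finite_borel_measure_on_def
proof
  show "sets (density_part h) = sets (restrict_space borel {0<..<L})" by (simp add: density_part_def sets_M)
  have "integrable M (\<lambda>x. max 0 (h x))" using assms by simp
  from integrableD(2)[OF this] have "(\<integral>\<^sup>+x. ennreal (max 0 (h x)) \<partial>M) \<noteq> \<infinity>" by simp
  then show "finite_measure (density_part h)"
    using assms emeasure_density[of "\<lambda>x. ennreal (max 0 (h x))" M "space M"]
    unfolding density_part_def by (auto intro!: finite_measureI simp del: space_M cong: nn_integral_cong)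
qed

lemma integral_density_part:
  fixes f :: "real \<Rightarrow> real"
  assumes "integrable M h" "f \<in> borel_measurable M"
  shows "integral\<^sup>L (density_part h) f = (\<integral>x. max 0 (h x) * f x \<partial>M)"
    and "integrable (density_part h) f \<longleftrightarrow> integrable M (\<lambda>x. max 0 (h x) * f x)"
  unfolding density_part_def using assms by (simp_all add: integral_density integrable_density)

text \<open>The set \<open>{h > 0}\<close> separates the positive part of \<open>h M\<close> from
  the negative one, so the two form the Jordan decomposition whatever dominating \<open>M\<close>
  was chosen.\<close>

lemma is_density_Jordan_parts:
  assumes "is_density h u"
  shows "has_distributional_derivative {0<..<L} u (density_part h) (density_part (\<lambda>x. - h x))"
    and "D_pos {0<..<L} u = density_part h" "D_neg {0<..<L} u = density_part (\<lambda>x. - h x)"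
proof -
  have h: "integrable M h" using assms by (simp add: is_density_def)
  then have [measurable]: "h \<in> borel_measurable M" by simp
  show hdd: "has_distributional_derivative {0<..<L} u (density_part h) (density_part (\<lambda>x. - h x))"
    unfolding has_distributional_derivative_def
  proof (intro conjI allI impI)
    show "finite_borel_measure_on {0<..<L} (density_part h)" "finite_borel_measure_on {0<..<L} (density_part (\<lambda>x. - h x))"
      using interval_measure_density_part[of h] interval_measure_density_part[of "\<lambda>x. - h x"] h
      by (simp_all add: interval_measure_def)
    fix \<psi> assume \<psi>: "test_function_on {0<..<L} \<psi>"
    obtain C where C: "\<And>x. \<bar>\<psi> x\<bar> \<le> C" using test_function_onD(6)[OF \<psi>] by blast
    have meas: "\<psi> \<in> borel_measurable M"
      using test_function_onD(2)[OF \<psi>] by (rule continuous_on_borel_measurable_M)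
    have "integrable M (\<lambda>s. \<psi> s * max 0 (h s))" "integrable M (\<lambda>s. \<psi> s * max 0 (- h s))"
      using h by (auto intro!: integrable_mult_bounded[OF _ meas C])
    then have "(\<integral>x. max 0 (h x) * \<psi> x \<partial>M) - (\<integral>x. max 0 (- h x) * \<psi> x \<partial>M) =
        (\<integral>x. max 0 (h x) * \<psi> x - max 0 (- h x) * \<psi> x \<partial>M)"
      by (subst Bochner_Integration.integral_diff) (simp_all add: mult.commute)
    also have "\<dots> = (\<integral>x. \<psi> x * h x \<partial>M)"
      by (rule Bochner_Integration.integral_cong) (auto simp: max_def)
    finally show "(LINT s:{0<..<L}|lborel. u s * deriv \<psi> s) =
        - ((LINT s|density_part h. \<psi> s) - (LINT s|density_part (\<lambda>x. - h x). \<psi> s))"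
      using assms \<psi> h meas by (simp add: is_density_def integral_density_part)
  qed
  have "mutually_singular (density_part h) (density_part (\<lambda>x. - h x))"
    unfolding mutually_singular_def
  proof (intro bexI conjI)
    let ?A = "{x \<in> space M. 0 < h x}"
    have [measurable]: "?A \<in> sets M" by measurable
    have dens: "emeasure (density_part g) B = (\<integral>\<^sup>+x. ennreal (max 0 (g x)) * indicator B x \<partial>M)"
      if "g \<in> borel_measurable M" "B \<in> sets M" for g B
      using that by (simp add: density_part_def emeasure_density)
    show "?A \<in> sets (density_part h)" unfolding density_part_def sets_density by fact
    show "emeasure (density_part h) (space (density_part h) - ?A) = 0"
    proof -
      have [measurable]: "space M - ?A \<in> sets M" by measurable
      have "space (density_part h) = space M" by (simp add: density_part_def)
      moreover have "(\<integral>\<^sup>+x. ennreal (max 0 (h x)) * indicator (space M - ?A) x \<partial>M) = 0"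
        by (subst nn_integral_0_iff_AE) (measurable, auto split: split_indicator)
      ultimately show ?thesis by (simp only: dens[OF \<open>h \<in> borel_measurable M\<close> \<open>space M - ?A \<in> sets M\<close>])
    qed
    show "emeasure (density_part (\<lambda>x. - h x)) ?A = 0"
    proof -
      have "(\<integral>\<^sup>+x. ennreal (max 0 (- h x)) * indicator ?A x \<partial>M) = 0"
        by (subst nn_integral_0_iff_AE) (measurable, auto split: split_indicator)
      then show ?thesis using dens[of "\<lambda>x. - h x" ?A] \<open>?A \<in> sets M\<close> by simp
    qed
  qed
  from Jordan_parts_eqI[OF hdd this]
  show "D_pos {0<..<L} u = density_part h" "D_neg {0<..<L} u = density_part (\<lambda>x. - h x)"
    by (simp_all add: D_pos_def D_neg_def)
qed

lemma D_integral_is_density: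
  fixes f :: "real \<Rightarrow> real"
  assumes "is_density h u" and f: "f \<in> borel_measurable M" and fh: "integrable M (\<lambda>x. f x * h x)"
  shows "D_integrable {0<..<L} u f"
    and "B \<in> sets borel \<Longrightarrow> D_integral {0<..<L} u f B = (LINT s:B|M. f s * h s)"
proof -
  have h: "integrable M h" using assms by (simp add: is_density_def)
  then have [measurable]: "h \<in> borel_measurable M" "f \<in> borel_measurable M" using f by auto
  have pos: "integrable M (\<lambda>x. max 0 (h x) * f x)"
    by (rule Bochner_Integration.integrable_bound[OF fh])
      (auto simp: abs_mult mult.commute[of "\<bar>f _\<bar>"] intro!: mult_right_mono)
  have neg: "integrable M (\<lambda>x. max 0 (- h x) * f x)"
    by (rule Bochner_Integration.integrable_bound[OF fh])
      (auto simp: abs_mult mult.commute[of "\<bar>f _\<bar>"] intro!: mult_right_mono)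
  note D = is_density_Jordan_parts(2,3)[OF assms(1)]
  show "D_integrable {0<..<L} u f"
    unfolding D_integrable_def D using h pos neg by (simp add: integral_density_part)
  assume B: "B \<in> sets borel"
  note [measurable] = indicator_measurable_M[OF B]
  have pos': "integrable M (\<lambda>x. max 0 (h x) * (indicator B x * f x))"
    using set_integrable_borel[OF pos B] by (simp add: set_integrable_def mult_ac)
  have neg': "integrable M (\<lambda>x. max 0 (- h x) * (indicator B x * f x))"
    using set_integrable_borel[OF neg B] by (simp add: set_integrable_def mult_ac)
  have "D_integral {0<..<L} u f B =
     (\<integral>x. max 0 (h x) * (indicator B x * f x) \<partial>M) - (\<integral>x. max 0 (- h x) * (indicator B x * f x) \<partial>M)"
    unfolding D_integral_def D set_lebesgue_integral_def using h by (simp add: integral_density_part)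
  also have "\<dots> = (\<integral>x. max 0 (h x) * (indicator B x * f x) - max 0 (- h x) * (indicator B x * f x) \<partial>M)"
    using pos' neg' by simp
  also have "\<dots> = (LINT s:B|M. f s * h s)"
    unfolding set_lebesgue_integral_def
    by (rule Bochner_Integration.integral_cong) (auto simp: max_def split: split_indicator)
  finally show "D_integral {0<..<L} u f B = (LINT s:B|M. f s * h s)" .
qed

lemma D_measure_is_density:
  assumes "is_density h u" "B \<in> sets borel" "B \<subseteq> {0<..<L}"
  shows "D_measure {0<..<L} u B = (LINT s:B|M. h s)"
proof -
  have h: "integrable M h" using assms by (simp add: is_density_def)
  have "D_measure {0<..<L} u B = D_integral {0<..<L} u (\<lambda>_. 1) B"
    unfolding D_measure_def D_integral_def is_density_Jordan_parts(2,3)[OF assms(1)] set_lebesgue_integral_def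
    using assms by (simp add: density_part_def Int_absorb2)
  then show ?thesis using D_integral_is_density(2)[OF assms(1), of "\<lambda>_. 1" B] assms h by simp
qed

end

section \<open>Atoms and increments of functions of bounded variation\<close>

lemma (in interval_measure) integral_singleton:
  fixes h :: "real \<Rightarrow> real"
  shows "(LINT r:{s}|M. h r) = h s * measure M {s}"
proof -
  have "(LINT r:{s}|M. h r) = (\<integral>r. indicator {s} r * h s \<partial>M)"
    unfolding set_lebesgue_integral_def
    by (rule Bochner_Integration.integral_cong) (auto split: split_indicator)
  also have "\<dots> = h s * measure M {s}"
  proof (cases "s \<in> {0<..<L}")
    case False
    \<comment> \<open>Outside the interval \<open>{s}\<close> is not measurable and has measure 0 by
      default, in accordance with its indicator vanishing on the space of \<open>M\<close>.\<close>
    then have "{s} \<notin> sets M" using sets.sets_into_space[of "{s}" M] by auto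
    then show ?thesis using False by (simp add: measure_notin_sets)
  qed simp
  finally show ?thesis .
qed

lemma BV_on_is_density:
  assumes "BV_on {0<..<L} u"
  obtains M h where "interval_measure L M" "interval_measure.is_density L M h u"
proof -
  obtain P N where hdd: "has_distributional_derivative {0<..<L} u P N"
    using assms unfolding BV_on_def by blast
  interpret P: interval_measure L P using hdd by (rule interval_measure_derivative)
  interpret N: interval_measure L N using hdd by (rule interval_measure_derivative)
  interpret M: interval_measure L "sum_measure P N"
    using P.finite_borel N.finite_borel by (simp add: interval_measure_def finite_borel_measure_on_sum_measure)
  have "sets N = sets P" using P.sets_M N.sets_M by simp
  then have "absolutely_continuous (sum_measure P N) P" "absolutely_continuous (sum_measure P N) N"
    unfolding absolutely_continuous_def null_sets_def by (auto simp: emeasure_sum_measure)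
  from M.ex_is_density[OF hdd this] show thesis using that M.interval_measure_axioms by blast
qed

text \<open>An arbitrary representing pair may contain atoms that cancel in the difference. The
  Jordan parts cannot: their masses at \<open>s\<close> are \<open>max 0 (h s)\<close> and
  \<open>max 0 (- h s)\<close> times that of \<open>M\<close>, and
  \<open>h s * measure M {s} = 0\<close>.\<close>

lemma continuous_BV_on_atomless:
  assumes "continuous_BV_on {0<..<L} u"
  shows "\<exists>P N. has_distributional_derivative {0<..<L} u P N \<and> (\<forall>s. emeasure P {s} = 0 \<and> emeasure N {s} = 0)"
proof -
  obtain M h where "interval_measure L M" "interval_measure.is_density L M h u"
    using assms BV_on_is_density unfolding continuous_BV_on_def by blast
  then interpret interval_measure L M by simp
  have dens: "is_density h u" by fact
  then have [measurable]: "h \<in> borel_measurable M" by (auto simp: is_density_def)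
  have zero: "h s * measure M {s} = 0" if "s \<in> {0<..<L}" for s
    using D_measure_is_density[OF dens, of "{s}"] integral_singleton[of s h] that assms
    by (simp add: continuous_BV_on_def)
  have emeasure_0: "emeasure (density_part g) {s} = 0" if g: "g \<in> borel_measurable M" "g s * measure M {s} = 0 \<or> s \<notin> {0<..<L}" for g s
  proof (cases "s \<in> {0<..<L}")
    case True
    then have s: "{s} \<in> sets M" by (intro in_sets_M') auto
    then have "emeasure (density_part g) {s} = (\<integral>\<^sup>+r. ennreal (max 0 (g s)) * indicator {s} r \<partial>M)"
      unfolding density_part_def using g(1)
      by (subst emeasure_density) (auto intro!: nn_integral_cong split: split_indicator)
    also have "\<dots> = ennreal (max 0 (g s) * measure M {s})"
      using s by (simp add: nn_integral_cmult_indicator emeasure_eq_measure ennreal_mult)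
    also have "\<dots> = 0" using g(2) True by (auto simp: max_def)
    finally show ?thesis .
  next
    case False
    then have "{s} \<notin> sets M" using sets.sets_into_space[of "{s}" M] by auto
    then show ?thesis by (simp add: density_part_def emeasure_notin_sets)
  qed
  have "emeasure (density_part h) {s} = 0 \<and> emeasure (density_part (\<lambda>x. - h x)) {s} = 0" for s
    using zero[of s] by (intro conjI emeasure_0) auto
  then show ?thesis using is_density_Jordan_parts(1)[OF dens] by blast
qed

text \<open>Test \<open>u\<close> against bumps. The derivative of a bump is a difference of two
  mollifiers concentrating at \<open>x\<close> and \<open>z\<close>, so continuity of
  \<open>u\<close> produces the increment in the limit, while the bump itself tends to the indicator
  of the open interval.\<close>

lemma has_distributional_derivative_interval:
  assumes hdd: "has_distributional_derivative {0<..<L} u P N" and u: "set_integrable lborel {0<..<L} u"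
    and cont: "continuous_on {0<..<L} u" and xz: "0 < x" "x < z" "z < L"
  shows "u z - u x = measure P {x<..<z} - measure N {x<..<z}"
proof -
  have isCont: "isCont u y" if "0 < y" "y < L" for y
    using cont that by (simp add: continuous_on_eq_continuous_at)
  let ?d = "\<lambda>n. (z - x) / (real n + 7)"
  let ?T = "\<lambda>a d y. tent ((y - a) / d) / d"
  have lim: "filterlim ?d (at_right 0) sequentially" by (rule filterlim_bump_width) fact
  have A: "(\<lambda>n. LINT y:{0<..<L}|lborel. u y * ?T (x + ?d n) (?d n) y) \<longlonglongrightarrow> u x"
  proof (rule filterlim_compose[OF mollification_tendsto lim])
    show "((\<lambda>d. x + d) \<longlongrightarrow> x) (at_right 0)" by (auto intro!: tendsto_eq_intros)
  qed (use u isCont xz in auto)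
  have B: "(\<lambda>n. LINT y:{0<..<L}|lborel. u y * ?T (z - 4 * ?d n) (?d n) y) \<longlonglongrightarrow> u z"
  proof (rule filterlim_compose[OF mollification_tendsto lim])
    show "((\<lambda>d. z - 4 * d) \<longlongrightarrow> z) (at_right 0)" by (auto intro!: tendsto_eq_intros)
  qed (use u isCont xz in auto)
  have "(LINT y:{0<..<L}|lborel. u y * deriv (bump x z (?d n)) y) =
      (LINT y:{0<..<L}|lborel. u y * ?T (x + ?d n) (?d n) y) -
      (LINT y:{0<..<L}|lborel. u y * ?T (z - 4 * ?d n) (?d n) y)" for n
    unfolding deriv_bump[OF bump_width(1)[OF xz(2), of n]] right_diff_distrib
    by (rule set_integral_diff(2)) (intro set_integrable_mult_tent u bump_width xz)+
  then have "(\<lambda>n. - (LINT y:{0<..<L}|lborel. u y * deriv (bump x z (?d n)) y)) \<longlonglongrightarrow> - (u x - u z)"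
    using tendsto_minus[OF tendsto_diff[OF A B]] by simp
  from LIMSEQ_unique[OF this bump_integral_tendsto_distributional_derivative[OF hdd]] xz show ?thesis by simp
qed

lemma continuous_BV_on_D_measure:
  assumes "continuous_BV_on {0<..<L} u" "0 < x" "x < z" "z < L"
  shows "D_measure {0<..<L} u {x<..<z} = u z - u x"
proof -
  have BV: "BV_on {0<..<L} u" and cont: "continuous_on {0<..<L} u"
    using assms by (simp_all add: continuous_BV_on_def)
  obtain M h where "interval_measure L M" "interval_measure.is_density L M h u"
    using BV BV_on_is_density by blast
  then interpret interval_measure L M by simp
  have "is_density h u" by fact
  from is_density_Jordan_parts[OF this] show ?thesis
    using has_distributional_derivative_interval[of L u, OF _ _ cont assms(2-4)] BV
    unfolding D_measure_def BV_on_def by simp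
qed

section \<open>Primitives with respect to an atomless measure\<close>

locale atomless_interval_measure = interval_measure +
  assumes atomless: "emeasure M {s} = 0"
begin

lemma AE_neq: "AE r in M. r \<noteq> s"
proof (cases "s \<in> {0<..<L}")
  case True
  then have "{s} \<in> null_sets M" using atomless by (intro null_setsI in_sets_M') auto
  then show ?thesis by (rule AE_I') auto
next
  case False
  then show ?thesis by (intro AE_I2) auto
qed

lemma set_integral_cong_atomless:
  fixes h :: "real \<Rightarrow> real"
  assumes "h \<in> borel_measurable M" "A \<in> sets borel" "B \<in> sets borel" "A - {s} = B - {s}"
  shows "(LINT r:A|M. h r) = (LINT r:B|M. h r)"
  unfolding set_lebesgue_integral_def
proof (rule integral_cong_AE)
  show "(\<lambda>r. indicator A r *\<^sub>R h r) \<in> borel_measurable M" "(\<lambda>r. indicator B r *\<^sub>R h r) \<in> borel_measurable M"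
    using assms indicator_measurable_M by auto
  show "AE r in M. indicator A r *\<^sub>R h r = indicator B r *\<^sub>R h r"
    using AE_neq[of s] by eventually_elim (use assms(4) in \<open>auto split: split_indicator\<close>)
qed

lemma prim_diff_Ioo:
  assumes "integrable M h" "a \<le> b"
  shows "prim h b - prim h a = (LINT r:{a<..<b}|M. h r)"
  unfolding prim_diff_eq[OF assms]
  by (rule set_integral_cong_atomless[where s = b]) (use assms in auto)

text \<open>The indicators of \<open>{..X n}\<close> converge to that of \<open>{..s}\<close> except
  possibly at \<open>s\<close>, which is a null set.\<close>

lemma isCont_prim:
  assumes h: "integrable M h"
  shows "isCont (prim h) s"
  unfolding continuous_at_sequentially o_def prim_def set_lebesgue_integral_def
proof (intro allI impI)
  fix X assume X: "X \<longlonglongrightarrow> s"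
  show "(\<lambda>n. \<integral>r. indicator {..X n} r *\<^sub>R h r \<partial>M) \<longlonglongrightarrow> (\<integral>r. indicator {..s} r *\<^sub>R h r \<partial>M)"
  proof (rule integral_dominated_convergence)
    show "integrable M (\<lambda>r. \<bar>h r\<bar>)" using h by simp
    show "(\<lambda>r. indicator {..t} r *\<^sub>R h r) \<in> borel_measurable M" for t
      using h indicator_measurable_M[of "{..t}"] by simp
    then show "(\<lambda>r. indicator {..t} r *\<^sub>R h r) \<in> borel_measurable M" for t .
    show "AE r in M. norm (indicator {..X n} r *\<^sub>R h r) \<le> \<bar>h r\<bar>" for n
      by (rule AE_I2) (auto split: split_indicator)
    show "AE r in M. (\<lambda>n. indicator {..X n} r *\<^sub>R h r) \<longlonglongrightarrow> indicator {..s} r *\<^sub>R h r"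
      using AE_neq[of s]
    proof eventually_elim
      fix r assume "r \<noteq> s"
      then consider "r < s" | "s < r" by linarith
      then have "eventually (\<lambda>n. indicator {..X n} r = (indicator {..s} r :: real)) sequentially"
      proof cases
        case 1
        show ?thesis using order_tendstoD(1)[OF X 1] by eventually_elim (use 1 in auto)
      next
        case 2
        show ?thesis using order_tendstoD(2)[OF X 2] by eventually_elim (use 2 in auto)
      qed
      then have "eventually (\<lambda>n. indicator {..X n} r *\<^sub>R h r = indicator {..s} r *\<^sub>R h r) sequentially"
        by eventually_elim simp
      then show "(\<lambda>n. indicator {..X n} r *\<^sub>R h r) \<longlonglongrightarrow> indicator {..s} r *\<^sub>R h r"
        by (rule tendsto_eventually)
    qed
  qed
qed

lemma continuous_on_prim: "integrable M h \<Longrightarrow> continuous_on A (prim h)"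
  using isCont_prim by (blast intro: continuous_at_imp_continuous_on)

lemma abs_prim_bound:
  assumes "integrable M h"
  shows "\<bar>prim h s\<bar> \<le> (\<integral>r. \<bar>h r\<bar> \<partial>M)"
  using abs_prim_le[OF assms, of s] prim_increasing[of "\<lambda>r. \<bar>h r\<bar>" s "max s L"] prim_ge_L[of "max s L"] assms
  by simp

lemma integrable_prim_mult:
  assumes "integrable M f" "integrable M g"
  shows "integrable M (\<lambda>r. prim f r * g r)"
  by (rule integrable_mult_bounded[OF assms(2) _ abs_prim_bound[OF assms(1)]])
    (intro continuous_on_borel_measurable_M continuous_on_prim assms)

text \<open>Integration by parts: Fubini's theorem on the square, whose diagonal is a null set.\<close>

lemma prim_mult:
  assumes f: "integrable M f" and g: "integrable M g"
  shows "prim f s * prim g s = prim (\<lambda>r. prim f r * g r + prim g r * f r) s"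
proof -
  have g': "integrable M (\<lambda>q. indicator {..s} q * g q)"
    using set_integrable_borel[OF g, of "{..s}"] by (simp add: set_integrable_def)
  have inner: "(LINT q:{r..}|M. indicator {..s} q * g q) = indicator {..s} r * (prim g s - prim g r)" for r
  proof (cases "r \<le> s")
    case True
    have "(LINT q:{r..}|M. indicator {..s} q * g q) = (LINT q:{r..s}|M. g q)"
      unfolding set_lebesgue_integral_def by (rule Bochner_Integration.integral_cong) (auto split: split_indicator)
    also have "\<dots> = (LINT q:{r<..s}|M. g q)"
      by (rule set_integral_cong_atomless[where s = r]) (use g in auto)
    finally show ?thesis using True prim_diff_eq[OF g True] by simp
  next
    case False
    then show ?thesis unfolding set_lebesgue_integral_def
      by (simp, intro integral_eq_zero_AE AE_I2) (auto split: split_indicator)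
  qed
  have "prim (\<lambda>r. prim f r * g r) s = (\<integral>q. (LINT r:{..q}|M. f r) * (indicator {..s} q * g q) \<partial>M)"
    unfolding prim_def set_lebesgue_integral_def by (simp add: mult_ac)
  also have "\<dots> = (\<integral>r. f r * (LINT q:{r..}|M. indicator {..s} q * g q) \<partial>M)"
    by (rule interval_measure_Fubini[OF interval_measure_axioms interval_measure_axioms f g'])
  also have "\<dots> = (\<integral>r. f r * (indicator {..s} r * (prim g s - prim g r)) \<partial>M)"
    by (simp only: inner)
  also have "\<dots> = prim (\<lambda>r. prim g s * f r - prim g r * f r) s"
    unfolding prim_def[of "\<lambda>r. prim g s * f r - prim g r * f r"] set_lebesgue_integral_def
    by (rule Bochner_Integration.integral_cong) (auto simp: algebra_simps)
  also have "\<dots> = prim g s * prim f s - prim (\<lambda>r. prim g r * f r) s"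
    using integrable_prim_mult[OF g f] f by (simp add: prim_diff prim_cmult)
  finally show ?thesis using integrable_prim_mult[OF f g] integrable_prim_mult[OF g f]
    by (simp add: prim_add mult.commute)
qed

lemma is_density_imp_prim:
  assumes u: "continuous_BV_on {0<..<L} u" and h: "is_density h u" and xz: "0 < x" "x < z" "z < L"
  shows "u z - u x = prim h z - prim h x"
  using continuous_BV_on_D_measure[OF u xz] D_measure_is_density[OF h, of "{x<..<z}"] prim_diff_Ioo[of h x z] xz h
  by (simp add: is_density_def subset_eq)

lemma continuous_BV_on_imp_prim:
  assumes u: "continuous_BV_on {0<..<L} u" and h: "is_density h u"
  shows "\<exists>c. \<forall>s\<in>{0<..<L}. u s = c + prim h s"
proof (intro exI ballI)
  fix s assume s: "s \<in> {0<..<L}"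
  \<comment> \<open>The base point has to be interior, as nothing is known of \<open>u\<close> at 0;
    the midpoint will do.\<close>
  show "u s = (u (L / 2) - prim h (L / 2)) + prim h s"
    using is_density_imp_prim[OF u h, of s "L / 2"] is_density_imp_prim[OF u h, of "L / 2" s] s
    by (cases s "L / 2" rule: linorder_cases) auto
qed

lemma continuous_BV_on_prim:
  assumes h: "integrable M h" and u: "\<And>s. s \<in> {0<..<L} \<Longrightarrow> u s = c + prim h s" and "L > 0"
  shows "continuous_BV_on {0<..<L} u"
proof -
  have dens: "is_density h u" by (rule is_density_prim[OF h u \<open>L > 0\<close>])
  have cont: "continuous_on {0<..<L} u"
    using u by (subst continuous_on_cong[OF refl u]) (auto intro!: continuous_intros continuous_on_prim h)
  interpret Q: interval_measure L "restrict_space lborel {0<..<L}" by (rule interval_measure_lborel)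
  have "integrable (restrict_space lborel {0<..<L}) (\<lambda>s. u s * 1)"
  proof (rule Q.integrable_mult_bounded)
    show "\<bar>u s\<bar> \<le> \<bar>c\<bar> + (\<integral>r. \<bar>h r\<bar> \<partial>M)" if "s \<in> {0<..<L}" for s
      using u[OF that] abs_prim_bound[OF h, of s] by linarith
  qed (use cont Q.continuous_on_borel_measurable_M in auto)
  then have "set_integrable lborel {0<..<L} u"
    by (simp add: set_integrable_def integrable_restrict_space)
  moreover have "D_measure {0<..<L} u {s} = 0" if "s \<in> {0<..<L}" for s
    using D_measure_is_density[OF dens, of "{s}"] integral_singleton[of s h] that atomless[of s]
    by (simp add: measure_def)
  ultimately show ?thesis
    using is_density_Jordan_parts(1)[OF dens] cont unfolding continuous_BV_on_def BV_on_def by blast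
qed

end

subsection \<open>Linear integral equations\<close>

context atomless_interval_measure
begin

text \<open>The integrated form of \<open>dy = - y K dM\<close> with \<open>y 0 = d\<close> for a
  row vector \<open>y\<close>: the equation of a single row of \<open>G\<close> once
  \<open>(G^T)^-1\<close> is replaced by \<open>G\<close>. It is imposed at all real
  \<open>s\<close>, since primitives are defined there.\<close>

definition solves_linear :: "('n::finite \<Rightarrow> 'n \<Rightarrow> real \<Rightarrow> real) \<Rightarrow> ('n \<Rightarrow> real) \<Rightarrow> ('n \<Rightarrow> real \<Rightarrow> real) \<Rightarrow> bool" where
  "solves_linear K d y \<longleftrightarrow> (\<forall>k j. integrable M (\<lambda>r. y k r * K k j r)) \<and>
     (\<forall>j s. y j s = d j - (\<Sum>k\<in>UNIV. prim (\<lambda>r. y k r * K k j r) s))"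

lemma solves_linear_eq_prim:
  assumes "solves_linear K d y"
  shows "integrable M (\<lambda>r. \<Sum>k\<in>UNIV. y k r * K k j r)"
    and "y j s = d j + prim (\<lambda>r. - (\<Sum>k\<in>UNIV. y k r * K k j r)) s"
proof -
  have int: "integrable M (\<lambda>r. y k r * K k j r)" for k using assms unfolding solves_linear_def by blast
  then show "integrable M (\<lambda>r. \<Sum>k\<in>UNIV. y k r * K k j r)" by simp
  have "y j s = d j - (\<Sum>k\<in>UNIV. prim (\<lambda>r. y k r * K k j r) s)"
    using assms unfolding solves_linear_def by blast
  also have "\<dots> = d j + prim (\<lambda>r. - (\<Sum>k\<in>UNIV. y k r * K k j r)) s"
    using int by (simp add: prim_uminus prim_sum)
  finally show "y j s = d j + prim (\<lambda>r. - (\<Sum>k\<in>UNIV. y k r * K k j r)) s" .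
qed

lemma affine_prim_mult:
  assumes "integrable M f" "integrable M g"
  shows "(a + prim f s) * (b + prim g s) =
    a * b + prim (\<lambda>r. f r * (b + prim g r) + (a + prim f r) * g r) s"
    and "integrable M (\<lambda>r. f r * (b + prim g r) + (a + prim f r) * g r)"
proof -
  have eq: "(\<lambda>r. f r * (b + prim g r) + (a + prim f r) * g r) =
      (\<lambda>r. b * f r + (a * g r + (prim f r * g r + prim g r * f r)))"
    by (auto simp: algebra_simps)
  show "integrable M (\<lambda>r. f r * (b + prim g r) + (a + prim f r) * g r)"
    unfolding eq using assms integrable_prim_mult by simp
  show "(a + prim f s) * (b + prim g s) =
    a * b + prim (\<lambda>r. f r * (b + prim g r) + (a + prim f r) * g r) s"
    unfolding eq using assms integrable_prim_mult
    by (simp add: prim_add prim_cmult prim_mult[OF assms] algebra_simps)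
qed

text \<open>By the Leibniz rule the inner product has density
  \<open>- (x K) \<bullet> y - x \<bullet> (y K)\<close>, which skewness cancels pointwise, before
  any integration.\<close>

lemma solves_linear_inner_const:
  fixes K :: "'n::finite \<Rightarrow> 'n \<Rightarrow> real \<Rightarrow> real"
  assumes skew: "\<And>k j r. K k j r = - K j k r"
    and x: "solves_linear K a x" and y: "solves_linear K b y"
  shows "(\<Sum>j\<in>UNIV. x j s * y j s) = (\<Sum>j\<in>UNIV. a j * b j)"
proof -
  define f where "f j r = - (\<Sum>k\<in>UNIV. x k r * K k j r)" for j r
  define g where "g j r = - (\<Sum>k\<in>UNIV. y k r * K k j r)" for j r
  have f: "integrable M (f j)" and g: "integrable M (g j)" for j
    using solves_linear_eq_prim(1)[OF x] solves_linear_eq_prim(1)[OF y] unfolding f_def g_def by simp_all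
  have xf: "x j s = a j + prim (f j) s" and yg: "y j s = b j + prim (g j) s" for j s
    unfolding f_def g_def by (rule solves_linear_eq_prim(2)[OF x] solves_linear_eq_prim(2)[OF y])+
  have cancel: "(\<Sum>j\<in>UNIV. f j r * y j r + x j r * g j r) = 0" for r
  proof -
    have "(\<Sum>j\<in>UNIV. f j r * y j r) = - (\<Sum>j\<in>UNIV. \<Sum>k\<in>UNIV. x k r * K k j r * y j r)"
      by (simp add: f_def sum_distrib_right sum_negf)
    also have "\<dots> = (\<Sum>j\<in>UNIV. \<Sum>k\<in>UNIV. x k r * K j k r * y j r)"
      unfolding sum_negf[symmetric] by (intro sum.cong refl) (subst skew, simp)
    also have "\<dots> = (\<Sum>k\<in>UNIV. \<Sum>j\<in>UNIV. x k r * K j k r * y j r)" by (rule sum.swap)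
    also have "\<dots> = - (\<Sum>j\<in>UNIV. x j r * g j r)"
      by (simp add: g_def sum_distrib_left sum_negf mult_ac)
    finally show ?thesis by (simp add: sum.distrib)
  qed
  have "(\<Sum>j\<in>UNIV. x j s * y j s) = (\<Sum>j\<in>UNIV. a j * b j + prim (\<lambda>r. f j r * y j r + x j r * g j r) s)"
    by (simp only: xf yg affine_prim_mult(1)[OF f g])
  also have "\<dots> = (\<Sum>j\<in>UNIV. a j * b j) + prim (\<lambda>r. \<Sum>j\<in>UNIV. f j r * y j r + x j r * g j r) s"
  proof -
    have "integrable M (\<lambda>r. f j r * y j r + x j r * g j r)" for j
      unfolding xf yg by (rule affine_prim_mult(2)[OF f g])
    then show ?thesis
      by (subst prim_sum[where A = UNIV and f = "\<lambda>j r. f j r * y j r + x j r * g j r"]) (simp_all only: sum.distrib)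
  qed
  finally show ?thesis by (simp add: cancel prim_0)
qed

text \<open>Expand \<open>|x - y|^2\<close>: by the conservation law all three inner products keep
  the common initial value \<open>a \<bullet> a\<close>.\<close>

lemma solves_linear_unique:
  fixes K :: "'n::finite \<Rightarrow> 'n \<Rightarrow> real \<Rightarrow> real"
  assumes skew: "\<And>k j r. K k j r = - K j k r"
    and x: "solves_linear K a x" and y: "solves_linear K a y"
  shows "x = y"
proof (intro ext)
  fix j s
  have "(\<Sum>j\<in>UNIV. (x j s - y j s)\<^sup>2) =
      (\<Sum>j\<in>UNIV. x j s * x j s) - 2 * (\<Sum>j\<in>UNIV. x j s * y j s) + (\<Sum>j\<in>UNIV. y j s * y j s)"
    unfolding sum_distrib_left sum_subtractf[symmetric] sum.distrib[symmetric]
    by (intro sum.cong refl) (simp add: power2_eq_square algebra_simps)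
  also have "\<dots> = 0"
    unfolding solves_linear_inner_const[OF skew x x] solves_linear_inner_const[OF skew x y]
      solves_linear_inner_const[OF skew y y] by simp
  finally show "x j s = y j s"
    by (simp add: sum_nonneg_eq_0_iff)
qed

text \<open>With \<open>W = prim w\<close>, the Leibniz rule shows that the next integral
  \<open>I\<close> satisfies \<open>W^(n+2) / (n+1) = (1 + 1/(n+1)) * I\<close>. This ordinary power
  rule is the source of the factorials in the Picard estimate.\<close>

lemma prim_power:
  assumes w: "integrable M w"
  shows "integrable M (\<lambda>r. prim w r ^ n * w r) \<and> prim (\<lambda>r. prim w r ^ n * w r) s = prim w s ^ Suc n / real (Suc n)"
proof (induction n arbitrary: s)
  case 0
  then show ?case using w by simp
next
  case (Suc n)
  let ?h = "\<lambda>r. prim w r ^ n * w r"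
  have h: "integrable M ?h" and ph: "\<And>s. prim ?h s = prim w s ^ Suc n / real (Suc n)" using Suc by auto
  have int: "integrable M (\<lambda>r. prim w r * ?h r)" by (rule integrable_prim_mult[OF w h])
  then have int': "integrable M (\<lambda>r. prim w r ^ Suc n * w r)" by (simp add: mult_ac)
  have "prim w s * prim ?h s = prim (\<lambda>r. prim w r * ?h r + prim ?h r * w r) s" by (rule prim_mult[OF w h])
  also have "\<dots> = prim (\<lambda>r. (1 + 1 / real (Suc n)) * (prim w r ^ Suc n * w r)) s"
    by (rule prim_cong, simp only: ph) (simp add: field_simps)
  also have "\<dots> = (1 + 1 / real (Suc n)) * prim (\<lambda>r. prim w r ^ Suc n * w r) s" by (rule prim_cmult)
  finally have "prim w s ^ Suc (Suc n) / real (Suc n) = (1 + 1 / real (Suc n)) * prim (\<lambda>r. prim w r ^ Suc n * w r) s"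
    by (simp add: ph)
  also have "1 + 1 / real (Suc n) = real (Suc (Suc n)) / real (Suc n)" by (simp add: field_simps)
  finally have "prim (\<lambda>r. prim w r ^ Suc n * w r) s = prim w s ^ Suc (Suc n) / real (Suc (Suc n))"
    by (simp add: field_simps del: of_nat_Suc power_Suc)
  then show ?case using int' by blast
qed

text \<open>These are the terms of the Neumann series; the Picard iterates are their partial
  sums.\<close>

primrec picard :: "('n::finite \<Rightarrow> 'n \<Rightarrow> real \<Rightarrow> real) \<Rightarrow> ('n \<Rightarrow> real) \<Rightarrow> nat \<Rightarrow> 'n \<Rightarrow> real \<Rightarrow> real" where
  "picard K d 0 = (\<lambda>j s. d j)"
| "picard K d (Suc n) = (\<lambda>j s. - (\<Sum>k\<in>UNIV. prim (\<lambda>r. picard K d n k r * K k j r) s))"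

text \<open>By \<open>prim_power\<close> the majorant reproduces itself under integration;
  \<open>w\<close> adds up all entries of \<open>K\<close> so that it bounds every column.
  Continuity is carried through the induction because it makes the next integrand
  measurable.\<close>

lemma picard_bound:
  fixes K :: "'n::finite \<Rightarrow> 'n \<Rightarrow> real \<Rightarrow> real" and d :: "'n \<Rightarrow> real"
  assumes K: "\<And>k j. integrable M (K k j)"
  defines "w \<equiv> \<lambda>r. \<Sum>k\<in>UNIV. \<Sum>j\<in>UNIV. \<bar>K k j r\<bar>" and "D \<equiv> \<Sum>j\<in>UNIV. \<bar>d j\<bar>"
  shows "(\<forall>s. isCont (picard K d n j) s) \<and> (\<forall>s. \<bar>picard K d n j s\<bar> \<le> D * (prim w s ^ n / fact n))"
proof (induction n arbitrary: j)
  case 0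
  have "\<bar>d j\<bar> \<le> D" unfolding D_def by (rule member_le_sum) auto
  then show ?case by simp
next
  case (Suc n)
  have w: "integrable M w" unfolding w_def using K by simp
  have wn: "integrable M (\<lambda>r. prim w r ^ n * w r)" using prim_power[OF w] by blast
  have T: "prim w s ^ n / fact n \<le> (\<integral>r. \<bar>w r\<bar> \<partial>M) ^ n / fact n" for s
    using abs_prim_bound[OF w, of s] prim_nonneg[of w s]
    by (intro divide_right_mono power_mono) (auto simp: w_def sum_nonneg)
  have D0: "0 \<le> D" by (simp add: D_def sum_nonneg)
  have int: "integrable M (\<lambda>r. picard K d n k r * K k j r)" for k j
  proof (rule integrable_mult_bounded[OF K])
    show "picard K d n k \<in> borel_measurable M"
      using Suc.IH by (intro continuous_on_borel_measurable_M continuous_at_imp_continuous_on) auto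
    show "\<bar>picard K d n k r\<bar> \<le> D * ((\<integral>r. \<bar>w r\<bar> \<partial>M) ^ n / fact n)" for r
      using Suc.IH[of k] mult_left_mono[OF T[of r] D0] order_trans by blast
  qed
  show ?case
  proof (intro conjI allI)
    show "isCont (picard K d (Suc n) j) s" for s
      by (auto intro!: continuous_intros isCont_prim int)
    fix s
    have "\<bar>picard K d (Suc n) j s\<bar> \<le> (\<Sum>k\<in>UNIV. \<bar>prim (\<lambda>r. picard K d n k r * K k j r) s\<bar>)"
      by (simp add: sum_abs)
    also have "\<dots> \<le> (\<Sum>k\<in>UNIV. prim (\<lambda>r. \<bar>picard K d n k r * K k j r\<bar>) s)"
      by (intro sum_mono abs_prim_le int)
    also have "\<dots> = prim (\<lambda>r. \<Sum>k\<in>UNIV. \<bar>picard K d n k r * K k j r\<bar>) s"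
      by (rule prim_sum[symmetric]) (use int in auto)
    also have "\<dots> \<le> prim (\<lambda>r. D / fact n * (prim w r ^ n * w r)) s"
    proof (rule prim_mono)
      show "integrable M (\<lambda>r. \<Sum>k\<in>UNIV. \<bar>picard K d n k r * K k j r\<bar>)" using int by simp
      show "integrable M (\<lambda>r. D / fact n * (prim w r ^ n * w r))"
        using wn by (rule integrable_mult_right)
      fix r
      have "(\<Sum>k\<in>UNIV. \<bar>picard K d n k r * K k j r\<bar>) \<le> (\<Sum>k\<in>UNIV. D * (prim w r ^ n / fact n) * \<bar>K k j r\<bar>)"
      proof (rule sum_mono)
        fix k
        have "\<bar>picard K d n k r\<bar> \<le> D * (prim w r ^ n / fact n)" using Suc.IH by blast
        from mult_right_mono[OF this, of "\<bar>K k j r\<bar>"]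
        show "\<bar>picard K d n k r * K k j r\<bar> \<le> D * (prim w r ^ n / fact n) * \<bar>K k j r\<bar>"
          by (simp only: abs_mult abs_ge_zero)
      qed
      also have "\<dots> = D * (prim w r ^ n / fact n) * (\<Sum>k\<in>UNIV. \<bar>K k j r\<bar>)"
        by (simp add: sum_distrib_left)
      also have "\<dots> \<le> D * (prim w r ^ n / fact n) * w r"
        unfolding w_def using D0 prim_nonneg[of w r]
        by (intro mult_left_mono sum_mono member_le_sum) (auto simp: w_def sum_nonneg)
      finally show "(\<Sum>k\<in>UNIV. \<bar>picard K d n k r * K k j r\<bar>) \<le> D / fact n * (prim w r ^ n * w r)"
        by simp
    qed
    also have "\<dots> = D / fact n * (prim w s ^ Suc n / real (Suc n))"
      using prim_power[OF w, of n s] by (simp only: prim_cmult)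
    also have "\<dots> = D * (prim w s ^ Suc n / fact (Suc n))" by (simp add: field_simps)
    finally show "\<bar>picard K d (Suc n) j s\<bar> \<le> D * (prim w s ^ Suc n / fact (Suc n))" .
  qed
qed

text \<open>The series is dominated by an exponential one uniformly in \<open>s\<close>, so all
  partial sums are bounded by one constant \<open>C\<close>. Then
  \<open>C * \<bar>K k j r\<bar>\<close> dominates the integrands, and the integral equation passes
  to the limit.\<close>

lemma ex_solves_linear:
  fixes K :: "'n::finite \<Rightarrow> 'n \<Rightarrow> real \<Rightarrow> real"
  assumes K: "\<And>k j. integrable M (K k j)"
  shows "\<exists>y. solves_linear K d y"
proof -
  define w where "w = (\<lambda>r. \<Sum>k\<in>UNIV. \<Sum>j\<in>UNIV. \<bar>K k j r\<bar>)"
  define D where "D = (\<Sum>j\<in>UNIV. \<bar>d j\<bar>)"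
  define T where "T = (\<integral>r. \<bar>w r\<bar> \<partial>M)"
  let ?Y = "picard K d"
  have w: "integrable M w" unfolding w_def using K by simp
  have D0: "0 \<le> D" by (simp add: D_def sum_nonneg)
  have bound: "\<bar>?Y n j s\<bar> \<le> D * (T ^ n / fact n)" for n j s
  proof -
    have "prim w s ^ n / fact n \<le> T ^ n / fact n" unfolding T_def
      using abs_prim_bound[OF w, of s] prim_nonneg[of w s]
      by (intro divide_right_mono power_mono) (auto simp: w_def sum_nonneg)
    from mult_left_mono[OF this D0] show ?thesis
      using picard_bound[OF K, where d = d and n = n and j = j] unfolding w_def D_def by (meson order_trans)
  qed
  have summable_exp: "summable (\<lambda>n. D * (T ^ n / fact n))"
    using summable_exp[of T] by (intro summable_mult) (simp add: field_simps)
  have summ: "summable (\<lambda>n. ?Y n j s)" for j s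
    by (rule summable_comparison_test'[OF summable_exp]) (use bound in auto)
  define y where "y j s = (\<Sum>n. ?Y n j s)" for j s
  define C where "C = (\<Sum>n. D * (T ^ n / fact n))"
  have T0: "0 \<le> T" by (simp add: T_def)
  have part_bound: "\<bar>\<Sum>n<N. ?Y n j s\<bar> \<le> C" for N j s
  proof -
    have "\<bar>\<Sum>n<N. ?Y n j s\<bar> \<le> (\<Sum>n<N. D * (T ^ n / fact n))"
      using bound by (intro order_trans[OF sum_abs] sum_mono) auto
    also have "\<dots> \<le> C" unfolding C_def
      by (rule sum_le_suminf[OF summable_exp]) (use D0 T0 in auto)
    finally show ?thesis .
  qed
  have lim: "(\<lambda>N. \<Sum>n<N. ?Y n j s) \<longlonglongrightarrow> y j s" for j s
    unfolding y_def using summ summable_LIMSEQ by blast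
  have cont: "?Y n j \<in> borel_measurable M" for n j
    using picard_bound[where K = K and d = d and n = n and j = j, OF K]
    by (intro continuous_on_borel_measurable_M continuous_at_imp_continuous_on) auto
  have meas: "(\<lambda>s. \<Sum>n<N. ?Y n j s) \<in> borel_measurable M" for N j
    using cont by simp
  have ymeas: "y j \<in> borel_measurable M" for j
    by (rule borel_measurable_LIMSEQ_real[OF lim meas])
  have ybound: "\<bar>y j s\<bar> \<le> C" for j s
    by (rule LIMSEQ_le_const2[OF tendsto_rabs[OF lim]]) (use part_bound in blast)
  have int: "integrable M (\<lambda>r. y k r * K k j r)" for k j
    by (rule integrable_mult_bounded[OF K ymeas ybound])
  have intY: "integrable M (\<lambda>r. ?Y n k r * K k j r)" for n k j
    by (rule integrable_mult_bounded[OF K cont bound])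
  have conv: "(\<lambda>N. prim (\<lambda>r. (\<Sum>n<N. ?Y n k r) * K k j r) s) \<longlonglongrightarrow> prim (\<lambda>r. y k r * K k j r) s" for k j s
    unfolding prim_def set_lebesgue_integral_def
  proof (rule integral_dominated_convergence)
    show "integrable M (\<lambda>r. C * \<bar>K k j r\<bar>)" using K by simp
    show "(\<lambda>r. indicator {..s} r *\<^sub>R (y k r * K k j r)) \<in> borel_measurable M"
      using int[of k j] indicator_measurable_M[of "{..s}"] by simp
    show "(\<lambda>r. indicator {..s} r *\<^sub>R ((\<Sum>n<N. ?Y n k r) * K k j r)) \<in> borel_measurable M" for N
      using meas K[of k j] indicator_measurable_M[of "{..s}"] by simp
    show "AE r in M. (\<lambda>N. indicator {..s} r *\<^sub>R ((\<Sum>n<N. ?Y n k r) * K k j r)) \<longlonglongrightarrow>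
        indicator {..s} r *\<^sub>R (y k r * K k j r)"
      by (intro AE_I2 tendsto_intros lim)
    show "AE r in M. norm (indicator {..s} r *\<^sub>R ((\<Sum>n<N. ?Y n k r) * K k j r)) \<le> C * \<bar>K k j r\<bar>" for N
    proof (rule AE_I2)
      fix r
      have "\<bar>(\<Sum>n<N. ?Y n k r) * K k j r\<bar> \<le> C * \<bar>K k j r\<bar>"
        unfolding abs_mult by (rule mult_right_mono[OF part_bound]) simp
      moreover have "0 \<le> C * \<bar>K k j r\<bar>" using calculation by linarith
      ultimately show "norm (indicator {..s} r *\<^sub>R ((\<Sum>n<N. ?Y n k r) * K k j r)) \<le> C * \<bar>K k j r\<bar>"
        by (auto split: split_indicator)
    qed
  qed
  have "y j s = d j - (\<Sum>k\<in>UNIV. prim (\<lambda>r. y k r * K k j r) s)" for j s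
  proof (rule LIMSEQ_unique)
    show "(\<lambda>N. \<Sum>n<Suc N. ?Y n j s) \<longlonglongrightarrow> y j s" using lim by (rule LIMSEQ_Suc)
    \<comment> \<open>The index shift of the iteration: the partial sum with one more term is
      \<open>d\<close> minus the integral of the previous one.\<close>
    have "(\<Sum>n<Suc N. ?Y n j s) = d j - (\<Sum>k\<in>UNIV. prim (\<lambda>r. (\<Sum>n<N. ?Y n k r) * K k j r) s)" for N
    proof -
      have "(\<Sum>n<N. ?Y (Suc n) j s) = - (\<Sum>n<N. \<Sum>k\<in>UNIV. prim (\<lambda>r. ?Y n k r * K k j r) s)"
        by (simp add: sum_negf)
      also have "\<dots> = - (\<Sum>k\<in>UNIV. \<Sum>n<N. prim (\<lambda>r. ?Y n k r * K k j r) s)"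
        by (simp add: sum.swap[of _ UNIV])
      also have "\<dots> = - (\<Sum>k\<in>UNIV. prim (\<lambda>r. (\<Sum>n<N. ?Y n k r) * K k j r) s)"
        using intY by (simp add: prim_sum[symmetric] sum_distrib_right)
      finally show ?thesis unfolding sum.lessThan_Suc_shift by simp
    qed
    then show "(\<lambda>N. \<Sum>n<Suc N. ?Y n j s) \<longlonglongrightarrow> d j - (\<Sum>k\<in>UNIV. prim (\<lambda>r. y k r * K k j r) s)"
      by (simp only:) (intro tendsto_intros conv)
  qed
  then show ?thesis using int unfolding solves_linear_def by blast
qed

end

subsection \<open>The moving frame\<close>

text \<open>A sum dominates each summand, and no summand has atoms. Lebesgue measure is among them
  so that its density \<open>l\<close> can later serve as a denominator.\<close>

lemma ex_common_measure:
  assumes "continuous_BV_on {0<..<L} \<theta>" "continuous_BV_on {0<..<L} \<phi>"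
  obtains M f g l where "atomless_interval_measure L M"
    "interval_measure.is_density L M f \<theta>" "interval_measure.is_density L M g \<phi>"
    "l \<in> borel_measurable M" "\<And>x. 0 \<le> l x" "density M (\<lambda>x. ennreal (l x)) = restrict_space lborel {0<..<L}"
proof -
  let ?Q = "restrict_space lborel {0<..<L}"
  obtain P N where 1: "has_distributional_derivative {0<..<L} \<theta> P N" "\<And>s. emeasure P {s} = 0" "\<And>s. emeasure N {s} = 0"
    using continuous_BV_on_atomless[OF assms(1)] by blast
  obtain P' N' where 2: "has_distributional_derivative {0<..<L} \<phi> P' N'" "\<And>s. emeasure P' {s} = 0" "\<And>s. emeasure N' {s} = 0"
    using continuous_BV_on_atomless[OF assms(2)] by blast
  interpret P: interval_measure L P using 1(1) by (rule interval_measure_derivative)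
  interpret N: interval_measure L N using 1(1) by (rule interval_measure_derivative)
  interpret P': interval_measure L P' using 2(1) by (rule interval_measure_derivative)
  interpret N': interval_measure L N' using 2(1) by (rule interval_measure_derivative)
  interpret Q: interval_measure L ?Q by (rule interval_measure_lborel)
  note sets = P.sets_M N.sets_M P'.sets_M N'.sets_M Q.sets_M
  define M where "M = sum_measure P (sum_measure N (sum_measure P' (sum_measure N' ?Q)))"
  have emeasure_M: "emeasure M X = emeasure P X + (emeasure N X + (emeasure P' X + (emeasure N' X + emeasure ?Q X)))" for X
    unfolding M_def by (simp add: emeasure_sum_measure sets)
  have "finite_borel_measure_on {0<..<L} M" unfolding M_def
    by (intro finite_borel_measure_on_sum_measure P.finite_borel N.finite_borel P'.finite_borel N'.finite_borel Q.finite_borel)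
  moreover have "emeasure ?Q {s} = 0" for s
  proof (cases "s \<in> {0<..<L}")
    case False
    then have "{s} \<notin> sets ?Q" using sets.sets_into_space[of "{s}" ?Q] by auto
    then show ?thesis by (rule emeasure_notin_sets)
  qed (simp add: emeasure_restrict_space)
  ultimately have M: "atomless_interval_measure L M"
    by unfold_locales (simp_all add: emeasure_M 1 2)
  interpret M: atomless_interval_measure L M by fact
  have ac: "absolutely_continuous M P" "absolutely_continuous M N" "absolutely_continuous M P'"
      "absolutely_continuous M N'" "absolutely_continuous M ?Q"
    unfolding absolutely_continuous_def null_sets_def by (auto simp: emeasure_M sets M.sets_M)
  obtain f where f: "M.is_density f \<theta>" using M.ex_is_density[OF 1(1) ac(1,2)] by blast
  obtain g where g: "M.is_density g \<phi>" using M.ex_is_density[OF 2(1) ac(3,4)] by blast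
  obtain l where l: "integrable M l" "\<And>x. 0 \<le> l x" "density M (\<lambda>x. ennreal (l x)) = ?Q"
    using M.ex_real_density[OF interval_measure_lborel ac(5)] by blast
  show thesis by (rule that[OF M f g borel_measurable_integrable[OF l(1)] l(2,3)])
qed

text \<open>\<open>continuous_BV_SO3\<close> asks for rotations only almost everywhere; this extends
  the property to every point, as \<open>{F \<noteq> 0}\<close> is open and a nonempty open set is
  not null.\<close>

lemma continuous_AE_eq_0:
  fixes F :: "real \<Rightarrow> real"
  assumes cont: "continuous_on {0<..<L} F" and ae: "AE s\<in>{0<..<L} in lborel. F s = 0" and s: "s \<in> {0<..<L}"
  shows "F s = 0"
proof -
  define U where "U = {0<..<L} \<inter> F -` (- {0})"
  have "open U" unfolding U_def
    using cont by (intro continuous_open_preimage) auto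
  then have "closed (- U)" by (simp only: closed_def double_complement)
  moreover have "AE s\<in>{0<..<L} in lebesgue. s \<in> - U"
    using AE_completion[OF ae] by (rule AE_mp) (auto simp: U_def)
  ultimately have "s \<in> - U"
    by (rule mem_closed_if_AE_lebesgue_open[OF open_greaterThanLessThan _ _ s])
  then show ?thesis using s by (auto simp: U_def)
qed

lemma abs_orthogonal_matrix_le_1:
  fixes A :: "real^'n^'n"
  assumes "orthogonal_matrix A"
  shows "\<bar>A $ i $ j\<bar> \<le> 1"
proof -
  have "norm (row i A) = 1" using assms unfolding orthogonal_matrix_orthonormal_rows by blast
  then show ?thesis using component_le_norm_cart[of "row i A" j] by (simp add: row_def)
qed

text \<open>This linearises the system: the coefficient \<open>(G^T)^-1\<close> is \<open>G\<close>
  itself.\<close>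

lemma matrix_inv_transpose_orthogonal:
  fixes A :: "real^'n^'n"
  assumes "orthogonal_matrix A"
  shows "matrix_inv (transpose A) = A" "invertible A"
proof -
  have o: "transpose A ** A = mat 1" "A ** transpose A = mat 1" using assms by (simp_all add: orthogonal_matrix_def)
  then show "invertible A" unfolding invertible_def by blast
  have "invertible (transpose A)" unfolding invertible_def using o by blast
  then have "transpose A ** matrix_inv (transpose A) = mat 1"
    unfolding invertible_def matrix_inv_def by (rule someI_ex[THEN conjunct1])
  then have "(A ** transpose A) ** matrix_inv (transpose A) = A"
    by (simp add: matrix_mul_assoc[symmetric])
  then show "matrix_inv (transpose A) = A" by (simp add: o)
qed

lemma precise_rep_continuous:
  assumes "isCont H s"
  shows "precise_rep H s = H s"
proof -
  have "(H \<longlongrightarrow> H s) (at_right s)" "(H \<longlongrightarrow> H s) (at_left s)"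
    using assms by (simp_all add: continuous_within filterlim_at_split)
  then have "Lim (at_right s) H = H s" "Lim (at_left s) H = H s"
    by (auto intro!: tendsto_Lim)
  then show ?thesis by (simp add: precise_rep_def flip: scaleR_2)
qed

lemma continuous_on_matrix:
  fixes H :: "real \<Rightarrow> real^'n^'m"
  assumes "\<And>i j. continuous_on S (\<lambda>s. H s $ i $ j)"
  shows "continuous_on S H"
proof -
  have "continuous_on S (\<lambda>s. \<chi> i. \<chi> j. H s $ i $ j)"
    using assms by (intro continuous_on_vec_lambda)
  then show ?thesis by (simp only: vec_nth_inverse)
qed

lemma (in interval_measure) set_integral_neg_sum:
  fixes h :: "'k \<Rightarrow> real \<Rightarrow> real"
  assumes h: "\<And>k. integrable M (h k)" and B: "B \<in> sets borel"
  shows "(LINT s:B|M. - (\<Sum>k\<in>J. h k s)) = - (\<Sum>k\<in>J. LINT s:B|M. h k s)"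
proof -
  have "(LINT s:B|M. - (\<Sum>k\<in>J. h k s)) = (\<integral>s. - (\<Sum>k\<in>J. indicator B s *\<^sub>R h k s) \<partial>M)"
    by (simp only: set_lebesgue_integral_def real_scaleR_def mult_minus_right sum_distrib_left)
  also have "\<dots> = - (\<integral>s. (\<Sum>k\<in>J. indicator B s *\<^sub>R h k s) \<partial>M)" by (rule integral_minus)
  also have "(\<integral>s. (\<Sum>k\<in>J. indicator B s *\<^sub>R h k s) \<partial>M) = (\<Sum>k\<in>J. LINT s:B|M. h k s)"
    unfolding set_lebesgue_integral_def
    by (rule Bochner_Integration.integral_sum) (use set_integrable_borel[OF h B] in \<open>simp add: set_integrable_def\<close>)
  finally show ?thesis .
qed

locale frame_data = atomless_interval_measure +
  fixes \<theta> \<phi> f g l :: "real \<Rightarrow> real"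
  assumes L_pos: "L > 0" and \<theta>: "continuous_BV_on {0<..<L} \<theta>" and \<phi>: "continuous_BV_on {0<..<L} \<phi>"
    and f: "is_density f \<theta>" and g: "is_density g \<phi>"
    and l: "l \<in> borel_measurable M" "\<And>x. 0 \<le> l x" "density M (\<lambda>x. ennreal (l x)) = restrict_space lborel {0<..<L}"
begin

text \<open>\<open>Omega\<close> depends linearly on its two functions, so inserting the densities
  of \<theta> and \<phi> gives the density of \<open>D\<Omega>\<close>.\<close>

definition K :: "3 \<Rightarrow> 3 \<Rightarrow> real \<Rightarrow> real" where
  "K k j r = Omega f g r $ k $ j"

lemma K_skew: "K k j r = - K j k r"
  using exhaust_3[of k] exhaust_3[of j] by (auto simp: K_def Omega_def)

lemma is_density_Omega: "is_density (K k j) (\<lambda>s. Omega \<theta> \<phi> s $ k $ j)"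
proof -
  have 0: "is_density (\<lambda>_. 0) (\<lambda>_. 0)" by (simp add: is_density_def)
  have m: "is_density (\<lambda>s. - h s) (\<lambda>s. - u s)" if "is_density h u" for h u
    using that by (simp add: is_density_def set_lebesgue_integral_def)
  have "K k j = (\<lambda>r. Omega f g r $ k $ j)" by (simp add: fun_eq_iff K_def)
  then show ?thesis
    using exhaust_3[of k] exhaust_3[of j] 0 f g m[OF f] m[OF g] by (auto simp: Omega_def)
qed

lemma integrable_K: "integrable M (K k j)"
  using is_density_Omega by (simp add: is_density_def)

text \<open>Formulated for any continuous orthogonal \<open>H\<close>, as it serves both to verify
  that \<open>frame\<close> is a solution and to turn an arbitrary solution into one of the linear
  equation. \<open>A\<close> is identified with \<open>H\<close> on the interval only, so
  measurability and integrals are transferred there.\<close>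

lemma continuous_orthogonal_coefficient:
  assumes cont: "\<And>i j. continuous_on {0<..<L} (\<lambda>s. H s $ i $ j)"
    and orth: "\<forall>s\<in>{0<..<L}. orthogonal_matrix (H s)"
  defines "A \<equiv> \<lambda>s. matrix_inv (transpose (precise_rep H s))"
  shows "s \<in> {0<..<L} \<Longrightarrow> precise_rep H s = H s"
    and "integrable M (\<lambda>s. H s $ i $ k * K k' j s)"
    and "D_integrable {0<..<L} (\<lambda>s. Omega \<theta> \<phi> s $ k' $ j) (\<lambda>s. A s $ i $ k)"
    and "B \<in> sets borel \<Longrightarrow> D_integral {0<..<L} (\<lambda>s. Omega \<theta> \<phi> s $ k' $ j) (\<lambda>s. A s $ i $ k) B =
      (LINT s:B|M. H s $ i $ k * K k' j s)"
proof -
  have "continuous_on {0<..<L} H" using cont by (rule continuous_on_matrix)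
  then show prec: "precise_rep H s = H s" if "s \<in> {0<..<L}" for s
    using that by (intro precise_rep_continuous) (simp add: continuous_on_eq_continuous_at)
  have A: "A s = H s" if "s \<in> {0<..<L}" for s
    unfolding A_def prec[OF that] using orth that by (intro matrix_inv_transpose_orthogonal) blast
  have meas: "(\<lambda>s. H s $ i $ k) \<in> borel_measurable M"
    using cont by (rule continuous_on_borel_measurable_M)
  show int: "integrable M (\<lambda>s. H s $ i $ k * K k' j s)"
    by (rule integrable_mult_bounded[OF integrable_K meas]) (use orth abs_orthogonal_matrix_le_1 in blast)
  have measA: "(\<lambda>s. A s $ i $ k) \<in> borel_measurable M"
    using meas by (subst measurable_cong[where g = "\<lambda>s. H s $ i $ k"]) (simp_all add: A)
  have intA: "integrable M (\<lambda>s. A s $ i $ k * K k' j s)"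
    using int by (subst Bochner_Integration.integrable_cong[where g = "\<lambda>s. H s $ i $ k * K k' j s"]) (simp_all add: A)
  show "D_integrable {0<..<L} (\<lambda>s. Omega \<theta> \<phi> s $ k' $ j) (\<lambda>s. A s $ i $ k)"
    by (rule D_integral_is_density(1)[OF is_density_Omega measA intA])
  assume B: "B \<in> sets borel"
  show "D_integral {0<..<L} (\<lambda>s. Omega \<theta> \<phi> s $ k' $ j) (\<lambda>s. A s $ i $ k) B =
      (LINT s:B|M. H s $ i $ k * K k' j s)"
    unfolding D_integral_is_density(2)[OF is_density_Omega measA intA B] set_lebesgue_integral_def
    by (rule Bochner_Integration.integral_cong) (simp_all add: A)
qed

text \<open>Each row is its own linear problem, with the corresponding row of the identity as
  initial value.\<close>

definition frame :: "real \<Rightarrow> real^3^3" where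
  "frame s = (\<chi> i j. (SOME y. solves_linear K (\<lambda>j. mat 1 $ i $ j) y) j s)"

definition dframe :: "3 \<Rightarrow> 3 \<Rightarrow> real \<Rightarrow> real" where
  "dframe i j r = - (\<Sum>k\<in>UNIV. frame r $ i $ k * K k j r)"

lemma solves_linear_frame: "solves_linear K (\<lambda>j. mat 1 $ i $ j) (\<lambda>j s. frame s $ i $ j)"
proof -
  have "\<exists>y. solves_linear K (\<lambda>j. mat 1 $ i $ j) y" by (rule ex_solves_linear[OF integrable_K])
  then have "solves_linear K (\<lambda>j. mat 1 $ i $ j) (SOME y. solves_linear K (\<lambda>j. mat 1 $ i $ j) y)"
    by (rule someI_ex)
  then show ?thesis by (simp add: frame_def)
qed

lemma frame_eq_prim:
  shows "integrable M (dframe i j)" "frame s $ i $ j = mat 1 $ i $ j + prim (dframe i j) s"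
proof -
  show "integrable M (dframe i j)"
    unfolding dframe_def using solves_linear_eq_prim(1)[OF solves_linear_frame[of i], of j] by simp
  show "frame s $ i $ j = mat 1 $ i $ j + prim (dframe i j) s"
    unfolding dframe_def by (rule solves_linear_eq_prim(2)[OF solves_linear_frame])
qed

lemma frame_0: "s \<le> 0 \<Longrightarrow> frame s = mat 1"
  by (simp add: vec_eq_iff frame_eq_prim(2) prim_le_0)

lemma isCont_frame_nth: "isCont (\<lambda>s. frame s $ i $ j) s"
  unfolding frame_eq_prim(2) by (intro continuous_intros isCont_prim frame_eq_prim)

lemma continuous_on_frame_nth: "continuous_on S (\<lambda>s. frame s $ i $ j)"
  using isCont_frame_nth by (blast intro: continuous_at_imp_continuous_on)

lemma continuous_on_frame: "continuous_on S frame"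
  by (intro continuous_on_matrix continuous_on_frame_nth)

lemma orthogonal_frame: "orthogonal_matrix (frame s)"
proof -
  have "(frame s ** transpose (frame s)) $ i $ l = mat 1 $ i $ l" for i l
  proof -
    have "(frame s ** transpose (frame s)) $ i $ l = (\<Sum>j\<in>UNIV. frame s $ i $ j * frame s $ l $ j)"
      by (simp add: matrix_matrix_mult_def transpose_def)
    also have "\<dots> = (\<Sum>j\<in>UNIV. mat 1 $ i $ j * (mat 1 :: real^3^3) $ l $ j)"
      by (rule solves_linear_inner_const[OF K_skew solves_linear_frame solves_linear_frame])
    also have "\<dots> = (mat 1 ** transpose (mat 1 :: real^3^3)) $ i $ l"
      unfolding matrix_matrix_mult_def transpose_def by simp
    finally show ?thesis by simp
  qed
  then have "frame s ** transpose (frame s) = mat 1" by (simp add: vec_eq_iff)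
  then show ?thesis
    unfolding orthogonal_matrix_def by (intro conjI, subst matrix_left_right_inverse)
qed

text \<open>The determinant is continuous on the line with values in \<open>{-1, 1}\<close>, hence
  constant, and it is 1 at 0, where the frame is the identity.\<close>

lemma rotation_frame: "rotation_matrix (frame s)"
proof -
  have "(\<lambda>s. det (frame s)) constant_on UNIV"
  proof (rule continuous_finite_range_constant)
    show "continuous_on UNIV (\<lambda>s. det (frame s))"
      unfolding det_3
      by (intro continuous_on_add continuous_on_diff continuous_on_mult continuous_on_frame_nth)
    have "(\<lambda>s. det (frame s)) ` UNIV \<subseteq> {-1, 1}" using det_orthogonal_matrix[OF orthogonal_frame] by auto
    then show "finite ((\<lambda>s. det (frame s)) ` UNIV)" by (rule finite_subset) simp
  qed simp
  then have "det (frame s) = det (frame 0)" unfolding constant_on_def by auto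
  then show ?thesis using orthogonal_frame by (simp add: rotation_matrix_def frame_0)
qed

lemma is_density_frame: "is_density (dframe i j) (\<lambda>s. frame s $ i $ j)"
  by (rule is_density_prim[OF frame_eq_prim(1) _ L_pos]) (rule frame_eq_prim(2))

lemma continuous_BV_SO3_frame: "continuous_BV_SO3 {0<..<L} frame"
  unfolding continuous_BV_SO3_def
proof (intro conjI allI)
  show "continuous_BV_on {0<..<L} (\<lambda>s. frame s $ i $ j)" for i j
    by (rule continuous_BV_on_prim[OF frame_eq_prim(1) _ L_pos]) (rule frame_eq_prim(2))
qed (simp add: rotation_frame)

lemma frame_tendsto: "(frame \<longlongrightarrow> mat 1) (at_right 0)"
proof -
  have "isCont frame 0" using continuous_on_frame[of UNIV] by (simp add: continuous_on_eq_continuous_at)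
  then show ?thesis using frame_0[of 0] by (simp add: continuous_within filterlim_at_split)
qed

lemma solves_system_frame: "solves_system L (Omega \<theta> \<phi>) frame"
  unfolding solves_system_def Let_def
proof (intro conjI allI ballI impI frame_tendsto)
  have "\<forall>s\<in>{0<..<L}. orthogonal_matrix (frame s)" using orthogonal_frame by blast
  note H = continuous_orthogonal_coefficient[OF continuous_on_frame_nth this]
  show "invertible (precise_rep frame s)" if "s \<in> {0<..<L}" for s
    unfolding H(1)[OF that] by (rule matrix_inv_transpose_orthogonal(2)[OF orthogonal_frame])
  show "D_integrable {0<..<L} (\<lambda>s. Omega \<theta> \<phi> s $ k $ j) (\<lambda>s. matrix_inv (transpose (precise_rep frame s)) $ i $ k)" for i j k
    by (rule H(3))
  fix i j B assume B: "B \<in> sets borel" "B \<subseteq> {0<..<L}"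
  have "D_measure {0<..<L} (\<lambda>s. frame s $ i $ j) B = (LINT s:B|M. dframe i j s)"
    by (rule D_measure_is_density[OF is_density_frame B])
  also have "\<dots> = - (\<Sum>k\<in>UNIV. LINT s:B|M. frame s $ i $ k * K k j s)"
    unfolding dframe_def by (rule set_integral_neg_sum[OF H(2) B(1)])
  finally show "D_measure {0<..<L} (\<lambda>s. frame s $ i $ j) B =
      - (\<Sum>k\<in>UNIV. D_integral {0<..<L} (\<lambda>s. Omega \<theta> \<phi> s $ k $ j) (\<lambda>s. matrix_inv (transpose (precise_rep frame s)) $ i $ k) B)"
    unfolding H(4)[OF B(1)] .
qed

text \<open>\<open>H\<close> is controlled on the open interval only, and its initial value is a
  limit. The primitive \<open>x\<close> extends it to the line and solves the linear equation there,
  where uniqueness is available.\<close>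

lemma solves_system_unique:
  assumes BV: "continuous_BV_SO3 {0<..<L} H" and sol: "solves_system L (Omega \<theta> \<phi>) H" and s: "s \<in> {0<..<L}"
  shows "H s = frame s"
proof -
  have cBV: "continuous_BV_on {0<..<L} (\<lambda>s. H s $ i $ j)" for i j
    using BV by (simp add: continuous_BV_SO3_def)
  then have cont: "continuous_on {0<..<L} (\<lambda>s. H s $ i $ j)" for i j
    by (simp add: continuous_BV_on_def)
  have orth: "orthogonal_matrix (H s)" if "s \<in> {0<..<L}" for s
  proof -
    have "(H s ** transpose (H s)) $ i $ l - mat 1 $ i $ l = 0" for i l
    proof (rule continuous_AE_eq_0[OF _ _ that])
      show "continuous_on {0<..<L} (\<lambda>s. (H s ** transpose (H s)) $ i $ l - mat 1 $ i $ l)"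
      proof -
        have "(\<lambda>s. (H s ** transpose (H s)) $ i $ l - mat 1 $ i $ l) =
            (\<lambda>s. (\<Sum>j\<in>UNIV. H s $ i $ j * H s $ l $ j) - mat 1 $ i $ l)"
          by (simp add: matrix_matrix_mult_def transpose_def)
        then show ?thesis
          by (simp only:) (intro continuous_on_diff continuous_on_sum continuous_on_mult continuous_on_const cont)
      qed
      have "AE s\<in>{0<..<L} in lborel. rotation_matrix (H s)" using BV by (simp add: continuous_BV_SO3_def)
      then show "AE s\<in>{0<..<L} in lborel. (H s ** transpose (H s)) $ i $ l - mat 1 $ i $ l = 0"
        by eventually_elim (auto simp: rotation_matrix_def orthogonal_matrix_def)
    qed
    then have "H s ** transpose (H s) = mat 1" by (simp add: vec_eq_iff)
    then show ?thesis
      unfolding orthogonal_matrix_def by (intro conjI, subst matrix_left_right_inverse)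
  qed
  then have "\<forall>s\<in>{0<..<L}. orthogonal_matrix (H s)" by blast
  note H = continuous_orthogonal_coefficient[OF cont this]
  have sys: "\<forall>i j. \<forall>B\<in>sets borel. B \<subseteq> {0<..<L} \<longrightarrow> D_measure {0<..<L} (\<lambda>s. H s $ i $ j) B =
      - (\<Sum>k\<in>UNIV. D_integral {0<..<L} (\<lambda>s. Omega \<theta> \<phi> s $ k $ j)
          (\<lambda>s. matrix_inv (transpose (precise_rep H s)) $ i $ k) B)"
    and init: "(H \<longlongrightarrow> mat 1) (at_right 0)"
    using sol unfolding solves_system_def Let_def by iprover+
  define dH where "dH i j r = - (\<Sum>k\<in>UNIV. H r $ i $ k * K k j r)" for i j r
  have int: "integrable M (dH i j)" for i j
    unfolding dH_def using H(2) by simp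
  define x where "x i j s = mat 1 $ i $ j + prim (dH i j) s" for i j s
  have xH: "x i j s = H s $ i $ j" if s: "s \<in> {0<..<L}" for i j s
  proof -
    have step: "H z $ i $ j - H a $ i $ j = prim (dH i j) z - prim (dH i j) a" if "0 < a" "a < z" "z < L" for a z
    proof -
      have B: "{a<..<z} \<in> sets borel" "{a<..<z} \<subseteq> {0<..<L}" using that by auto
      have "H z $ i $ j - H a $ i $ j = D_measure {0<..<L} (\<lambda>s. H s $ i $ j) {a<..<z}"
        using continuous_BV_on_D_measure[OF cBV that] by simp
      also have "\<dots> = - (\<Sum>k\<in>UNIV. LINT s:{a<..<z}|M. H s $ i $ k * K k j s)"
        unfolding H(4)[OF B(1), symmetric] using sys B by blast
      also have "\<dots> = (LINT s:{a<..<z}|M. dH i j s)"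
        unfolding dH_def by (rule set_integral_neg_sum[OF H(2) B(1), symmetric])
      also have "\<dots> = prim (dH i j) z - prim (dH i j) a"
        using prim_diff_Ioo[OF int, of a z] that by simp
      finally show ?thesis .
    qed
    \<comment> \<open>The left end \<open>a\<close> tends to 0 in \<open>step\<close>: the initial
      condition enters as a limit, and the primitive is continuous at 0.\<close>
    have ev: "eventually (\<lambda>a. H s $ i $ j - H a $ i $ j = prim (dH i j) s - prim (dH i j) a) (at_right 0)"
      using eventually_at_right_real[of 0 s] s by (auto elim!: eventually_mono intro!: step)
    have "((\<lambda>a. H s $ i $ j - H a $ i $ j) \<longlongrightarrow> H s $ i $ j - mat 1 $ i $ j) (at_right 0)"
      by (intro tendsto_intros init)
    then have lim: "((\<lambda>a. prim (dH i j) s - prim (dH i j) a) \<longlongrightarrow> H s $ i $ j - mat 1 $ i $ j) (at_right 0)"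
      by (rule tendsto_cong[OF ev, THEN iffD1])
    have "isCont (prim (dH i j)) 0" by (rule isCont_prim[OF int])
    then have "(prim (dH i j) \<longlongrightarrow> prim (dH i j) 0) (at_right 0)"
      by (simp add: continuous_within filterlim_at_split)
    then have "((\<lambda>a. prim (dH i j) s - prim (dH i j) a) \<longlongrightarrow> prim (dH i j) s - prim (dH i j) 0) (at_right 0)"
      by (intro tendsto_intros)
    from tendsto_unique[OF _ lim this] have "H s $ i $ j - mat 1 $ i $ j = prim (dH i j) s - prim (dH i j) 0"
      by simp
    then show ?thesis by (simp add: x_def prim_le_0)
  qed
  have "solves_linear K (\<lambda>j. mat 1 $ i $ j) (x i)" for i
    unfolding solves_linear_def
  proof (intro conjI allI)
    show "integrable M (\<lambda>r. x i k r * K k j r)" for k j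
      by (subst Bochner_Integration.integrable_cong[where N = M and g = "\<lambda>r. H r $ i $ k * K k j r"])
        (simp_all add: xH H(2))
    fix j s
    have "x i j s = mat 1 $ i $ j - (\<Sum>k\<in>UNIV. prim (\<lambda>r. H r $ i $ k * K k j r) s)"
      unfolding x_def dH_def using H(2) by (simp add: prim_uminus prim_sum)
    also have "(\<Sum>k\<in>UNIV. prim (\<lambda>r. H r $ i $ k * K k j r) s) = (\<Sum>k\<in>UNIV. prim (\<lambda>r. x i k r * K k j r) s)"
      by (intro sum.cong refl prim_cong) (simp add: xH)
    finally show "x i j s = mat 1 $ i $ j - (\<Sum>k\<in>UNIV. prim (\<lambda>r. x i k r * K k j r) s)" .
  qed
  from solves_linear_unique[OF K_skew this solves_linear_frame]
  have "x i j s = frame s $ i $ j" for i j by (rule fun_cong[OF fun_cong])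
  then show ?thesis using xH[OF s] by (simp add: vec_eq_iff)
qed

end

subsection \<open>The Frenet--Serret system\<close>

text \<open>Off the union of the two exceptional null sets both densities integrate to the same
  measure; removing a null set changes no integral, so they agree on all Borel sets.\<close>

lemma is_ac_density_unique:
  assumes f1: "is_ac_density {0<..<L} u f1" and f2: "is_ac_density {0<..<L} u f2"
  shows "AE s\<in>{0<..<L} in lborel. f1 s = f2 s"
proof -
  obtain Z1 where Z1: "Z1 \<in> null_sets lborel"
    "\<And>B. B \<in> sets borel \<Longrightarrow> B \<subseteq> {0<..<L} - Z1 \<Longrightarrow> D_measure {0<..<L} u B = (LINT s:B|lborel. f1 s)"
    using f1 unfolding is_ac_density_def by blast
  obtain Z2 where Z2: "Z2 \<in> null_sets lborel"
    "\<And>B. B \<in> sets borel \<Longrightarrow> B \<subseteq> {0<..<L} - Z2 \<Longrightarrow> D_measure {0<..<L} u B = (LINT s:B|lborel. f2 s)"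
    using f2 unfolding is_ac_density_def by blast
  have i1: "integrable lborel (\<lambda>s. indicator {0<..<L} s *\<^sub>R f1 s)" and i2: "integrable lborel (\<lambda>s. indicator {0<..<L} s *\<^sub>R f2 s)"
    using f1 f2 unfolding is_ac_density_def set_integrable_def by blast+
  let ?Z = "Z1 \<union> Z2"
  have Z: "?Z \<in> null_sets lborel" using Z1(1) Z2(1) by (rule null_sets.Un)
  then have AE_Z: "AE s in lborel. s \<notin> ?Z" by (rule AE_not_in)
  have "AE s in lborel. indicator {0<..<L} s *\<^sub>R f1 s = indicator {0<..<L} s *\<^sub>R f2 s"
  proof (rule density_unique_real[OF i1 i2])
    fix A :: "real set" assume "A \<in> sets lborel"
    then have A: "A \<in> sets borel" by simp
    define B where "B = A \<inter> {0<..<L} - ?Z"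
    have B: "B \<in> sets borel" "B \<subseteq> {0<..<L} - Z1" "B \<subseteq> {0<..<L} - Z2"
      using A Z by (auto simp: B_def null_sets_def)
    have eq: "(LINT s:A|lborel. indicator {0<..<L} s *\<^sub>R f s) = (LINT s:B|lborel. f s)"
      if "integrable lborel (\<lambda>s. indicator {0<..<L} s *\<^sub>R f s)" for f :: "real \<Rightarrow> real"
      unfolding set_lebesgue_integral_def
    proof (rule integral_cong_AE)
      show "(\<lambda>s. indicator A s *\<^sub>R indicator {0<..<L} s *\<^sub>R f s) \<in> borel_measurable lborel"
        using borel_measurable_integrable[OF that] A by measurable
      \<comment> \<open>Only the product of \<open>f\<close> with the indicator of the interval is
        known to be measurable, so the indicator of \<open>B\<close> is multiplied onto that
        product.\<close>
      have "(\<lambda>s. indicator B s *\<^sub>R (indicator {0<..<L} s *\<^sub>R f s)) \<in> borel_measurable lborel"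
        using borel_measurable_integrable[OF that] B(1) by measurable
      also have "(\<lambda>s. indicator B s *\<^sub>R (indicator {0<..<L} s *\<^sub>R f s)) = (\<lambda>s. indicator B s *\<^sub>R f s)"
        using B(2) by (auto simp: fun_eq_iff split: split_indicator)
      finally show "(\<lambda>s. indicator B s *\<^sub>R f s) \<in> borel_measurable lborel" .
      show "AE s in lborel. indicator A s *\<^sub>R indicator {0<..<L} s *\<^sub>R f s = indicator B s *\<^sub>R f s"
        using AE_Z by (rule AE_mp) (auto simp: B_def split: split_indicator)
    qed
    show "(LINT s:A|lborel. indicator {0<..<L} s *\<^sub>R f1 s) = (LINT s:A|lborel. indicator {0<..<L} s *\<^sub>R f2 s)"
      using eq[OF i1] eq[OF i2] Z1(2)[OF B(1,2)] Z2(2)[OF B(1,3)] by simp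
  qed
  then show ?thesis by (rule AE_mp) (auto split: split_indicator)
qed

context frame_data
begin

text \<open>As \<open>l\<close> is the density of Lebesgue measure with respect to \<open>M\<close>, the singular part of \<open>h M\<close> lives
  on \<open>{l = 0}\<close>.\<close>

lemma is_ac_density_quotient:
  assumes "is_density h u"
  shows "is_ac_density {0<..<L} u (\<lambda>s. h s / l s)"
proof -
  let ?Q = "restrict_space lborel {0<..<L}"
  have h: "integrable M h" using assms by (simp add: is_density_def)
  then have [measurable]: "h \<in> borel_measurable M" "l \<in> borel_measurable M" using l(1) by auto
  have "integrable M (\<lambda>s. l s *\<^sub>R (h s / l s))"
    by (rule Bochner_Integration.integrable_bound[OF h]) auto
  then have "integrable ?Q (\<lambda>s. h s / l s)"
    unfolding l(3)[symmetric] using l(2) by (subst integrable_density) auto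
  then have int: "set_integrable lborel {0<..<L} (\<lambda>s. h s / l s)"
    by (simp add: set_integrable_def integrable_restrict_space)
  define Z where "Z = {s \<in> space M. l s = 0}"
  have ZM: "Z \<in> sets M" unfolding Z_def by measurable
  then have Zb: "Z \<in> sets lborel" unfolding sets_M sets_restrict_space by auto
  have "emeasure ?Q Z = 0"
    unfolding l(3)[symmetric] using ZM l(1)
    by (simp add: emeasure_density) (subst nn_integral_0_iff_AE, auto simp: Z_def simp del: space_M split: split_indicator)
  then have "emeasure lborel Z = 0"
    by (subst (asm) emeasure_restrict_space) (auto simp: Z_def)
  then have Z: "Z \<in> null_sets lborel" using Zb by (rule null_setsI)
  have "D_measure {0<..<L} u B = (LINT s:B|lborel. h s / l s)" if B: "B \<in> sets borel" "B \<subseteq> {0<..<L} - Z" for B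
  proof -
    have [measurable]: "(indicator B :: real \<Rightarrow> real) \<in> borel_measurable M" by (rule indicator_measurable_M[OF B(1)])
    have "(LINT s:B|lborel. h s / l s) = (\<integral>s. indicator {0<..<L} s *\<^sub>R (indicator B s * (h s / l s)) \<partial>lborel)"
      unfolding set_lebesgue_integral_def
      by (rule Bochner_Integration.integral_cong) (use B in \<open>auto split: split_indicator\<close>)
    also have "\<dots> = (\<integral>s. indicator B s * (h s / l s) \<partial>?Q)"
      by (rule integral_restrict_space[symmetric]) simp
    also have "\<dots> = (\<integral>s. l s *\<^sub>R (indicator B s * (h s / l s)) \<partial>M)"
      unfolding l(3)[symmetric] using l(2) by (subst integral_density) auto
    also have "\<dots> = (LINT s:B|M. h s)"
      unfolding set_lebesgue_integral_def
      by (rule Bochner_Integration.integral_cong) (use B in \<open>auto simp: Z_def split: split_indicator\<close>)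
    finally show ?thesis using D_measure_is_density[OF assms B(1)] B(2) by auto
  qed
  then show ?thesis unfolding is_ac_density_def using int Z by blast
qed

text \<open>Since \<open>h / l\<close> is a density of the absolutely continuous part, so is the
  representative picked by \<open>SOME\<close>, and the two agree almost everywhere.\<close>

lemma AE_ae_deriv:
  assumes "is_density h u"
  shows "AE s\<in>{0<..<L} in lborel. ae_deriv {0<..<L} u s = h s / l s"
proof (rule is_ac_density_unique)
  show "is_ac_density {0<..<L} u (\<lambda>s. h s / l s)" by (rule is_ac_density_quotient[OF assms])
  then show "is_ac_density {0<..<L} u (ae_deriv {0<..<L} u)" unfolding ae_deriv_def
    by (rule someI[where P = "is_ac_density {0<..<L} u"])
qed

lemma dframe_simps:
  "dframe i 1 r = f r * frame r $ i $ 2"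
  "dframe i 2 r = - f r * frame r $ i $ 1 + g r * frame r $ i $ 3"
  "dframe i 3 r = - g r * frame r $ i $ 2"
  by (simp_all add: dframe_def K_def Omega_def sum_3)

text \<open>Dividing \<open>dframe_simps\<close> by \<open>l\<close> turns each density into an a.e.
  derivative; the exceptional null sets of the finitely many entries are merged first.\<close>

lemma Frenet_Serret:
  fixes t n b
  defines "t \<equiv> \<lambda>s. frame s *v axis 1 1" and "n \<equiv> \<lambda>s. frame s *v axis 2 1" and "b \<equiv> \<lambda>s. frame s *v axis 3 1"
  shows "AE s\<in>{0<..<L} in lborel.
          ae_vector_deriv {0<..<L} t s = ae_deriv {0<..<L} \<theta> s *\<^sub>R n s \<and>
          ae_vector_deriv {0<..<L} n s = - ae_deriv {0<..<L} \<theta> s *\<^sub>R t s + ae_deriv {0<..<L} \<phi> s *\<^sub>R b s \<and>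
          ae_vector_deriv {0<..<L} b s = - ae_deriv {0<..<L} \<phi> s *\<^sub>R n s"
proof -
  have comp: "(frame s *v axis j 1) $ i = frame s $ i $ j" for s i j
    by (simp add: matrix_vector_mult_basis column_def)
  have "AE s in lborel. \<forall>i j. s \<in> {0<..<L} \<longrightarrow> ae_deriv {0<..<L} (\<lambda>s. frame s $ i $ j) s = dframe i j s / l s"
    using AE_ae_deriv[OF is_density_frame] by (simp only: AE_all_countable) simp
  then show ?thesis
    using AE_ae_deriv[OF f] AE_ae_deriv[OF g]
    by eventually_elim
      (auto simp: vec_eq_iff ae_vector_deriv_def t_def n_def b_def comp dframe_simps add_divide_distrib diff_divide_distrib)
qed

end

subsection \<open>Angles\<close>

lemma Cauchy_Schwarz_quotient:
  fixes u v :: "real^3"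
  shows "-1 \<le> u \<bullet> v / (norm u * norm v)" "u \<bullet> v / (norm u * norm v) \<le> 1"
proof -
  have "\<bar>u \<bullet> v / (norm u * norm v)\<bar> \<le> 1"
    using Cauchy_Schwarz_ineq2[of u v] by (cases "norm u * norm v = 0") (simp_all add: divide_simps)
  then show "-1 \<le> u \<bullet> v / (norm u * norm v)" "u \<bullet> v / (norm u * norm v) \<le> 1" by linarith+
qed

lemma angle_bounds: "0 \<le> turning_angle u v" "turning_angle u v \<le> pi"
  unfolding turning_angle_def by (simp_all add: arccos_lbound arccos_ubound Cauchy_Schwarz_quotient)

lemma cos_angle: "cos (turning_angle u v) = u \<bullet> v / (norm u * norm v)"
  unfolding turning_angle_def by (intro cos_arccos Cauchy_Schwarz_quotient)

lemma angle_commute: "turning_angle u v = turning_angle v u"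
  by (simp add: turning_angle_def inner_commute mult.commute)

lemma angle_0 [simp]: "turning_angle u 0 = pi / 2" "turning_angle 0 u = pi / 2"
  by (simp_all add: turning_angle_def)

lemma angle_self: "u \<noteq> 0 \<Longrightarrow> turning_angle u u = 0"
  by (simp add: turning_angle_def flip: power2_norm_eq_inner power2_eq_square)

lemma angle_minus: "turning_angle u (- v) = pi - turning_angle u v"
  unfolding turning_angle_def using Cauchy_Schwarz_quotient[of u v] by (simp add: arccos_minus)

lemma angle_scale: "a > 0 \<Longrightarrow> turning_angle (a *\<^sub>R u) v = turning_angle u v"
  "a > 0 \<Longrightarrow> turning_angle u (a *\<^sub>R v) = turning_angle u v"
  by (simp_all add: turning_angle_def)

lemma angle_le_iff:
  assumes "0 \<le> a" "a \<le> pi"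
  shows "turning_angle u v \<le> a \<longleftrightarrow> cos a \<le> u \<bullet> v / (norm u * norm v)"
  using cos_mono_le_eq[of a "turning_angle u v"] angle_bounds[of u v] assms by (simp add: cos_angle)

lemma sin_angle:
  assumes "u \<noteq> 0" "v \<noteq> 0"
  shows "sin (turning_angle u v) = sqrt ((norm u)\<^sup>2 * (norm v)\<^sup>2 - (u \<bullet> v)\<^sup>2) / (norm u * norm v)"
proof -
  have "sin (turning_angle u v) = sqrt (1 - (u \<bullet> v / (norm u * norm v))\<^sup>2)"
    unfolding turning_angle_def using Cauchy_Schwarz_quotient[of u v] by (intro sin_arccos) auto
  also have "1 - (u \<bullet> v / (norm u * norm v))\<^sup>2 = ((norm u)\<^sup>2 * (norm v)\<^sup>2 - (u \<bullet> v)\<^sup>2) / (norm u * norm v)\<^sup>2"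
    using assms by (simp add: field_simps power2_eq_square)
  finally show ?thesis using assms by (simp add: real_sqrt_divide)
qed

text \<open>\<open>?U\<close> and \<open>?W\<close> are the components of \<open>u\<close> and
  \<open>w\<close> orthogonal to \<open>v\<close>, multiplied by \<open>|v|^2\<close> to avoid
  fractions. Cauchy-Schwarz for them says that the cosine of the angle between \<open>u\<close> and
  \<open>w\<close> is at least that of the sum of the other two angles. A sum beyond
  \<open>pi\<close> makes the claim trivial.\<close>

lemma angle_triangle:
  assumes "u \<noteq> 0" "v \<noteq> 0" "w \<noteq> 0"
  shows "turning_angle u w \<le> turning_angle u v + turning_angle v w"
proof (cases "turning_angle u v + turning_angle v w \<le> pi")
  case True
  let ?p = "norm u" and ?q = "norm v" and ?r = "norm w"
  have pos: "?p > 0" "?q > 0" "?r > 0" using assms by auto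
  let ?U = "?q\<^sup>2 *\<^sub>R u - (u \<bullet> v) *\<^sub>R v" and ?W = "?q\<^sup>2 *\<^sub>R w - (v \<bullet> w) *\<^sub>R v"
  define A where "A = ?p\<^sup>2 * ?q\<^sup>2 - (u \<bullet> v)\<^sup>2"
  define B where "B = ?q\<^sup>2 * ?r\<^sup>2 - (v \<bullet> w)\<^sup>2"
  have UU: "?U \<bullet> ?U = ?q\<^sup>2 * A" and WW: "?W \<bullet> ?W = ?q\<^sup>2 * B"
    unfolding A_def B_def power2_norm_eq_inner
    by (simp_all add: inner_diff inner_commute power2_eq_square algebra_simps)
  have UW: "?U \<bullet> ?W = ?q\<^sup>2 * (?q\<^sup>2 * (u \<bullet> w) - (u \<bullet> v) * (v \<bullet> w))"
    unfolding power2_norm_eq_inner by (simp add: inner_diff inner_commute power2_eq_square algebra_simps)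
  have "- (norm ?U * norm ?W) \<le> ?U \<bullet> ?W" using Cauchy_Schwarz_ineq2[of ?U ?W] by linarith
  moreover have "norm ?U = ?q * sqrt A" "norm ?W = ?q * sqrt B"
    unfolding norm_eq_sqrt_inner[of ?U] norm_eq_sqrt_inner[of ?W] UU WW by (simp_all add: real_sqrt_mult)
  ultimately have "?q\<^sup>2 * - (sqrt A * sqrt B) \<le> ?q\<^sup>2 * (?q\<^sup>2 * (u \<bullet> w) - (u \<bullet> v) * (v \<bullet> w))"
    unfolding UW by (simp add: power2_eq_square mult_ac)
  then have "- (sqrt A * sqrt B) \<le> ?q\<^sup>2 * (u \<bullet> w) - (u \<bullet> v) * (v \<bullet> w)"
    using pos by (subst (asm) mult_le_cancel_left_pos) auto
  then have "((u \<bullet> v) * (v \<bullet> w) - sqrt A * sqrt B) / (?p * ?q\<^sup>2 * ?r) \<le> (?q\<^sup>2 * (u \<bullet> w)) / (?p * ?q\<^sup>2 * ?r)"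
    using pos by (intro divide_right_mono) auto
  also have "(?q\<^sup>2 * (u \<bullet> w)) / (?p * ?q\<^sup>2 * ?r) = u \<bullet> w / (?p * ?r)" using pos by simp
  also have "((u \<bullet> v) * (v \<bullet> w) - sqrt A * sqrt B) / (?p * ?q\<^sup>2 * ?r) = cos (turning_angle u v + turning_angle v w)"
    unfolding cos_add cos_angle sin_angle[OF assms(1,2)] sin_angle[OF assms(2,3)]
      A_def B_def using pos by (simp add: field_simps power2_eq_square)
  finally show ?thesis
    using True angle_bounds by (subst angle_le_iff) auto
next
  case False
  then show ?thesis using angle_bounds(2)[of u w] by linarith
qed

text \<open>\<open>a + b\<close> lies between \<open>a\<close> and \<open>b\<close> in their plane.
  All three pairs have the same Gram determinant \<open>R\<close>, which allows computing sine and
  cosine of the sum: the cosine is the desired one, and a nonnegative sine leaves only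
  \<open>[0, pi]\<close> or the value \<open>2 * pi\<close>.\<close>

lemma angle_add:
  assumes "a \<noteq> 0" "b \<noteq> 0" "a + b \<noteq> 0"
  shows "turning_angle a (a + b) + turning_angle (a + b) b = turning_angle a b"
proof -
  let ?p = "norm a" and ?q = "norm b" and ?N = "norm (a + b)" and ?d = "a \<bullet> b"
  let ?\<alpha> = "turning_angle a (a + b)" and ?\<gamma> = "turning_angle (a + b) b"
  have pos: "?p > 0" "?q > 0" "?N > 0" using assms by auto
  have N2: "?N\<^sup>2 = ?p\<^sup>2 + 2 * ?d + ?q\<^sup>2"
    by (simp add: power2_norm_eq_inner inner_add inner_commute)
  define R where "R = ?p\<^sup>2 * ?q\<^sup>2 - ?d\<^sup>2"
  have R0: "R \<ge> 0" unfolding R_def using Cauchy_Schwarz_ineq[of a b] by (simp add: power2_norm_eq_inner)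
  have ca: "cos ?\<alpha> = (?p\<^sup>2 + ?d) / (?p * ?N)" and cb: "cos ?\<gamma> = (?d + ?q\<^sup>2) / (?N * ?q)"
    unfolding cos_angle by (simp_all add: inner_add power2_norm_eq_inner)
  have "?p\<^sup>2 * ?N\<^sup>2 - (a \<bullet> (a + b))\<^sup>2 = R" "?N\<^sup>2 * ?q\<^sup>2 - ((a + b) \<bullet> b)\<^sup>2 = R"
    unfolding N2 R_def by (simp_all add: inner_add power2_norm_eq_inner[symmetric] power2_eq_square algebra_simps)
  then have sa: "sin ?\<alpha> = sqrt R / (?p * ?N)" and sb: "sin ?\<gamma> = sqrt R / (?N * ?q)"
    using sin_angle[OF assms(1,3)] sin_angle[OF assms(3,2)] by simp_all
  have "cos (?\<alpha> + ?\<gamma>) = ((?p\<^sup>2 + ?d) * (?d + ?q\<^sup>2) - sqrt R * sqrt R) / (?p * ?q * ?N\<^sup>2)"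
    unfolding cos_add ca cb sa sb using pos by (simp add: field_simps power2_eq_square)
  also have "(?p\<^sup>2 + ?d) * (?d + ?q\<^sup>2) - sqrt R * sqrt R = ?d * ?N\<^sup>2"
    unfolding N2 using R0 by (simp add: R_def power2_eq_square algebra_simps)
  also have "?d * ?N\<^sup>2 / (?p * ?q * ?N\<^sup>2) = cos (turning_angle a b)"
    using pos by (simp add: cos_angle)
  finally have cos_eq: "cos (?\<alpha> + ?\<gamma>) = cos (turning_angle a b)" .
  have "sin (?\<alpha> + ?\<gamma>) = sqrt R * ((?d + ?q\<^sup>2) + (?p\<^sup>2 + ?d)) / (?p * ?q * ?N\<^sup>2)"
    unfolding sin_add ca cb sa sb using pos by (simp add: field_simps power2_eq_square)
  also have "(?d + ?q\<^sup>2) + (?p\<^sup>2 + ?d) = ?N\<^sup>2" unfolding N2 by simp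
  finally have sin0: "sin (?\<alpha> + ?\<gamma>) \<ge> 0" using R0 by simp
  note bounds = angle_bounds[of a "a + b"] angle_bounds[of "a + b" b]
  have "?\<alpha> + ?\<gamma> \<le> pi"
  proof (rule ccontr)
    assume gt: "\<not> ?\<alpha> + ?\<gamma> \<le> pi"
    \<comment> \<open>The value \<open>2 * pi\<close> would make \<open>a\<close> and
      \<open>b\<close> both antiparallel to their own sum, and \<open>?N\<^sup>2\<close> would be
      negative.\<close>
    then have "?\<alpha> + ?\<gamma> = 2 * pi" using sin0 sin_lt_zero[of "?\<alpha> + ?\<gamma>"] bounds by fastforce
    then have "?\<alpha> = pi" "?\<gamma> = pi" using bounds by linarith+
    then have "(?p\<^sup>2 + ?d) / (?p * ?N) = -1" "(?d + ?q\<^sup>2) / (?N * ?q) = -1"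
      using ca cb by (metis cos_pi)+
    then have "?p\<^sup>2 + ?d = - (?p * ?N)" "?d + ?q\<^sup>2 = - (?N * ?q)"
      using pos by (simp_all only: divide_eq_eq) auto
    then have "?N\<^sup>2 = - (?N * (?p + ?q))" unfolding N2 by (simp add: algebra_simps)
    then have "0 < - (?N * (?p + ?q))" using pos by (metis zero_less_power)
    moreover have "0 < ?N * (?p + ?q)" using pos by (intro mult_pos_pos add_pos_pos)
    ultimately show False by linarith
  qed
  then show ?thesis using cos_eq cos_inj_pi[of "?\<alpha> + ?\<gamma>" "turning_angle a b"] bounds angle_bounds[of a b] by linarith
qed

text \<open>The value \<open>pi / 2\<close> of \<open>turning_angle\<close> at the zero vector makes the inequality hold, and the
  induction go through, even if a partial sum vanishes.\<close>

lemma angle_partial_sum: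
  fixes w :: "nat \<Rightarrow> real^3"
  assumes w: "\<And>i. w i \<noteq> 0"
  shows "turning_angle (w 0) (\<Sum>i\<le>j. w i) + turning_angle (\<Sum>i\<le>j. w i) (w j) \<le> (\<Sum>i<j. turning_angle (w i) (w (Suc i)))"
proof (induction j)
  case 0
  show ?case using w by (simp add: angle_self)
next
  case (Suc j)
  let ?S = "\<Sum>i\<le>j. w i" and ?w = "w (Suc j)" and ?T = "\<Sum>i<j. turning_angle (w i) (w (Suc i))"
  have S: "(\<Sum>i\<le>Suc j. w i) = ?S + ?w" by simp
  consider "?S = 0" | "?S \<noteq> 0" "?S + ?w = 0" | "?S \<noteq> 0" "?S + ?w \<noteq> 0" by blast
  then show ?case
  proof cases
    case 1
    then have "pi \<le> ?T" using Suc.IH by simp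
    then show ?thesis using 1 angle_bounds[of "w 0" ?w] angle_bounds[of "w j" ?w] w
      by (simp add: angle_self)
  next
    case 2
    then have eq: "?w = - ?S" by (simp add: eq_neg_iff_add_eq_0 add.commute)
    have "turning_angle (w j) ?w = pi - turning_angle ?S (w j)"
      unfolding eq angle_minus by (simp add: angle_commute)
    then show ?thesis using 2(2) Suc.IH angle_bounds(1)[of "w 0" ?S] unfolding S by simp
  next
    case 3
    have "turning_angle (w 0) (?S + ?w) \<le> turning_angle (w 0) ?S + turning_angle ?S (?S + ?w)"
      using 3 w by (intro angle_triangle) auto
    moreover have "turning_angle ?S (?S + ?w) + turning_angle (?S + ?w) ?w = turning_angle ?S ?w"
      using 3 w by (intro angle_add) auto
    moreover have "turning_angle ?S ?w \<le> turning_angle ?S (w j) + turning_angle (w j) ?w"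
      using 3 w by (intro angle_triangle) auto
    ultimately show ?thesis using Suc.IH unfolding S by simp
  qed
qed

lemma angle_chain:
  fixes v :: "nat \<Rightarrow> real^3"
  assumes "m \<le> n" "\<And>i. m \<le> i \<Longrightarrow> i \<le> n \<Longrightarrow> v i \<noteq> 0"
  shows "turning_angle (v m) (v n) \<le> (\<Sum>i=m..<n. turning_angle (v i) (v (Suc i)))"
  using assms
proof (induction n rule: dec_induct)
  case base
  then show ?case by (simp add: angle_self)
next
  case (step n)
  have "turning_angle (v m) (v (Suc n)) \<le> turning_angle (v m) (v n) + turning_angle (v n) (v (Suc n))"
    using step by (intro angle_triangle) auto
  then show ?case using step by simp
qed

text \<open>Skipping directions only lowers the rotation, so a coarse selection of edges bounds the
  rotation of a fine polygon from below.\<close>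

lemma angle_chain_blocks:
  fixes v :: "nat \<Rightarrow> real^3"
  assumes "\<And>i. i \<le> m * q \<Longrightarrow> v i \<noteq> 0"
  shows "(\<Sum>i<m. turning_angle (v (i * q)) (v (Suc i * q))) \<le> (\<Sum>j<m * q. turning_angle (v j) (v (Suc j)))"
proof -
  have "(\<Sum>i<m. turning_angle (v (i * q)) (v (Suc i * q))) \<le> (\<Sum>i<m. \<Sum>j=i * q..<i * q + q. turning_angle (v j) (v (Suc j)))"
  proof (rule sum_mono)
    fix i assume i: "i \<in> {..<m}"
    then have "Suc i * q \<le> m * q" by (intro mult_le_mono1) auto
    then show "turning_angle (v (i * q)) (v (Suc i * q)) \<le> (\<Sum>j=i * q..<i * q + q. turning_angle (v j) (v (Suc j)))"
      using angle_chain[of "i * q" "i * q + q" v] assms by (simp add: add.commute)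
  qed
  also have "\<dots> = (\<Sum>j<m * q. turning_angle (v j) (v (Suc j)))"
    by (rule sum.nat_group)
  finally show ?thesis .
qed

lemma angle_tendsto:
  fixes f g :: "'a \<Rightarrow> real^3"
  assumes "(f \<longlongrightarrow> u) F" "(g \<longlongrightarrow> v) F" "u \<noteq> 0" "v \<noteq> 0"
  shows "((\<lambda>x. turning_angle (f x) (g x)) \<longlongrightarrow> turning_angle u v) F"
proof -
  have "((\<lambda>x. f x \<bullet> g x / (norm (f x) * norm (g x))) \<longlongrightarrow> u \<bullet> v / (norm u * norm v)) F"
    using assms by (intro tendsto_intros) auto
  then show ?thesis
    unfolding turning_angle_def
    using continuous_on_tendsto_compose[OF continuous_on_arccos', of _ _ F] Cauchy_Schwarz_quotient by auto
qed

section \<open>Chords and arcs on the unit sphere\<close>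

lemma norm_diff_unit:
  fixes u v :: "real^3"
  assumes "norm u = 1" "norm v = 1"
  shows "norm (u - v) = 2 * sin (turning_angle u v / 2)"
proof -
  let ?T = "turning_angle u v"
  have "u \<bullet> u = 1" "v \<bullet> v = 1" using assms by (simp_all add: norm_eq_1)
  then have "(norm (u - v))\<^sup>2 = 2 - 2 * cos ?T"
    using assms by (simp add: cos_angle power2_norm_eq_inner inner_diff inner_commute)
  also have "\<dots> = (2 * sin (?T / 2))\<^sup>2"
    using cos_double_sin[of "?T / 2"] by (simp add: power2_eq_square)
  finally show ?thesis
    using angle_bounds[of u v] sin_ge_zero[of "?T / 2"] by (intro power2_eq_imp_eq[of "norm (u - v)"]) auto
qed

lemma norm_diff_le_angle:
  fixes u v :: "real^3"
  assumes "norm u = 1" "norm v = 1"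
  shows "norm (u - v) \<le> turning_angle u v"
  using sin_x_le_x[of "turning_angle u v / 2"] angle_bounds[of u v] norm_diff_unit[OF assms] by simp

text \<open>This is \<open>x \<le> tan x\<close> without the quotient; the difference of the two
  sides has derivative \<open>y * sin y\<close>.\<close>

lemma x_cos_x_le_sin_x:
  fixes x :: real
  assumes "0 \<le> x" "x \<le> pi"
  shows "x * cos x \<le> sin x"
proof -
  have "sin 0 - 0 * cos 0 \<le> sin x - x * cos x"
  proof (rule DERIV_nonneg_imp_nondecreasing[OF assms(1)])
    fix y assume "0 \<le> y" "y \<le> x"
    then show "\<exists>d. DERIV (\<lambda>y. sin y - y * cos y) y :> d \<and> 0 \<le> d"
      using assms sin_ge_zero[of y]
      by (intro exI[of _ "y * sin y"]) (auto intro!: derivative_eq_intros)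
  qed
  then show ?thesis by simp
qed

text \<open>With \<open>x\<close> half the angle,
  \<open>cos x \<ge> (cos x)\<^sup>2 = 1 - (sin x)\<^sup>2\<close>, and the smallness bound is
  chosen to make this at least \<open>1 / (1 + \<eta>)\<close>. Then
  \<open>x * cos x \<le> sin x\<close> bounds the arc by the chord.\<close>

lemma angle_le_norm_diff:
  fixes u v :: "real^3"
  assumes "norm u = 1" "norm v = 1" "\<eta> > 0" and small: "(norm (u - v))\<^sup>2 \<le> \<eta> / (1 + \<eta>)"
  shows "turning_angle u v \<le> (1 + \<eta>) * norm (u - v)"
proof -
  define x where "x = turning_angle u v / 2"
  have x: "0 \<le> x" "x \<le> pi / 2" using angle_bounds[of u v] by (auto simp: x_def)
  have n: "norm (u - v) = 2 * sin x" using norm_diff_unit[OF assms(1,2)] by (simp add: x_def)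
  have s0: "0 \<le> sin x" and c0: "0 \<le> cos x" using x by (auto intro!: sin_ge_zero cos_ge_zero)
  have "(sin x)\<^sup>2 \<le> \<eta> / (1 + \<eta>)" using small unfolding n power_mult_distrib by (simp add: power2_eq_square) (use zero_le_square[of "sin x"] in linarith)
  moreover have "(cos x)\<^sup>2 \<le> cos x" unfolding power2_eq_square using c0 by (intro mult_left_le) auto
  ultimately have "1 - \<eta> / (1 + \<eta>) \<le> cos x" using sin_cos_squared_add[of x] by linarith
  moreover have "1 - \<eta> / (1 + \<eta>) = 1 / (1 + \<eta>)" using assms(3) by (simp add: field_simps)
  ultimately have "x * (1 / (1 + \<eta>)) \<le> x * cos x" using x by (intro mult_left_mono) auto
  also have "\<dots> \<le> sin x" using x pi_ge_zero by (intro x_cos_x_le_sin_x) linarith+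
  finally have "x \<le> (1 + \<eta>) * sin x" using assms(3) by (simp add: field_simps)
  then show ?thesis unfolding n by (simp add: x_def)
qed

subsection \<open>Arc-length curves with a given tantrix\<close>

text \<open>A bound at small scale becomes global: \<open>F\<close> is chained from the left end
  through equal pieces shorter than \<delta>, while the increments of \<open>g\<close>
  telescope.\<close>

lemma partition_bound:
  fixes F :: "real \<Rightarrow> real \<Rightarrow> real" and g :: "real \<Rightarrow> real"
  assumes tri: "\<And>x y. a \<le> x \<Longrightarrow> x \<le> y \<Longrightarrow> y \<le> b \<Longrightarrow> F a y \<le> F a x + F x y"
    and "\<delta> > 0" and small: "\<And>x y. a \<le> x \<Longrightarrow> x \<le> y \<Longrightarrow> y \<le> b \<Longrightarrow> y - x < \<delta> \<Longrightarrow> F x y \<le> g y - g x"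
    and "a \<le> b"
  shows "F a b \<le> g b - g a"
proof -
  obtain n where n: "(b - a) / \<delta> < real n" using reals_Archimedean2 by blast
  have n0: "real n > 0" using n assms(2,4) by (smt (verit) divide_nonneg_pos)
  define h where "h = (b - a) / real n"
  have h: "0 \<le> h" "h < \<delta>" using n n0 assms(2,4) by (simp_all add: h_def field_simps)
  have "real k * h \<le> real n * h" if "k \<le> n" for k using that h(1) by (intro mult_right_mono) auto
  then have le: "a + real k * h \<le> b" if "k \<le> n" for k using that n0 by (fastforce simp: h_def)
  have "F a (a + real k * h) \<le> g (a + real k * h) - g a" if "k \<le> n" for k
    using that
  proof (induction k)
    case 0
    show ?case using small[of a a] assms(2,4) by simp
  next
    case (Suc k)
    have ord: "a \<le> a + real k * h" "a + real k * h \<le> a + real (Suc k) * h" using h(1) by (simp_all add: algebra_simps)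
    have "F a (a + real (Suc k) * h) \<le> F a (a + real k * h) + F (a + real k * h) (a + real (Suc k) * h)"
      using ord le[OF Suc.prems] by (intro tri)
    moreover have "F (a + real k * h) (a + real (Suc k) * h) \<le> g (a + real (Suc k) * h) - g (a + real k * h)"
      using ord le[OF Suc.prems] h(2) by (intro small) (simp_all add: algebra_simps)
    ultimately show ?case using Suc by simp
  qed
  from this[of n] show ?thesis using n0 by (simp add: h_def)
qed

locale arc_length_curve =
  fixes L :: real and t c :: "real \<Rightarrow> real^3"
  assumes L_pos: "0 < L" and t_cont: "continuous_on {0..L} t" and t_unit: "norm (t s) = 1"
    and c_deriv: "s \<in> {0..L} \<Longrightarrow> (c has_vector_derivative t s) (at s within {0..L})"
begin

lemma uniformly_continuous_t:
  assumes "\<eta> > 0"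
  shows "\<exists>\<delta>>0. \<forall>x\<in>{0..L}. \<forall>y\<in>{0..L}. \<bar>y - x\<bar> < \<delta> \<longrightarrow> norm (t y - t x) < \<eta>"
  using compact_uniformly_continuous[OF t_cont] assms
  unfolding uniformly_continuous_on_def by (auto simp: dist_norm)

text \<open>Mean value inequality for \<open>c s - s *\<^sub>R v\<close>, whose derivative is
  \<open>t s - v\<close>.\<close>

lemma c_linear_approx_aux:
  assumes ab: "0 \<le> a" "a \<le> b" "b \<le> L" and close: "\<And>s. a \<le> s \<Longrightarrow> s \<le> b \<Longrightarrow> norm (t s - v) \<le> \<eta>"
  shows "norm (c b - c a - (b - a) *\<^sub>R v) \<le> \<eta> * (b - a)"
proof -
  have "norm ((c b - b *\<^sub>R v) - (c a - a *\<^sub>R v)) \<le> \<eta> * norm (b - a)"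
  proof (rule differentiable_bound[where S = "{a..b}" and f' = "\<lambda>s h. h *\<^sub>R (t s - v)"])
    fix s assume s: "s \<in> {a..b}"
    have "(c has_vector_derivative t s) (at s within {a..b})"
      using c_deriv[of s] s ab by (auto intro: has_vector_derivative_within_subset)
    then have "((\<lambda>s. c s - s *\<^sub>R v) has_vector_derivative t s - v) (at s within {a..b})"
      by (auto intro!: derivative_eq_intros)
    then show "((\<lambda>s. c s - s *\<^sub>R v) has_derivative (\<lambda>h. h *\<^sub>R (t s - v))) (at s within {a..b})"
      by (simp add: has_vector_derivative_def)
    have "norm (t s - v) \<le> \<eta>" using s close by simp
    then show "onorm (\<lambda>h. h *\<^sub>R (t s - v)) \<le> \<eta>"
      by (intro onorm_le) (metis abs_ge_zero mult.commute mult_left_mono norm_scaleR real_norm_def)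
  qed (use ab in auto)
  then show ?thesis using ab by (simp add: algebra_simps)
qed

lemma c_linear_approx:
  assumes "\<eta> > 0"
  shows "\<exists>\<delta>>0. \<forall>a b. 0 \<le> a \<longrightarrow> a \<le> b \<longrightarrow> b \<le> L \<longrightarrow> b - a < \<delta> \<longrightarrow>
    norm (c b - c a - (b - a) *\<^sub>R t a) \<le> \<eta> * (b - a)"
proof -
  obtain \<delta> where \<delta>: "\<delta> > 0" "\<And>x y. x \<in> {0..L} \<Longrightarrow> y \<in> {0..L} \<Longrightarrow> \<bar>y - x\<bar> < \<delta> \<Longrightarrow> norm (t y - t x) < \<eta>"
    using uniformly_continuous_t[OF assms] by blast
  show ?thesis
  proof (intro exI[of _ \<delta>] conjI allI impI)
    fix a b assume ab: "0 \<le> a" "a \<le> b" "b \<le> L" "b - a < \<delta>"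
    show "norm (c b - c a - (b - a) *\<^sub>R t a) \<le> \<eta> * (b - a)"
      using ab by (intro c_linear_approx_aux less_imp_le[OF \<delta>(2)]) auto
  qed (fact \<delta>)
qed

lemma dist_c_le:
  assumes "0 \<le> a" "a \<le> b" "b \<le> L"
  shows "dist (c a) (c b) \<le> b - a"
  \<comment> \<open>The comparison vector is \<open>v = 0\<close>, with \<eta> = 1 by unit
    speed.\<close>
  using c_linear_approx_aux[OF assms, of 0 1] t_unit by (simp add: dist_norm norm_minus_commute)

text \<open>Chords are nearly as long as arcs at small scale. Besides the length, this gives local
  injectivity and hence admissible inscribed polygons.\<close>

lemma dist_c_ge:
  assumes "\<eta> > 0"
  shows "\<exists>\<delta>>0. \<forall>a b. 0 \<le> a \<longrightarrow> a \<le> b \<longrightarrow> b \<le> L \<longrightarrow> b - a < \<delta> \<longrightarrow>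
    (1 - \<eta>) * (b - a) \<le> dist (c a) (c b)"
proof -
  obtain \<delta> where \<delta>: "\<delta> > 0" "\<And>a b. 0 \<le> a \<Longrightarrow> a \<le> b \<Longrightarrow> b \<le> L \<Longrightarrow> b - a < \<delta> \<Longrightarrow>
      norm (c b - c a - (b - a) *\<^sub>R t a) \<le> \<eta> * (b - a)"
    using c_linear_approx[OF assms] by blast
  have "(1 - \<eta>) * (b - a) \<le> dist (c a) (c b)" if "0 \<le> a" "a \<le> b" "b \<le> L" "b - a < \<delta>" for a b
  proof -
    have "norm ((b - a) *\<^sub>R t a) \<le> norm (c b - c a) + norm (c b - c a - (b - a) *\<^sub>R t a)"
      using norm_triangle_sub[of "(b - a) *\<^sub>R t a" "c b - c a"] by (simp add: norm_minus_commute)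
    then show ?thesis using \<delta>(2)[OF that] that t_unit by (simp add: dist_norm norm_minus_commute left_diff_distrib)
  qed
  then show ?thesis using \<delta>(1) by blast
qed

definition uniform_polygon :: "real \<Rightarrow> nat \<Rightarrow> (real^3) list" where
  "uniform_polygon s N = map c (map (\<lambda>j. real j * (s / real N)) [0..<Suc N])"

lemma uniform_partition:
  assumes "0 < s" "s \<le> L" "\<eta> > 0"
  shows "eventually (\<lambda>N. uniform_polygon s N \<in> inscribed c 0 s \<and>
    (1 - \<eta>) * s \<le> polygon_length (uniform_polygon s N)) sequentially"
proof -
  \<comment> \<open>\<eta> may be 1 or more, so a second bound with the fixed constant
    \<open>1 / 2\<close> is kept to make consecutive vertices distinct.\<close>
  obtain \<delta>1 where \<delta>1: "\<delta>1 > 0" "\<And>a b. 0 \<le> a \<Longrightarrow> a \<le> b \<Longrightarrow> b \<le> L \<Longrightarrow> b - a < \<delta>1 \<Longrightarrow>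
      (1 - 1 / 2) * (b - a) \<le> dist (c a) (c b)"
    using dist_c_ge[of "1 / 2"] by auto
  obtain \<delta>2 where \<delta>2: "\<delta>2 > 0" "\<And>a b. 0 \<le> a \<Longrightarrow> a \<le> b \<Longrightarrow> b \<le> L \<Longrightarrow> b - a < \<delta>2 \<Longrightarrow>
      (1 - \<eta>) * (b - a) \<le> dist (c a) (c b)"
    using dist_c_ge[OF assms(3)] by blast
  have "eventually (\<lambda>N. s / real N < min \<delta>1 \<delta>2) sequentially"
    by (rule order_tendstoD(2)[OF lim_const_over_n]) (use \<delta>1 \<delta>2 in simp)
  then show ?thesis using eventually_gt_at_top[of 0]
  proof eventually_elim
    fix N :: nat assume N: "s / real N < min \<delta>1 \<delta>2" "0 < N"
    define h where "h = s / real N"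
    define x where "x = (\<lambda>j. real j * h)"
    have h: "0 < h" "h < \<delta>1" "h < \<delta>2" "real N * h = s" using N assms by (auto simp: h_def)
    have x_le: "0 \<le> x j" "x j \<le> s" if "j \<le> N" for j
    proof -
      show "0 \<le> x j" using h by (simp add: x_def)
      have "real j * h \<le> real N * h" using that h(1) by (intro mult_right_mono) auto
      then show "x j \<le> s" using h by (simp add: x_def)
    qed
    have x_Suc: "x (Suc j) - x j = h" for j by (simp add: x_def algebra_simps)
    have len: "(1 - \<eta>) * h \<le> dist (c (x j)) (c (x (Suc j)))" and ne: "c (x j) \<noteq> c (x (Suc j))" if "j < N" for j
    proof -
      have *: "0 \<le> x j" "x j \<le> x (Suc j)" "x (Suc j) \<le> L" using x_le[of j] x_le[of "Suc j"] x_Suc[of j] h(1) that assms(2) by auto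
      show "(1 - \<eta>) * h \<le> dist (c (x j)) (c (x (Suc j)))" using \<delta>2(2)[OF *] h by (simp add: x_Suc)
      show "c (x j) \<noteq> c (x (Suc j))" using \<delta>1(2)[OF *] h by (auto simp: x_Suc)
    qed
    have "sorted_wrt (<) (map x [0..<Suc N])"
      using h(1) by (auto simp: sorted_wrt_iff_nth_less x_def simp del: upt_Suc)
    moreover have "set (map x [0..<Suc N]) \<subseteq> {0..s}" using x_le by auto
    moreover have "distinct_adj (map c (map x [0..<Suc N]))"
      using ne by (auto simp: distinct_adj_conv_nth simp del: upt_Suc)
    ultimately have "map c (map x [0..<Suc N]) \<in> inscribed c 0 s" unfolding inscribed_def by blast
    moreover have "(1 - \<eta>) * s \<le> polygon_length (map c (map x [0..<Suc N]))"
    proof -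
      have "(\<Sum>j<N. (1 - \<eta>) * h) \<le> (\<Sum>j<N. dist (c (x j)) (c (x (Suc j))))"
        by (rule sum_mono) (use len in auto)
      moreover have "(\<Sum>j<N. (1 - \<eta>) * h) = (1 - \<eta>) * (real N * h)" by simp
      ultimately have "(1 - \<eta>) * s \<le> (\<Sum>j<N. dist (c (x j)) (c (x (Suc j))))" unfolding h(4) by linarith
      then show ?thesis by (simp add: polygon_length_def del: upt_Suc)
    qed
    ultimately show "uniform_polygon s N \<in> inscribed c 0 s \<and>
      (1 - \<eta>) * s \<le> polygon_length (uniform_polygon s N)"
      unfolding uniform_polygon_def x_def h_def by blast
  qed
qed

lemma inscribed_nth:
  assumes "xs \<in> inscribed c 0 s"
  obtains x where "\<And>i. i < length xs \<Longrightarrow> xs ! i = c (x i) \<and> 0 \<le> x i \<and> x i \<le> s"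
    "\<And>i. Suc i < length xs \<Longrightarrow> x i < x (Suc i) \<and> c (x i) \<noteq> c (x (Suc i))"
proof -
  obtain ts where ts: "xs = map c ts" "sorted_wrt (<) ts" "set ts \<subseteq> {0..s}" "distinct_adj (map c ts)"
    using assms unfolding inscribed_def by blast
  show thesis
  proof (rule that[of "\<lambda>i. ts ! i"])
    show "xs ! i = c (ts ! i) \<and> 0 \<le> ts ! i \<and> ts ! i \<le> s" if "i < length xs" for i
      using that ts(1) subsetD[OF ts(3) nth_mem[of i ts]] by simp
    show "ts ! i < ts ! Suc i \<and> c (ts ! i) \<noteq> c (ts ! Suc i)" if "Suc i < length xs" for i
      using that ts by (auto simp: sorted_wrt_iff_nth_less distinct_adj_conv_nth)
  qed
qed

lemma curve_length_c:
  assumes s: "0 \<le> s" "s \<le> L"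
  shows "curve_length c 0 s = ereal s"
proof (rule antisym)
  show "curve_length c 0 s \<le> ereal s"
    unfolding curve_length_def
  proof (rule SUP_least)
    fix xs assume "xs \<in> inscribed c 0 s"
    then obtain x where x: "\<And>i. i < length xs \<Longrightarrow> xs ! i = c (x i) \<and> 0 \<le> x i \<and> x i \<le> s"
      "\<And>i. Suc i < length xs \<Longrightarrow> x i < x (Suc i) \<and> c (x i) \<noteq> c (x (Suc i))" by (rule inscribed_nth) blast
    have "polygon_length xs \<le> (\<Sum>i<length xs - 1. x (Suc i) - x i)"
      unfolding polygon_length_def
    proof (rule sum_mono)
      fix i assume "i \<in> {..<length xs - 1}"
      then have i: "Suc i < length xs" "i < length xs" by auto
      show "dist (xs ! i) (xs ! Suc i) \<le> x (Suc i) - x i"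
        using x(1)[OF i(1)] x(1)[OF i(2)] x(2)[OF i(1)] s dist_c_le[of "x i" "x (Suc i)"] by simp
    qed
    also have "\<dots> = x (length xs - 1) - x 0" by (rule sum_lessThan_telescope)
    also have "\<dots> \<le> s"
    \<comment> \<open>For the empty list the truncated subtraction leaves \<open>x 0 - x 0\<close>,
      with \<open>x 0\<close> arbitrary.\<close>
    proof (cases "xs = []")
      case False
      then show ?thesis using x(1)[of 0] x(1)[of "length xs - 1"] by auto
    qed (use s in auto)
    finally show "ereal (polygon_length xs) \<le> ereal s" by simp
  qed
  show "ereal s \<le> curve_length c 0 s"
  proof (cases "s = 0")
    case True
    \<comment> \<open>At \<open>s = 0\<close> there is nothing to subdivide; the empty list supplies
      the lower bound 0.\<close>
    have "[] \<in> inscribed c 0 s" by (auto simp: inscribed_def)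
    then have "ereal (polygon_length []) \<le> curve_length c 0 s" unfolding curve_length_def by (rule SUP_upper)
    then show ?thesis using True by (simp add: polygon_length_def)
  next
    case False
    show ?thesis
    proof (rule ereal_le_epsilon2)
      fix e :: real assume "0 < e"
      with False s have "0 < e / s" by simp
      obtain N where N: "uniform_polygon s N \<in> inscribed c 0 s"
        "(1 - e / s) * s \<le> polygon_length (uniform_polygon s N)"
        using eventually_happens'[OF sequentially_bot uniform_partition[OF _ s(2) \<open>0 < e / s\<close>]] s(1) False by auto
      have "ereal (polygon_length (uniform_polygon s N)) \<le> curve_length c 0 s"
        unfolding curve_length_def by (rule SUP_upper[OF N(1)])
      moreover have "s - e \<le> polygon_length (uniform_polygon s N)"
        using N(2) False by (simp add: left_diff_distrib)
      ultimately have "ereal (s - e) \<le> curve_length c 0 s" by (metis ereal_less_eq(3) order_trans)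
      then have "ereal (s - e) + ereal e \<le> curve_length c 0 s + ereal e" by (rule add_right_mono)
      then show "ereal s \<le> curve_length c 0 s + ereal e" by simp
    qed
  qed
qed

lemma is_arc_length_curve_with_tantrix_c: "is_arc_length_curve_with_tantrix L t c"
  unfolding is_arc_length_curve_with_tantrix_def
proof (intro conjI ballI)
  have "continuous_on {0..L} c" using has_vector_derivative_continuous[OF c_deriv]
    by (simp add: continuous_on_eq_continuous_within)
  then show "rectifiable_curve c 0 L" unfolding rectifiable_curve_def using curve_length_c[of L] L_pos by simp
  show "C1_curve c 0 L" unfolding C1_curve_def using c_deriv t_cont by blast
  show "arc_length_parameterized c 0 L" unfolding arc_length_parameterized_def using curve_length_c by simp
  show "(c has_vector_derivative t s) (at s)" if "s \<in> {0<..<L}" for s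
    using c_deriv[of s] that at_within_interior[of s "{0..L}"] by auto
qed

text \<open>Curves with equal tantrices differ by a constant, so a translation is enough and the
  rotation is the identity.\<close>

lemma arc_length_curve_unique:
  assumes "is_arc_length_curve_with_tantrix L t d"
  shows "\<exists>f. rigid_motion f \<and> (\<forall>s\<in>{0..L}. d s = f (c s))"
proof -
  have d: "continuous_on {0..L} d" "\<And>s. s \<in> {0<..<L} \<Longrightarrow> (d has_vector_derivative t s) (at s)"
    using assms by (auto simp: is_arc_length_curve_with_tantrix_def rectifiable_curve_def)
  have c: "continuous_on {0..L} c" "\<And>s. s \<in> {0<..<L} \<Longrightarrow> (c has_vector_derivative t s) (at s)"
    using is_arc_length_curve_with_tantrix_c
    by (auto simp: is_arc_length_curve_with_tantrix_def rectifiable_curve_def)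
  have const: "d s - c s = d 0 - c 0" if s: "s \<in> {0..L}" for s
  \<comment> \<open>The tantrix is prescribed on the open interval only; the end points form the
    exceptional set, where continuity suffices.\<close>
  proof (rule has_derivative_zero_unique_strong_interval[where k = "{0, L}" and a = 0 and b = L and f = "\<lambda>s. d s - c s"])
    show "((\<lambda>s. d s - c s) has_derivative (\<lambda>h. 0)) (at x within {0..L})" if "x \<in> {0..L} - {0, L}" for x
    proof -
      have "((\<lambda>s. d s - c s) has_vector_derivative t x - t x) (at x)"
        using that by (intro has_vector_derivative_diff d c) auto
      then have "((\<lambda>s. d s - c s) has_derivative (\<lambda>h. 0)) (at x)" by (simp add: has_vector_derivative_def)
      then show ?thesis by (rule has_derivative_at_withinI)
    qed
  qed (use s d(1) c(1) L_pos in \<open>auto intro!: continuous_on_diff\<close>)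
  have "d s = mat 1 *v c s + (d 0 - c 0)" if "s \<in> {0..L}" for s
    unfolding const[OF that, symmetric] by simp
  moreover have "rigid_motion (\<lambda>x. mat 1 *v x + (d 0 - c 0))"
    unfolding rigid_motion_def rotation_matrix_def using orthogonal_matrix_id by (intro exI[of _ "mat 1"]) auto
  ultimately show ?thesis by blast
qed

end

subsection \<open>Total curvature\<close>

text \<open>\<open>stieltjes\<close> is \<open>dt = n d\<Theta>\<close> as a first-order estimate.
  Its error is measured by the increasing function \<open>V\<close>, not by \<open>b - a\<close>,
  because \<Theta> may grow on a set of length 0; errors relative to \<open>V\<close> still
  telescope.\<close>

locale framed_curve = arc_length_curve +
  fixes n :: "real \<Rightarrow> real^3" and \<Theta> V :: "real \<Rightarrow> real"
  assumes n_unit: "norm (n s) = 1"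
    and \<Theta>_mono: "0 \<le> a \<Longrightarrow> a \<le> b \<Longrightarrow> b \<le> L \<Longrightarrow> \<Theta> a \<le> \<Theta> b"
    and V_mono: "a \<le> b \<Longrightarrow> V a \<le> V b"
    and \<Theta>_cont: "continuous_on {0..L} \<Theta>"
    and stieltjes: "\<eta> > 0 \<Longrightarrow> \<exists>\<delta>>0. \<forall>a b. 0 \<le> a \<longrightarrow> a \<le> b \<longrightarrow> b \<le> L \<longrightarrow> b - a < \<delta> \<longrightarrow>
      norm (t b - t a - (\<Theta> b - \<Theta> a) *\<^sub>R n a) \<le> \<eta> * (V b - V a)"
begin

lemma t_nonzero: "t s \<noteq> 0"
  using t_unit[of s] by auto

lemma stieltjes_norm:
  assumes "\<eta> > 0"
  shows "\<exists>\<delta>>0. \<forall>a b. 0 \<le> a \<longrightarrow> a \<le> b \<longrightarrow> b \<le> L \<longrightarrow> b - a < \<delta> \<longrightarrow>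
      \<bar>norm (t b - t a) - (\<Theta> b - \<Theta> a)\<bar> \<le> \<eta> * (V b - V a)"
proof -
  obtain \<delta> where \<delta>: "\<delta> > 0" "\<And>a b. 0 \<le> a \<Longrightarrow> a \<le> b \<Longrightarrow> b \<le> L \<Longrightarrow> b - a < \<delta> \<Longrightarrow>
      norm (t b - t a - (\<Theta> b - \<Theta> a) *\<^sub>R n a) \<le> \<eta> * (V b - V a)"
    using stieltjes[OF assms] by blast
  have "\<bar>norm (t b - t a) - (\<Theta> b - \<Theta> a)\<bar> \<le> \<eta> * (V b - V a)" if ab: "0 \<le> a" "a \<le> b" "b \<le> L" "b - a < \<delta>" for a b
  proof -
    have "norm ((\<Theta> b - \<Theta> a) *\<^sub>R n a) = \<Theta> b - \<Theta> a" using \<Theta>_mono[OF ab(1-3)] n_unit by simp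
    then show ?thesis
      using norm_triangle_ineq3[of "t b - t a" "(\<Theta> b - \<Theta> a) *\<^sub>R n a"] \<delta>(2)[OF ab] by linarith
  qed
  then show ?thesis using \<delta>(1) by blast
qed

text \<open>At small scale the chord of \<open>t\<close> is at most the increment of \<Theta> plus
  \<eta> times that of \<open>V\<close>. Both telescope, and \<eta> is arbitrary.\<close>

lemma norm_t_diff_le:
  assumes ab: "0 \<le> a" "a \<le> b" "b \<le> L"
  shows "norm (t b - t a) \<le> \<Theta> b - \<Theta> a"
proof (rule field_le_epsilon)
  fix e :: real assume "e > 0"
  \<comment> \<open>The summand 1 guards against a vanishing increment of \<open>V\<close>; the same
    device recurs below.\<close>
  define \<eta> where "\<eta> = e / (1 + (V b - V a))"
  have V: "0 \<le> V b - V a" using V_mono[OF ab(2)] by simp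
  then have \<eta>: "\<eta> > 0" "\<eta> * (V b - V a) \<le> e" using \<open>e > 0\<close> by (simp_all add: \<eta>_def field_simps)
  obtain \<delta> where \<delta>: "\<delta> > 0" "\<And>a b. 0 \<le> a \<Longrightarrow> a \<le> b \<Longrightarrow> b \<le> L \<Longrightarrow> b - a < \<delta> \<Longrightarrow>
      \<bar>norm (t b - t a) - (\<Theta> b - \<Theta> a)\<bar> \<le> \<eta> * (V b - V a)"
    using stieltjes_norm[OF \<eta>(1)] by blast
  have "norm (t b - t a) \<le> (\<Theta> b + \<eta> * V b) - (\<Theta> a + \<eta> * V a)"
  proof (rule partition_bound[where F = "\<lambda>x y. norm (t y - t x)" and g = "\<lambda>x. \<Theta> x + \<eta> * V x", OF _ \<delta>(1) _ ab(2)])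
    show "norm (t y - t a) \<le> norm (t x - t a) + norm (t y - t x)" for x y
      using norm_triangle_ineq[of "t x - t a" "t y - t x"] by simp
    show "norm (t y - t x) \<le> (\<Theta> y + \<eta> * V y) - (\<Theta> x + \<eta> * V x)" if "a \<le> x" "x \<le> y" "y \<le> b" "y - x < \<delta>" for x y
      using \<delta>(2)[of x y] that ab by (simp add: right_diff_distrib)
  qed
  then show "norm (t b - t a) \<le> \<Theta> b - \<Theta> a + e" using \<eta>(2) by (simp add: right_diff_distrib)
qed

text \<open>Arc and chord on the sphere agree up to the factor \<open>1 + \<eta>\<close> at small
  scale, so the chord estimate carries over to the angle, which is subadditive.\<close>

lemma angle_t_le:
  assumes ab: "0 \<le> a" "a \<le> b" "b \<le> L"
  shows "turning_angle (t a) (t b) \<le> \<Theta> b - \<Theta> a"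
proof (rule field_le_epsilon)
  fix e :: real assume "e > 0"
  define \<eta> where "\<eta> = e / (1 + (\<Theta> b - \<Theta> a))"
  have "0 \<le> \<Theta> b - \<Theta> a" using \<Theta>_mono[OF ab] by simp
  then have \<eta>: "\<eta> > 0" "\<eta> * (\<Theta> b - \<Theta> a) \<le> e" using \<open>e > 0\<close> by (simp_all add: \<eta>_def field_simps)
  then have "0 < sqrt (\<eta> / (1 + \<eta>))" by simp
  then obtain \<delta> where \<delta>: "\<delta> > 0" "\<And>x y. x \<in> {0..L} \<Longrightarrow> y \<in> {0..L} \<Longrightarrow> \<bar>y - x\<bar> < \<delta> \<Longrightarrow> norm (t y - t x) < sqrt (\<eta> / (1 + \<eta>))"
    using uniformly_continuous_t by blast
  have "turning_angle (t a) (t b) \<le> (1 + \<eta>) * \<Theta> b - (1 + \<eta>) * \<Theta> a"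
  proof (rule partition_bound[where F = "\<lambda>x y. turning_angle (t x) (t y)" and g = "\<lambda>x. (1 + \<eta>) * \<Theta> x", OF _ \<delta>(1) _ ab(2)])
    show "turning_angle (t a) (t y) \<le> turning_angle (t a) (t x) + turning_angle (t x) (t y)" for x y
      by (intro angle_triangle t_nonzero)
    fix x y assume xy: "a \<le> x" "x \<le> y" "y \<le> b" "y - x < \<delta>"
    have "(norm (t y - t x))\<^sup>2 \<le> (sqrt (\<eta> / (1 + \<eta>)))\<^sup>2"
      using xy ab by (intro power_mono less_imp_le[OF \<delta>(2)]) auto
    then have "(norm (t x - t y))\<^sup>2 \<le> \<eta> / (1 + \<eta>)" using \<eta>(1) by (simp add: norm_minus_commute)
    then have "turning_angle (t x) (t y) \<le> (1 + \<eta>) * norm (t x - t y)"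
      by (intro angle_le_norm_diff t_unit \<eta>(1))
    also have "\<dots> \<le> (1 + \<eta>) * (\<Theta> y - \<Theta> x)"
      using norm_t_diff_le[of x y] xy ab \<eta>(1) by (intro mult_left_mono) (auto simp: norm_minus_commute)
    finally show "turning_angle (t x) (t y) \<le> (1 + \<eta>) * \<Theta> y - (1 + \<eta>) * \<Theta> x"
      by (simp add: right_diff_distrib)
  qed
  then show "turning_angle (t a) (t b) \<le> \<Theta> b - \<Theta> a + e" using \<eta>(2) by (simp add: algebra_simps)
qed

section \<open>Upper bound: secants and inscribed polygons\<close>

lemma Riemann_sum_tendsto:
  assumes xy: "0 \<le> x" "x \<le> y" "y \<le> L"
  shows "(\<lambda>N. \<Sum>i<N. ((y - x) / real N) *\<^sub>R t (x + real i * ((y - x) / real N))) \<longlonglongrightarrow> c y - c x"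
proof (rule LIMSEQ_I)
  fix e :: real assume "e > 0"
  define \<eta> where "\<eta> = e / (1 + (y - x))"
  have \<eta>: "\<eta> > 0" "\<eta> * (y - x) < e" using \<open>e > 0\<close> xy by (simp_all add: \<eta>_def field_simps)
  obtain \<delta> where \<delta>: "\<delta> > 0" "\<And>a b. 0 \<le> a \<Longrightarrow> a \<le> b \<Longrightarrow> b \<le> L \<Longrightarrow> b - a < \<delta> \<Longrightarrow>
      norm (c b - c a - (b - a) *\<^sub>R t a) \<le> \<eta> * (b - a)"
    using c_linear_approx[OF \<eta>(1)] by blast
  have "eventually (\<lambda>N. (y - x) / real N < \<delta>) sequentially"
    by (rule order_tendstoD(2)[OF lim_const_over_n]) (use \<delta> in simp)
  then have "eventually (\<lambda>N. 0 < N \<and> (y - x) / real N < \<delta>) sequentially"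
    using eventually_gt_at_top[of 0] by eventually_elim simp
  then obtain N0 where N0: "\<And>N. N0 \<le> N \<Longrightarrow> 0 < N \<and> (y - x) / real N < \<delta>"
    unfolding eventually_sequentially by blast
  have "norm ((\<Sum>i<N. ((y - x) / real N) *\<^sub>R t (x + real i * ((y - x) / real N))) - (c y - c x)) < e" if "N0 \<le> N" for N
  proof -
    define h where "h = (y - x) / real N"
    define p where "p = (\<lambda>i. x + real i * h)"
    have N: "0 < N" "h < \<delta>" using N0[OF that] by (simp_all add: h_def)
    have h: "0 \<le> h" "real N * h = y - x" using N xy by (simp_all add: h_def)
    have p_Suc: "p (Suc i) - p i = h" for i by (simp add: p_def algebra_simps)
    have "p 0 = x" "p N = y" using h by (simp_all add: p_def)
    then have "c y - c x = (\<Sum>i<N. c (p (Suc i)) - c (p i))"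
      by (simp add: sum_lessThan_telescope[of "\<lambda>i. c (p i)"])
    then have "norm ((\<Sum>i<N. h *\<^sub>R t (p i)) - (c y - c x)) = norm (\<Sum>i<N. c (p (Suc i)) - c (p i) - h *\<^sub>R t (p i))"
      by (simp add: sum_subtractf norm_minus_commute)
    also have "\<dots> \<le> (\<Sum>i<N. \<eta> * h)"
    proof (intro order_trans[OF norm_sum] sum_mono)
      fix i assume "i \<in> {..<N}"
      then have "real (Suc i) * h \<le> real N * h" using h by (intro mult_right_mono) auto
      then have "p (Suc i) \<le> y" using h by (simp add: p_def)
      moreover have "0 \<le> p i" using h xy by (simp add: p_def)
      ultimately show "norm (c (p (Suc i)) - c (p i) - h *\<^sub>R t (p i)) \<le> \<eta> * h"
        using \<delta>(2)[of "p i" "p (Suc i)"] p_Suc[of i] h N xy by simp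
    qed
    also have "\<dots> = \<eta> * (real N * h)" by simp
    also have "\<dots> < e" unfolding h(2) by (rule \<eta>(2))
    finally show ?thesis by (simp add: h_def p_def)
  qed
  then show "\<exists>N0. \<forall>N\<ge>N0. norm ((\<Sum>i<N. ((y - x) / real N) *\<^sub>R t (x + real i * ((y - x) / real N))) - (c y - c x)) < e"
    by blast
qed

text \<open>The secant is a limit of sums of tangent vectors. By \<open>angle_partial_sum\<close>
  the angles of such a sum with its first and last summand are together at most the total turning of
  the tangents.\<close>

lemma angle_secant:
  assumes xy: "0 \<le> x" "x < y" "y \<le> L" and ne: "c x \<noteq> c y"
  shows "turning_angle (t x) (c y - c x) + turning_angle (c y - c x) (t y) \<le> \<Theta> y - \<Theta> x"
proof -
  define h where "h = (\<lambda>N. (y - x) / real N)"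
  define p where "p = (\<lambda>N i. x + real i * h N)"
  \<comment> \<open>The sum runs to \<open>N\<close> inclusively so that its last summand points
    along \<open>t y\<close>. Compared with the Riemann sum it has one term more, of norm
    \<open>h N\<close>, which vanishes in the limit.\<close>
  define S where "S = (\<lambda>N. \<Sum>i\<le>N. h N *\<^sub>R t (p N i))"
  have h0: "h \<longlonglongrightarrow> 0" unfolding h_def by (rule lim_const_over_n)
  have "S = (\<lambda>N. (\<Sum>i<N. h N *\<^sub>R t (p N i)) + h N *\<^sub>R t (p N N))"
    by (simp add: S_def fun_eq_iff lessThan_Suc_atMost[symmetric])
  moreover have "(\<lambda>N. h N *\<^sub>R t (p N N)) \<longlonglongrightarrow> 0"
    using h0 by (intro tendsto_norm_zero_cancel[of "\<lambda>N. h N *\<^sub>R t (p N N)"]) (simp add: t_unit tendsto_rabs_zero_iff)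
  ultimately have S: "S \<longlonglongrightarrow> c y - c x"
    using tendsto_add[OF Riemann_sum_tendsto[OF xy(1) less_imp_le[OF xy(2)] xy(3)]] by (fastforce simp: h_def p_def)
  have bound: "turning_angle (t x) (S N) + turning_angle (S N) (t y) \<le> \<Theta> y - \<Theta> x" if "0 < N" for N
  proof -
    have h: "0 < h N" "real N * h N = y - x" using that xy by (simp_all add: h_def)
    have p: "0 \<le> p N i" "p N i \<le> p N (Suc i)" for i using h(1) xy by (simp_all add: p_def algebra_simps)
    have ends: "p N 0 = x" "p N N = y" using h by (simp_all add: p_def)
    have ub: "p N i \<le> y" if "i \<le> N" for i
    proof -
      have "real i * h N \<le> real N * h N" using that h(1) by (intro mult_right_mono) auto
      then show ?thesis using h by (simp add: p_def)
    qed
    have "turning_angle (h N *\<^sub>R t (p N 0)) (S N) + turning_angle (S N) (h N *\<^sub>R t (p N N)) \<le>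
        (\<Sum>i<N. turning_angle (h N *\<^sub>R t (p N i)) (h N *\<^sub>R t (p N (Suc i))))"
      unfolding S_def by (rule angle_partial_sum) (use h t_nonzero in auto)
    also have "\<dots> = (\<Sum>i<N. turning_angle (t (p N i)) (t (p N (Suc i))))"
      using h by (simp add: angle_scale)
    also have "\<dots> \<le> (\<Sum>i<N. \<Theta> (p N (Suc i)) - \<Theta> (p N i))"
    proof (rule sum_mono)
      fix i assume "i \<in> {..<N}"
      then have "p N (Suc i) \<le> L" using ub[of "Suc i"] xy by simp
      then show "turning_angle (t (p N i)) (t (p N (Suc i))) \<le> \<Theta> (p N (Suc i)) - \<Theta> (p N i)"
        by (intro angle_t_le p)
    qed
    also have "\<dots> = \<Theta> y - \<Theta> x" by (subst sum_lessThan_telescope) (simp add: ends)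
    finally show ?thesis using h by (simp add: angle_scale ends)
  qed
  have "(\<lambda>N. turning_angle (t x) (S N) + turning_angle (S N) (t y)) \<longlonglongrightarrow>
      turning_angle (t x) (c y - c x) + turning_angle (c y - c x) (t y)"
    using ne by (intro tendsto_intros angle_tendsto S t_nonzero) auto
  then show ?thesis by (rule LIMSEQ_le_const2) (use bound in \<open>auto intro!: exI[of _ 1]\<close>)
qed

text \<open>At each inner vertex the turning angle is split by the tangent there. Every edge thus
  collects its angles with the tangents at its two ends, which \<open>angle_secant\<close> bounds by
  the increment of \<Theta> over that edge.\<close>

lemma polygon_rotation_le:
  assumes xs: "xs \<in> inscribed c 0 L"
  shows "polygon_rotation xs \<le> \<Theta> L - \<Theta> 0"
proof -
  obtain x where x: "\<And>i. i < length xs \<Longrightarrow> xs ! i = c (x i) \<and> 0 \<le> x i \<and> x i \<le> L"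
    "\<And>i. Suc i < length xs \<Longrightarrow> x i < x (Suc i) \<and> c (x i) \<noteq> c (x (Suc i))"
    using xs by (rule inscribed_nth) blast
  define v where "v = (\<lambda>i. xs ! Suc i - xs ! i)"
  have secant: "turning_angle (t (x k)) (v k) + turning_angle (v k) (t (x (Suc k))) \<le> \<Theta> (x (Suc k)) - \<Theta> (x k)"
    and v0: "v k \<noteq> 0" if "Suc k < length xs" for k
    using angle_secant[of "x k" "x (Suc k)"] x(1)[of k] x(1)[of "Suc k"] x(2)[of k] that
    by (auto simp: v_def)
  \<comment> \<open>The induction carries along the angle between the last edge and the tangent at
    its end, which becomes the first part of the next split.\<close>
  have main: "(\<Sum>i<k. turning_angle (v i) (v (Suc i))) + turning_angle (v k) (t (x (Suc k))) \<le> \<Theta> (x (Suc k)) - \<Theta> (x 0)"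
    if "Suc k < length xs" for k
    using that
  proof (induction k)
    case 0
    then show ?case using secant[of 0] angle_bounds(1)[of "t (x 0)" "v 0"] by simp
  next
    case (Suc k)
    have "turning_angle (v k) (v (Suc k)) \<le> turning_angle (v k) (t (x (Suc k))) + turning_angle (t (x (Suc k))) (v (Suc k))"
      using Suc.prems by (intro angle_triangle v0 t_nonzero) auto
    then show ?case using Suc secant[of "Suc k"] by simp
  qed
  show ?thesis
  proof (cases "length xs < 2")
    case True
    then show ?thesis using \<Theta>_mono[of 0 L] L_pos by (simp add: polygon_rotation_def)
  next
    case False
    then obtain k where k: "length xs = Suc (Suc k)" by (metis Suc_1 add_Suc less_eqE not_less plus_1_eq_Suc)
    have "polygon_rotation xs = (\<Sum>i<k. turning_angle (v i) (v (Suc i)))"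
      by (simp add: polygon_rotation_def v_def k)
    also have "\<dots> \<le> \<Theta> (x (Suc k)) - \<Theta> (x 0)"
      using main[of k] angle_bounds(1)[of "v k" "t (x (Suc k))"] k by simp
    also have "\<dots> \<le> \<Theta> L - \<Theta> 0"
      using \<Theta>_mono[of "x (Suc k)" L] \<Theta>_mono[of 0 "x 0"] x(1)[of 0] x(1)[of "Suc k"] k by simp
    finally show ?thesis .
  qed
qed

section \<open>Lower bound: fine uniform polygons\<close>

lemma secant_direction_tendsto:
  assumes s: "0 \<le> s" "s < L" and h: "h \<longlonglongrightarrow> 0" "\<And>q. 0 < h q"
  shows "(\<lambda>q. (1 / h q) *\<^sub>R (c (s + h q) - c s)) \<longlonglongrightarrow> t s"
proof (rule tendstoI)
  fix e :: real assume "e > 0"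
  then have "e / 2 > 0" by simp
  then obtain \<delta> where \<delta>: "\<delta> > 0" "\<And>a b. 0 \<le> a \<Longrightarrow> a \<le> b \<Longrightarrow> b \<le> L \<Longrightarrow> b - a < \<delta> \<Longrightarrow>
      norm (c b - c a - (b - a) *\<^sub>R t a) \<le> e / 2 * (b - a)"
    using c_linear_approx by blast
  have "eventually (\<lambda>q. h q < min \<delta> (L - s)) sequentially"
    using order_tendstoD(2)[OF h(1), of "min \<delta> (L - s)"] \<delta>(1) s by simp
  then show "eventually (\<lambda>q. dist ((1 / h q) *\<^sub>R (c (s + h q) - c s)) (t s) < e) sequentially"
  proof eventually_elim
    fix q assume q: "h q < min \<delta> (L - s)"
    have "norm (c (s + h q) - c s - h q *\<^sub>R t s) \<le> e / 2 * h q"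
      using \<delta>(2)[of s "s + h q"] q s h(2)[of q] by simp
    then have "(1 / h q) * norm (c (s + h q) - c s - h q *\<^sub>R t s) \<le> e / 2"
      using h(2)[of q] by (simp add: field_simps)
    moreover have "(1 / h q) *\<^sub>R (c (s + h q) - c s) - t s = (1 / h q) *\<^sub>R (c (s + h q) - c s - h q *\<^sub>R t s)"
      using h(2)[of q] by (simp add: scaleR_diff_right)
    moreover have "norm ((1 / h q) *\<^sub>R (c (s + h q) - c s - h q *\<^sub>R t s)) =
        (1 / h q) * norm (c (s + h q) - c s - h q *\<^sub>R t s)"
      using h(2)[of q] by simp
    ultimately have "norm ((1 / h q) *\<^sub>R (c (s + h q) - c s) - t s) \<le> e / 2" by (simp only:)
    then show "dist ((1 / h q) *\<^sub>R (c (s + h q) - c s)) (t s) < e"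
      using \<open>e > 0\<close> unfolding dist_norm by linarith
  qed
qed

text \<open>\<open>w i\<close> is the edge of the fine polygon that starts at the coarse node
  \<open>i * (L / m)\<close>, that is, every \<open>q\<close>-th edge; the edges in between can only
  add rotation.\<close>

lemma polygon_rotation_uniform:
  assumes "0 < m" "0 < q"
    and ins: "uniform_polygon L (m * q) \<in> inscribed c 0 L" (is "?xs \<in> _")
  defines "w \<equiv> \<lambda>i. c (real i * (L / real m) + L / real (m * q)) - c (real i * (L / real m))"
  shows "(\<Sum>i<m - 1. turning_angle (w i) (w (Suc i))) \<le> polygon_rotation ?xs"
proof -
  define N where "N = m * q"
  define v where "v = (\<lambda>j. ?xs ! Suc j - ?xs ! j)"
  have N0: "0 < N" using assms by (simp add: N_def)
  have len: "length ?xs = Suc N" by (simp add: N_def uniform_polygon_def)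
  have nth: "?xs ! j = c (real j * (L / real N))" if "j \<le> N" for j
    using that by (simp add: N_def uniform_polygon_def nth_append del: upt_Suc)
  have "distinct_adj ?xs" using ins by (auto simp: inscribed_def)
  then have v_ne: "v j \<noteq> 0" if "j < N" for j
    using that len by (auto simp: distinct_adj_conv_nth v_def simp del: upt_Suc)
  have le: "(m - 1) * q \<le> N - 1" using assms by (cases m) (auto simp: N_def)
  have v_eq: "v (i * q) = w i" if "i < m" for i
  proof -
    have "Suc i * q \<le> N" unfolding N_def using that by (intro mult_le_mono1) auto
    then have "i * q < N" using assms by simp
    moreover have "real (i * q) * (L / real N) = real i * (L / real m)"
      using assms by (simp add: N_def)
    moreover have "real (Suc (i * q)) * (L / real N) = real i * (L / real m) + L / real (m * q)"
      using assms by (simp add: N_def field_simps)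
    ultimately show ?thesis using nth[of "i * q"] nth[of "Suc (i * q)"] unfolding v_def w_def by (metis Suc_leI less_imp_le)
  qed
  have "(\<Sum>i<m - 1. turning_angle (w i) (w (Suc i))) =
      (\<Sum>i<m - 1. turning_angle (v (i * q)) (v (Suc i * q)))"
  proof (rule sum.cong[OF refl])
    fix i assume "i \<in> {..<m - 1}"
    then have "i < m" "Suc i < m" by auto
    then show "turning_angle (w i) (w (Suc i)) =
      turning_angle (v (i * q)) (v (Suc i * q))" by (simp only: v_eq)
  qed
  also have "\<dots> \<le> (\<Sum>j<(m - 1) * q. turning_angle (v j) (v (Suc j)))"
    using v_ne le N0 by (intro angle_chain_blocks) auto
  also have "\<dots> \<le> (\<Sum>j<N - 1. turning_angle (v j) (v (Suc j)))"
    using le by (intro sum_mono2) (auto simp: angle_bounds)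
  also have "\<dots> = polygon_rotation ?xs"
    unfolding polygon_rotation_def len v_def by simp
  finally show ?thesis .
qed

text \<open>Two scales are used: \<open>m\<close> coarse pieces on which the angles of
  \<open>t\<close> nearly add up to the increment of \<Theta>, and then, with \<open>m\<close>
  fixed, refinements whose edges at the coarse nodes align with the tangents.\<close>

lemma ex_polygon_rotation:
  assumes "e > 0"
  shows "\<exists>xs\<in>inscribed c 0 L. \<Theta> L - \<Theta> 0 - e \<le> polygon_rotation xs"
proof -
  \<comment> \<open>One third of \<open>e\<close> pays for the error in \<open>V\<close>, another
    for the last coarse interval.\<close>
  define \<eta> where "\<eta> = e / (3 * (1 + (V L - V 0)))"
  have "0 \<le> V L - V 0" using V_mono[of 0 L] L_pos by simp
  then have \<eta>: "\<eta> > 0" "\<eta> * (V L - V 0) \<le> e / 3" using assms by (simp_all add: \<eta>_def field_simps)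
  obtain \<delta> where \<delta>: "\<delta> > 0" "\<And>a b. 0 \<le> a \<Longrightarrow> a \<le> b \<Longrightarrow> b \<le> L \<Longrightarrow> b - a < \<delta> \<Longrightarrow>
      \<bar>norm (t b - t a) - (\<Theta> b - \<Theta> a)\<bar> \<le> \<eta> * (V b - V a)"
    using stieltjes_norm[OF \<eta>(1)] by blast
  have in_ivl: "L - L / real m \<in> {0..L}" if "0 < m" for m :: nat
    using that L_pos by (simp add: field_simps)
  \<comment> \<open>No edge starts at \<open>L\<close>, so tangents are compared only up to the node
    \<open>L - L / m\<close>; continuity of \<Theta> at \<open>L\<close> makes the rest
    small.\<close>
  have "(\<lambda>m. \<Theta> (L - L / real m)) \<longlonglongrightarrow> \<Theta> L"
  proof (rule continuous_on_tendsto_compose[OF \<Theta>_cont])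
    show "(\<lambda>m. L - L / real m) \<longlonglongrightarrow> L"
      using tendsto_diff[OF tendsto_const lim_const_over_n, of L L] by simp
    show "eventually (\<lambda>m. L - L / real m \<in> {0..L}) sequentially"
      using eventually_gt_at_top[of 0] by eventually_elim (rule in_ivl)
  qed (use L_pos in simp)
  then have "eventually (\<lambda>m. \<Theta> L - e / 3 < \<Theta> (L - L / real m)) sequentially"
    by (rule order_tendstoD) (use assms in simp)
  moreover have "eventually (\<lambda>m. L / real m < \<delta>) sequentially"
    by (rule order_tendstoD(2)[OF lim_const_over_n]) (use \<delta> in simp)
  ultimately have "eventually (\<lambda>m. \<Theta> L - e / 3 < \<Theta> (L - L / real m) \<and> L / real m < \<delta> \<and> 0 < m) sequentially"
    using eventually_gt_at_top[of 0] by eventually_elim auto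
  then obtain m where m: "\<Theta> L - e / 3 < \<Theta> (L - L / real m)" "L / real m < \<delta>" "0 < m"
    using eventually_happens'[OF sequentially_bot] by blast
  define s where "s = (\<lambda>i. real i * (L / real m))"
  have s_Suc: "s (Suc i) = s i + L / real m" for i by (simp add: s_def distrib_right add_divide_distrib)
  have s_last: "s (m - 1) = L - L / real m" using m(3) by (cases m) (simp_all add: s_def field_simps)
  have s0: "s 0 = 0" by (simp add: s_def)
  have s_bounds: "0 \<le> s i" "s i < L" if "i < m" for i
    using that L_pos by (simp_all add: s_def field_simps)
  have "\<Theta> (s (m - 1)) - \<Theta> 0 - \<eta> * (V (s (m - 1)) - V 0) =
      (\<Sum>i<m - 1. (\<Theta> (s (Suc i)) - \<eta> * V (s (Suc i))) - (\<Theta> (s i) - \<eta> * V (s i)))"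
    by (subst sum_lessThan_telescope) (simp add: s0 right_diff_distrib)
  also have "\<dots> \<le> (\<Sum>i<m - 1. turning_angle (t (s i)) (t (s (Suc i))))"
  proof (rule sum_mono)
    fix i assume "i \<in> {..<m - 1}"
    then have i: "i < m" "Suc i < m" by auto
    have "\<bar>norm (t (s (Suc i)) - t (s i)) - (\<Theta> (s (Suc i)) - \<Theta> (s i))\<bar> \<le> \<eta> * (V (s (Suc i)) - V (s i))"
      using s_bounds[OF i(1)] s_bounds[OF i(2)] m(2) L_pos by (intro \<delta>(2)) (simp_all add: s_Suc)
    moreover have "norm (t (s (Suc i)) - t (s i)) \<le> turning_angle (t (s i)) (t (s (Suc i)))"
      by (subst norm_minus_commute) (rule norm_diff_le_angle[OF t_unit t_unit])
    ultimately show "(\<Theta> (s (Suc i)) - \<eta> * V (s (Suc i))) - (\<Theta> (s i) - \<eta> * V (s i)) \<le> turning_angle (t (s i)) (t (s (Suc i)))"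
      by (simp add: right_diff_distrib)
  qed
  finally have A: "\<Theta> L - \<Theta> 0 - 2 * e / 3 < (\<Sum>i<m - 1. turning_angle (t (s i)) (t (s (Suc i))))"
  proof -
    assume *: "\<Theta> (s (m - 1)) - \<Theta> 0 - \<eta> * (V (s (m - 1)) - V 0) \<le> (\<Sum>i<m - 1. turning_angle (t (s i)) (t (s (Suc i))))"
    have "V (s (m - 1)) \<le> V L" using s_bounds[of "m - 1"] m(3) by (intro V_mono) auto
    then have "\<eta> * (V (s (m - 1)) - V 0) \<le> \<eta> * (V L - V 0)" using \<eta>(1) by simp
    then show ?thesis using * \<eta>(2) m(1) unfolding s_last by linarith
  qed
  define h where "h = (\<lambda>q. L / real (m * q))"
  define w where "w = (\<lambda>q i. c (s i + h (Suc q)) - c (s i))"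
  have h_pos: "0 < h (Suc q)" for q using L_pos m(3) by (simp add: h_def)
  have mq: "filterlim (\<lambda>q. m * Suc q) at_top sequentially"
    by (rule filterlim_compose[OF mult_nat_left_at_top[OF m(3)] filterlim_Suc])
  have h_lim: "(\<lambda>q. h (Suc q)) \<longlonglongrightarrow> 0"
    unfolding h_def by (rule filterlim_compose[OF lim_const_over_n mq])
  have dir: "(\<lambda>q. (1 / h (Suc q)) *\<^sub>R w q i) \<longlonglongrightarrow> t (s i)" if "i < m" for i
    unfolding w_def by (rule secant_direction_tendsto[OF s_bounds[OF that] h_lim h_pos])
  have scale: "turning_angle ((1 / h (Suc q)) *\<^sub>R u) ((1 / h (Suc q)) *\<^sub>R u') = turning_angle u u'" for q u u'
    using h_pos[of q] by (simp add: angle_scale)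
  have "(\<lambda>q. \<Sum>i<m - 1. turning_angle ((1 / h (Suc q)) *\<^sub>R w q i) ((1 / h (Suc q)) *\<^sub>R w q (Suc i)))
      \<longlonglongrightarrow> (\<Sum>i<m - 1. turning_angle (t (s i)) (t (s (Suc i))))"
    by (intro tendsto_sum angle_tendsto dir t_nonzero) auto
  then have "(\<lambda>q. \<Sum>i<m - 1. turning_angle (w q i) (w q (Suc i)))
      \<longlonglongrightarrow> (\<Sum>i<m - 1. turning_angle (t (s i)) (t (s (Suc i))))"
    unfolding scale .
  from order_tendstoD(1)[OF this A]
  have "eventually (\<lambda>q. \<Theta> L - \<Theta> 0 - 2 * e / 3 < (\<Sum>i<m - 1. turning_angle (w q i) (w q (Suc i)))) sequentially" .
  moreover have "eventually (\<lambda>q. uniform_polygon L (m * Suc q) \<in> inscribed c 0 L) sequentially"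
    using eventually_compose_filterlim[OF uniform_partition[OF L_pos order_refl zero_less_one] mq]
    by eventually_elim blast
  ultimately have "eventually (\<lambda>q. \<exists>xs\<in>inscribed c 0 L. \<Theta> L - \<Theta> 0 - e \<le> polygon_rotation xs) sequentially"
  proof eventually_elim
    fix q assume q: "\<Theta> L - \<Theta> 0 - 2 * e / 3 < (\<Sum>i<m - 1. turning_angle (w q i) (w q (Suc i)))"
      and ins: "uniform_polygon L (m * Suc q) \<in> inscribed c 0 L"
    have "(\<Sum>i<m - 1. turning_angle (w q i) (w q (Suc i))) \<le>
        polygon_rotation (uniform_polygon L (m * Suc q))"
      unfolding w_def h_def s_def by (rule polygon_rotation_uniform[OF m(3) zero_less_Suc ins])
    then show "\<exists>xs\<in>inscribed c 0 L. \<Theta> L - \<Theta> 0 - e \<le> polygon_rotation xs"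
      using q assms by (intro bexI[OF _ ins]) linarith
  qed
  then show ?thesis using eventually_happens'[OF sequentially_bot] by blast
qed

lemma total_curvature_c: "total_curvature c 0 L = ereal (\<Theta> L - \<Theta> 0)"
proof (rule antisym)
  show "total_curvature c 0 L \<le> ereal (\<Theta> L - \<Theta> 0)"
    unfolding total_curvature_def by (rule SUP_least) (simp only: ereal_less_eq polygon_rotation_le)
  show "ereal (\<Theta> L - \<Theta> 0) \<le> total_curvature c 0 L"
  proof (rule ereal_le_epsilon2)
    fix e :: real assume "0 < e"
    then obtain xs where xs: "xs \<in> inscribed c 0 L" "\<Theta> L - \<Theta> 0 - e \<le> polygon_rotation xs"
      using ex_polygon_rotation by blast
    have "ereal (polygon_rotation xs) \<le> total_curvature c 0 L"
      unfolding total_curvature_def by (rule SUP_upper[OF xs(1)])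
    then have "ereal (\<Theta> L - \<Theta> 0 - e) \<le> total_curvature c 0 L"
      using xs(2) by (metis ereal_less_eq(3) order_trans)
    then have "ereal (\<Theta> L - \<Theta> 0 - e) + ereal e \<le> total_curvature c 0 L + ereal e" by (rule add_right_mono)
    then show "ereal (\<Theta> L - \<Theta> 0) \<le> total_curvature c 0 L + ereal e" by simp
  qed
qed

end

subsection \<open>The curve of the frame\<close>

context frame_data
begin

text \<open>The continuous extension of \<theta> to the whole line, which gives meaning to its
  values at 0 and \<open>L\<close>.\<close>

definition \<Theta> :: "real \<Rightarrow> real" where
  "\<Theta> s = (SOME c. \<forall>s\<in>{0<..<L}. \<theta> s = c + prim f s) + prim f s"

text \<open>The distribution function of the total variation of \<open>D\<theta>\<close>.\<close>

definition V :: "real \<Rightarrow> real" where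
  "V = prim (\<lambda>r. \<bar>f r\<bar>)"

lemma \<theta>_eq_\<Theta>: "s \<in> {0<..<L} \<Longrightarrow> \<theta> s = \<Theta> s"
  using someI_ex[OF continuous_BV_on_imp_prim[OF \<theta> f]] unfolding \<Theta>_def by blast

lemma integrable_f: "integrable M f"
  using f by (simp add: is_density_def)

lemma isCont_\<Theta>: "isCont \<Theta> s"
  unfolding \<Theta>_def by (intro continuous_intros isCont_prim integrable_f)

lemma \<Theta>_tendsto: "(\<Theta> \<longlongrightarrow> \<Theta> s) (at s within S)"
  using isCont_\<Theta>[of s] by (simp add: continuous_at tendsto_within_subset[OF _ subset_UNIV])

lemma Lim_\<theta>: "Lim (at_left L) \<theta> = \<Theta> L" "Lim (at_right 0) \<theta> = \<Theta> 0"
proof -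
  have "eventually (\<lambda>s. \<Theta> s = \<theta> s) (at_left L)"
    using eventually_at_left_real[OF L_pos] by eventually_elim (simp add: \<theta>_eq_\<Theta>)
  from tendsto_cong[OF this] have "(\<theta> \<longlongrightarrow> \<Theta> L) (at_left L)" using \<Theta>_tendsto by blast
  then show "Lim (at_left L) \<theta> = \<Theta> L" by (intro tendsto_Lim) auto
  have "eventually (\<lambda>s. \<Theta> s = \<theta> s) (at_right 0)"
    using eventually_at_right_real[OF L_pos] by eventually_elim (simp add: \<theta>_eq_\<Theta>)
  from tendsto_cong[OF this] have "(\<theta> \<longlongrightarrow> \<Theta> 0) (at_right 0)" using \<Theta>_tendsto by blast
  then show "Lim (at_right 0) \<theta> = \<Theta> 0" by (intro tendsto_Lim) auto
qed

lemma D_measure_\<theta>: "D_measure {0<..<L} \<theta> {0<..<L} = \<Theta> L - \<Theta> 0"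
  using D_measure_is_density[OF f, of "{0<..<L}"] prim_diff_Ioo[OF integrable_f, of 0 L] L_pos by (simp add: \<Theta>_def)

lemma \<Theta>_mono:
  assumes mono: "strict_mono_on {0<..<L} \<theta>" and ab: "0 \<le> a" "a \<le> b" "b \<le> L"
  shows "\<Theta> a \<le> \<Theta> b"
proof (cases "a = b")
  case False
  then have ab': "0 \<le> a" "a < b" "b \<le> L" using ab by auto
  \<comment> \<open>The 3 keeps \<open>a + d n\<close> to the left of \<open>b - d n\<close> for
    every \<open>n\<close>, both strictly inside the interval, where \<theta> is known to
    increase.\<close>
  define d where "d = (\<lambda>n. (b - a) / real (n + 3))"
  have d: "d \<longlonglongrightarrow> 0"
    unfolding d_def by (rule LIMSEQ_ignore_initial_segment[OF lim_const_over_n])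
  have iscont: "(\<lambda>n. \<Theta> (x n)) \<longlonglongrightarrow> \<Theta> y" if "x \<longlonglongrightarrow> y" for x y
    by (rule isCont_tendsto_compose[OF isCont_\<Theta> that])
  have "\<Theta> (a + d n) \<le> \<Theta> (b - d n)" for n
  proof -
    have "0 < d n" "3 * d n \<le> b - a" using ab' by (simp_all add: d_def field_simps mult_right_mono)
    then have "a + d n \<in> {0<..<L}" "b - d n \<in> {0<..<L}" "a + d n < b - d n" using ab' by auto
    then show ?thesis using mono by (simp add: \<theta>_eq_\<Theta>[symmetric] strict_mono_on_def less_imp_le del: greaterThanLessThan_iff)
  qed
  moreover have "(\<lambda>n. \<Theta> (a + d n)) \<longlonglongrightarrow> \<Theta> a" "(\<lambda>n. \<Theta> (b - d n)) \<longlonglongrightarrow> \<Theta> b"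
    using tendsto_add[OF tendsto_const d, of a] tendsto_diff[OF tendsto_const d, of b]
    by (auto intro!: iscont)
  ultimately show ?thesis by (intro LIMSEQ_le[of "\<lambda>n. \<Theta> (a + d n)"]) auto
qed simp

lemma norm_frame_axis: "norm (frame s *v axis j 1) = 1"
  using orthogonal_frame[of s] by (simp add: matrix_vector_mult_basis orthogonal_matrix_orthonormal_columns)

lemma continuous_on_frame_axis: "continuous_on S (\<lambda>s. frame s *v axis j 1)"
  unfolding matrix_vector_mult_basis column_def by (intro continuous_on_vec_lambda continuous_on_frame_nth)

text \<open>Columns 1 and 2 of the frame are \<open>t\<close> and \<open>n\<close>. From
  \<open>dt = n f dM\<close> and \<open>d\<Theta> = f dM\<close> the difference is the integral of
  \<open>(n r - n a) * f r\<close>, at most the oscillation of \<open>n\<close> times the variation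
  of \<theta>.\<close>

lemma frame_nth_stieltjes:
  assumes ab: "0 \<le> a" "a \<le> b" "b \<le> L"
    and close: "\<And>r. a \<le> r \<Longrightarrow> r \<le> b \<Longrightarrow> \<bar>frame r $ i $ 2 - frame a $ i $ 2\<bar> \<le> \<eta>"
  shows "\<bar>frame b $ i $ 1 - frame a $ i $ 1 - (\<Theta> b - \<Theta> a) * frame a $ i $ 2\<bar> \<le>
    \<eta> * (V b - V a)"
proof -
  let ?d = "\<lambda>r. dframe i 1 r - frame a $ i $ 2 * f r"
  have int: "integrable M ?d" "integrable M (\<lambda>r. \<bar>f r\<bar>)"
    using frame_eq_prim(1) integrable_f by simp_all
  have "frame b $ i $ 1 - frame a $ i $ 1 - (\<Theta> b - \<Theta> a) * frame a $ i $ 2 = prim ?d b - prim ?d a"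
    using frame_eq_prim(1) integrable_f
    by (simp add: frame_eq_prim(2)[of b] frame_eq_prim(2)[of a i 1] \<Theta>_def prim_diff prim_cmult) (simp add: algebra_simps)
  also have "\<dots> = (LINT r:{a<..b}|M. ?d r)" by (rule prim_diff_eq[OF int(1) ab(2)])
  finally have "\<bar>frame b $ i $ 1 - frame a $ i $ 1 - (\<Theta> b - \<Theta> a) * frame a $ i $ 2\<bar> =
    \<bar>LINT r:{a<..b}|M. ?d r\<bar>" by simp
  also have "\<dots> \<le> (LINT r:{a<..b}|M. \<bar>?d r\<bar>)"
    using set_integral_norm_bound[OF set_integrable_borel[OF int(1), of "{a<..b}"]] by simp
  also have "\<dots> \<le> (LINT r:{a<..b}|M. \<eta> * \<bar>f r\<bar>)"
  proof (rule set_integral_mono)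
    show "set_integrable M {a<..b} (\<lambda>r. \<bar>?d r\<bar>)" "set_integrable M {a<..b} (\<lambda>r. \<eta> * \<bar>f r\<bar>)"
      using int by (intro set_integrable_borel; simp)+
    fix r assume "r \<in> {a<..b}"
    then have "\<bar>frame r $ i $ 2 - frame a $ i $ 2\<bar> * \<bar>f r\<bar> \<le> \<eta> * \<bar>f r\<bar>"
      using close[of r] by (intro mult_right_mono) auto
    then show "\<bar>?d r\<bar> \<le> \<eta> * \<bar>f r\<bar>"
      by (simp add: dframe_simps abs_mult[symmetric] algebra_simps)
  qed
  also have "\<dots> = \<eta> * (V b - V a)"
    using prim_diff_eq[OF int(2) ab(2)] by (simp add: V_def)
  finally show ?thesis .
qed

lemma frame_stieltjes:
  assumes "\<eta> > 0"
  shows "\<exists>\<delta>>0. \<forall>a b. 0 \<le> a \<longrightarrow> a \<le> b \<longrightarrow> b \<le> L \<longrightarrow> b - a < \<delta> \<longrightarrow>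
    norm (frame b *v axis 1 1 - frame a *v axis 1 1 - (\<Theta> b - \<Theta> a) *\<^sub>R (frame a *v axis 2 1)) \<le>
      \<eta> * (V b - V a)"
proof -
  have "uniformly_continuous_on {0..L} (\<lambda>s. frame s *v axis 2 1)"
    by (rule compact_uniformly_continuous[OF continuous_on_frame_axis]) simp
  \<comment> \<open>The norm is bounded by the sum over three coordinates, each of which is allowed
    a third.\<close>
  moreover have "\<eta> / 3 > 0" using assms by simp
  ultimately obtain \<delta> where \<delta>: "\<delta> > 0" "\<And>x y. x \<in> {0..L} \<Longrightarrow> y \<in> {0..L} \<Longrightarrow> dist y x < \<delta> \<Longrightarrow>
      dist (frame y *v axis 2 1) (frame x *v axis 2 1) < \<eta> / 3"
    unfolding uniformly_continuous_on_def by metis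
  have comp: "(frame s *v axis j 1) $ i = frame s $ i $ j" for s i j
    by (simp add: matrix_vector_mult_basis column_def)
  show ?thesis
  proof (intro exI[of _ \<delta>] conjI allI impI)
    fix a b assume ab: "0 \<le> a" "a \<le> b" "b \<le> L" "b - a < \<delta>"
    let ?u = "frame b *v axis 1 1 - frame a *v axis 1 1 - (\<Theta> b - \<Theta> a) *\<^sub>R (frame a *v axis 2 1)"
    have "\<bar>?u $ i\<bar> \<le> \<eta> / 3 * (V b - V a)" for i
    proof -
      have "\<bar>frame r $ i $ 2 - frame a $ i $ 2\<bar> \<le> \<eta> / 3" if "a \<le> r" "r \<le> b" for r
        using component_le_norm_cart[of "frame r *v axis 2 1 - frame a *v axis 2 1" i] \<delta>(2)[of a r] that ab
        by (simp add: comp dist_norm)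
      from frame_nth_stieltjes[OF ab(1-3) this] show ?thesis by (simp add: comp)
    qed
    then have "(\<Sum>i\<in>UNIV. \<bar>?u $ i\<bar>) \<le> (\<Sum>i\<in>(UNIV :: 3 set). \<eta> / 3 * (V b - V a))"
      by (intro sum_mono)
    then show "norm ?u \<le> \<eta> * (V b - V a)"
      using norm_le_l1_cart[of ?u] by simp
  qed (fact \<delta>)
qed

lemma curve_with_total_curvature:
  assumes mono: "strict_mono_on {0<..<L} \<theta>"
  defines "t \<equiv> \<lambda>s. frame s *v axis 1 1"
  shows "\<exists>c. is_arc_length_curve_with_tantrix L t c \<and>
    (\<forall>d. is_arc_length_curve_with_tantrix L t d \<longrightarrow> (\<exists>f. rigid_motion f \<and> (\<forall>s\<in>{0..L}. d s = f (c s)))) \<and>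
    total_curvature c 0 L = ereal (D_measure {0<..<L} \<theta> {0<..<L})"
proof -
  \<comment> \<open>The frame is continuous up to the end points, so this integral is C^1 on the
    closed interval.\<close>
  define c where "c = (\<lambda>s. integral {0..s} t)"
  have cont: "continuous_on {0..L} t" unfolding t_def by (rule continuous_on_frame_axis)
  interpret framed_curve L t c "\<lambda>s. frame s *v axis 2 1" \<Theta> V
  proof
    show "0 < L" by (rule L_pos)
    show "continuous_on {0..L} t" by (rule cont)
    show "norm (t s) = 1" "norm (frame s *v axis 2 1) = 1" for s
      unfolding t_def by (rule norm_frame_axis)+
    show "(c has_vector_derivative t s) (at s within {0..L})" if "s \<in> {0..L}" for s
      unfolding c_def using integral_has_vector_derivative[OF cont that] .
    show "\<Theta> a \<le> \<Theta> b" if "0 \<le> a" "a \<le> b" "b \<le> L" for a b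
      using mono that by (rule \<Theta>_mono)
    show "V a \<le> V b" if "a \<le> b" for a b
      unfolding V_def using that integrable_f by (intro prim_increasing) auto
    show "continuous_on {0..L} \<Theta>"
      using isCont_\<Theta> by (intro continuous_at_imp_continuous_on) auto
    show "\<exists>\<delta>>0. \<forall>a b. 0 \<le> a \<longrightarrow> a \<le> b \<longrightarrow> b \<le> L \<longrightarrow> b - a < \<delta> \<longrightarrow>
      norm (t b - t a - (\<Theta> b - \<Theta> a) *\<^sub>R (frame a *v axis 2 1)) \<le>
        \<eta> * (V b - V a)" if "\<eta> > 0" for \<eta>
      unfolding t_def by (rule frame_stieltjes[OF that])
  qed
  show ?thesis
    unfolding D_measure_\<theta>
    using is_arc_length_curve_with_tantrix_c arc_length_curve_unique total_curvature_c by blast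
qed

lemma frame_axis_tendsto: "((\<lambda>s. frame s *v axis j 1) \<longlongrightarrow> axis j 1) (at_right 0)"
proof -
  have "((\<lambda>s. frame s *v axis j 1) \<longlongrightarrow> mat 1 *v axis j 1) (at_right 0)"
    unfolding matrix_vector_mult_basis column_def by (intro tendsto_intros frame_tendsto)
  then show ?thesis by simp
qed

end

theorem theorem2p5:
  fixes L :: real and \<theta> \<phi> :: "real \<Rightarrow> real"
  defines "I \<equiv> {0<..<L}"
  assumes "L > 0"
    and "continuous_BV_on I \<theta>"
    and "continuous_BV_on I \<phi>"
  shows "\<exists>G :: real \<Rightarrow> real^3^3.
    continuous_BV_SO3 I G \<and> solves_system L (Omega \<theta> \<phi>) G \<and>
    (\<forall>H. continuous_BV_SO3 I H \<and> solves_system L (Omega \<theta> \<phi>) H \<longrightarrow> (\<forall>s\<in>I. H s = G s)) \<and>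
    (let t = (\<lambda>s. G s *v axis 1 1); n = (\<lambda>s. G s *v axis 2 1); b = (\<lambda>s. G s *v axis 3 1);
         k = ae_deriv I \<theta>; \<tau> = ae_deriv I \<phi>
     in
       (AE s\<in>I in lborel.
          ae_vector_deriv I t s = k s *\<^sub>R n s \<and>
          ae_vector_deriv I n s = - k s *\<^sub>R t s + \<tau> s *\<^sub>R b s \<and>
          ae_vector_deriv I b s = - \<tau> s *\<^sub>R n s) \<and>
       (t \<longlongrightarrow> axis 1 1) (at_right 0) \<and> (n \<longlongrightarrow> axis 2 1) (at_right 0) \<and>
       (b \<longlongrightarrow> axis 3 1) (at_right 0) \<and>
       (strict_mono_on I \<theta> \<longrightarrow>
         (\<exists>c. is_arc_length_curve_with_tantrix L t c \<and>
              (\<forall>d. is_arc_length_curve_with_tantrix L t d \<longrightarrow>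
                 (\<exists>f. rigid_motion f \<and> (\<forall>s\<in>{0..L}. d s = f (c s)))) \<and>
              total_curvature c 0 L = ereal (D_measure I \<theta> I) \<and>
              D_measure I \<theta> I = Lim (at_left L) \<theta> - Lim (at_right 0) \<theta>)))"
proof -
  obtain M f g l where M: "atomless_interval_measure L M"
    "interval_measure.is_density L M f \<theta>" "interval_measure.is_density L M g \<phi>"
    "l \<in> borel_measurable M" "\<And>x. 0 \<le> l x" "density M (\<lambda>x. ennreal (l x)) = restrict_space lborel {0<..<L}"
    using ex_common_measure assms(3,4) unfolding I_def by blast
  interpret frame_data L M \<theta> \<phi> f g l
    using M assms by (simp add: frame_data_def frame_data_axioms_def)
  show ?thesis
    unfolding Let_def I_def
  proof (intro exI[of _ frame] conjI allI impI ballI)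
    show "H s = frame s" if "continuous_BV_SO3 {0<..<L} H \<and> solves_system L (Omega \<theta> \<phi>) H" "s \<in> {0<..<L}" for H s
      using that solves_system_unique by blast
    show "\<exists>c. is_arc_length_curve_with_tantrix L (\<lambda>s. frame s *v axis 1 1) c \<and>
              (\<forall>d. is_arc_length_curve_with_tantrix L (\<lambda>s. frame s *v axis 1 1) d \<longrightarrow>
                 (\<exists>f. rigid_motion f \<and> (\<forall>s\<in>{0..L}. d s = f (c s)))) \<and>
              total_curvature c 0 L = ereal (D_measure {0<..<L} \<theta> {0<..<L}) \<and>
              D_measure {0<..<L} \<theta> {0<..<L} = Lim (at_left L) \<theta> - Lim (at_right 0) \<theta>"
      if "strict_mono_on {0<..<L} \<theta>"
      \<comment> \<open>The measure of the interval and the one-sided limits both reduce to the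
        increment of \<Theta>.\<close>
      using curve_with_total_curvature[OF that] unfolding Lim_\<theta> D_measure_\<theta> by blast
  qed (rule continuous_BV_SO3_frame solves_system_frame Frenet_Serret frame_axis_tendsto)+
qed

end
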